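(* Let $\mathcal{C}_F$ be a plane branch with value semigroup $\Gamma_F=\langle v_0,\ldots,v_g\rangle$, $g\ge1$, defined by a Weierstrass polynomial $F\in\mathbb{C}\{x\}[y]$ satisfying $e_1=\gcd(v_0,v_1)<v_0=I(F,x)<v_1=I(F,y)$, and let $\lambda$ be its Zariski invariant. Let $\omega_{01}=v_0x\,dy-v_1y\,dx$ and $$\mathcal{D}_1=\left\{\omega_{01}+Q_1dx+Q_2dy:\ \begin{array}{l}Q_1,Q_2\in\mathbb{C}\{x\}[y],\ Q_1\in\langle x,y\rangle^2,\ Q_2\in\langle x^2,y\rangle,\\ \deg_yQ_1<\frac{v_0}{e_1},\ \deg_yQ_2<\frac{v_0}{e_1}-1,\ \mathrm{mult}_xQ_1(x,0)>\frac{v_1}{v_0}\end{array}\right\}.$$ Then $$\lambda=\max\{\nu(\omega)-v_0:\ \omega\in\mathcal{D}_1\}=\max\left\{I\left(F,\frac{\omega\wedge dF}{dx\wedge dy}\right)-(\mu_F+v_0-1):\ \omega\in\mathcal{D}_1\right\}.$$ In particular, $\lambda$ is determined considering foliations $\mathcal{F}_\omega$ with $\omega\in\mathcal{D}_1$.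
   Context: $F\in\mathbb{C}\{x\}[y]$ is an irreducible Weierstrass polynomial with $\deg_yF=\mathrm{mult}(F)=v_0>1$ and $\mathcal{C}_F=\{F=0\}$ has a primitive Puiseux parameterization $\varphi(t)=\left(t^{v_0},\sum_{k\ge v_1}c_kt^k\right)$ with $c_{v_1}\ne0$. $I(F,G)=\dim_{\mathbb{C}}\mathbb{C}\{x,y\}/\langle F,G\rangle=\mathrm{ord}_tG(\varphi(t))$ ($=\infty$ if $F\mid G$). The value semigroup $\Gamma_F=\{I(F,G):G\in\mathbb{C}\{x,y\}\}\subset\mathbb{N}\cup\{\infty\}$ has minimal system of generators $v_0<v_1<\cdots<v_g$. $\mu_F=\dim_{\mathbb{C}}\mathbb{C}\{x,y\}/\langle F_x,F_y\rangle$ is the Milnor number. For $\omega=A\,dx+B\,dy\in\Omega^1=\mathbb{C}\{x,y\}dx+\mathbb{C}\{x,y\}dy$, writing $\varphi(t)=(x(t),y(t))$, put $\varphi^*(\omega)=A(\varphi(t))x'(t)+B(\varphi(t))y'(t)$ and $\nu(\omega)=\mathrm{ord}_t(\varphi^*(\omega))+1$, with $\nu(\omega)=\infty$ if $\varphi^*(\omega)=0$. Put $\Lambda_F=\{\nu(\omega):\omega\in\Omega^1\}\supseteq\Gamma_F\setminus\{0\}$. The Zariski invariant of $\mathcal{C}_F$ is $\lambda=\min(\Lambda_F\setminus\Gamma_F)-v_0$, and $\lambda=\infty$ if $\Lambda_F\setminus\Gamma_F=\emptyset$. $\mathrm{mult}_xQ_1(x,0)$ is the order of vanishing of $Q_1(x,0)$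 at $x=0$ ($\infty$ if $Q_1(x,0)=0$). $\mathcal{F}_\omega$ denotes the foliation defined by $\omega=0$. *)

theory Defs
  imports "HOL-Analysis.Analysis" "HOL-Computational_Algebra.Computational_Algebra"
begin

text \<open>
  A power series in two variables is an element of \<open>complex fps fps\<close>: the outer variable is \<open>y\<close>,
  the inner one is \<open>x\<close>, so \<open>G $ j $ i\<close> is the coefficient of \<open>x ^ i * y ^ j\<close>. A polynomial in \<open>y\<close>
  over series in \<open>x\<close> is a \<open>complex fps poly\<close>, viewed as a series by \<open>fps_of_poly\<close>.
\<close>

definition conv_series :: "complex fps fps set" where
  "conv_series =
     {G. \<exists>r>0. (\<lambda>(i, j). norm (G $ j $ i) * r ^ (i + j)) summable_on (UNIV :: (nat \<times> nat) set)}"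

definition conv_polys :: "complex fps poly set" where
  "conv_polys = {P. \<forall>j. fps_conv_radius (coeff P j) > 0}"

abbreviation var_x :: "complex fps fps" where "var_x \<equiv> fps_const fps_X"
abbreviation var_y :: "complex fps fps" where "var_y \<equiv> fps_X"

definition partial_x :: "complex fps fps \<Rightarrow> complex fps fps" where
  "partial_x G = Abs_fps (\<lambda>j. fps_deriv (G $ j))"

definition partial_y :: "complex fps fps \<Rightarrow> complex fps fps" where
  "partial_y G = fps_deriv G"

definition fps_ord :: "complex fps \<Rightarrow> enat" where
  "fps_ord f = (if f = 0 then \<infinity> else enat (subdegree f))"

definition series_mult :: "complex fps fps \<Rightarrow> enat" where
  "series_mult G = Inf {enat (i + j) | i j. G $ j $ i \<noteq> 0}"

text \<open>
  The series \<open>G(a(t), b(t))\<close>. It is meant for \<open>a\<close> and \<open>b\<close> without constant term, so that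
  only \<open>i, j \<le> n\<close> contribute to the coefficient of \<open>t ^ n\<close>.
\<close>

definition subst_curve :: "complex fps fps \<Rightarrow> complex fps \<Rightarrow> complex fps \<Rightarrow> complex fps" where
  "subst_curve G a b = Abs_fps (\<lambda>n. \<Sum>i\<le>n. \<Sum>j\<le>n. G $ j $ i * (a ^ i * b ^ j) $ n)"

text \<open>The ideal of \<open>conv_series\<close> generated by a finite set \<open>S\<close>.\<close>

definition ideal_gen :: "complex fps fps set \<Rightarrow> complex fps fps set" where
  "ideal_gen S = {\<Sum>s\<in>S. a s * s | a. \<forall>s\<in>S. a s \<in> conv_series}"

text \<open>
  The dimension over the complex numbers of the quotient of \<open>conv_series\<close> by \<open>I\<close>: the supremum
  of the sizes of finite families whose classes modulo \<open>I\<close> are linearly independent.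
\<close>

definition quotient_dim :: "complex fps fps set \<Rightarrow> enat" where
  "quotient_dim I =
     Sup {enat (card B) | B. finite B \<and> B \<subseteq> conv_series \<and>
       (\<forall>c :: complex fps fps \<Rightarrow> complex.
          (\<Sum>b\<in>B. fps_const (fps_const (c b)) * b) \<in> I \<longrightarrow> (\<forall>b\<in>B. c b = 0))}"

definition intersection_mult :: "complex fps fps \<Rightarrow> complex fps fps \<Rightarrow> enat" where
  "intersection_mult G H = quotient_dim (ideal_gen {G, H})"

definition milnor_number :: "complex fps fps \<Rightarrow> enat" where
  "milnor_number G = quotient_dim (ideal_gen {partial_x G, partial_y G})"

definition value_semigroup :: "complex fps fps \<Rightarrow> enat set" where
  "value_semigroup F = {intersection_mult F G | G. G \<in> conv_series}"

definition irreducible_in :: "'a::comm_ring_1 set \<Rightarrow> 'a \<Rightarrow> bool" where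
  "irreducible_in R p \<longleftrightarrow> p \<in> R \<and> p \<noteq> 0 \<and> \<not> (\<exists>q\<in>R. p * q = 1) \<and>
     (\<forall>a\<in>R. \<forall>b\<in>R. p = a * b \<longrightarrow> (\<exists>q\<in>R. a * q = 1) \<or> (\<exists>q\<in>R. b * q = 1))"

definition weierstrass_poly :: "complex fps poly \<Rightarrow> bool" where
  "weierstrass_poly F \<longleftrightarrow>
     F \<in> conv_polys \<and> lead_coeff F = 1 \<and> (\<forall>j<degree F. coeff F j $ 0 = 0)"

definition semigroup_span :: "nat set \<Rightarrow> nat set" where
  "semigroup_span S = {\<Sum>s\<in>S. a s * s | a. True}"

text \<open>
  \<open>v 0 < \<dots> < v g\<close> is the minimal system of generators of \<open>\<Gamma>\<close>; the element \<open>\<infinity>\<close>, which every value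
  semigroup contains, is not counted among the generators.
\<close>

definition minimal_generators :: "enat set \<Rightarrow> nat \<Rightarrow> (nat \<Rightarrow> nat) \<Rightarrow> bool" where
  "minimal_generators \<Gamma> g v \<longleftrightarrow>
     strict_mono_on {..g} v \<and>
     \<Gamma> = insert \<infinity> (enat ` semigroup_span (v ` {..g})) \<and>
     (\<forall>i\<le>g. v i \<notin> semigroup_span (v ` ({..g} - {i})))"

text \<open>
  \<open>(t ^ n, y(t))\<close> is a primitive Puiseux parameterization of the curve \<open>F = 0\<close>, where \<open>y(t)\<close> has
  order \<open>m\<close>. Primitive means that it is not a series in \<open>t ^ d\<close> for any \<open>d > 1\<close>.
\<close>

definition primitive_puiseux :: "complex fps fps \<Rightarrow> nat \<Rightarrow> nat \<Rightarrow> complex fps \<Rightarrow> bool" where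
  "primitive_puiseux F n m y \<longleftrightarrow>
     fps_conv_radius y > 0 \<and> (\<forall>k<m. y $ k = 0) \<and> y $ m \<noteq> 0 \<and>
     Gcd (insert n {k. y $ k \<noteq> 0}) = 1 \<and>
     subst_curve F (fps_X ^ n) y = 0"

text \<open>The pair \<open>(A, B)\<close> is the differential form \<open>A dx + B dy\<close>.\<close>

type_synonym form = "complex fps fps \<times> complex fps fps"

definition forms :: "form set" where
  "forms = conv_series \<times> conv_series"

definition differential :: "complex fps fps \<Rightarrow> form" where
  "differential G = (partial_x G, partial_y G)"

text \<open>The coefficient of \<open>dx \<and> dy\<close> in the exterior product of two forms.\<close>

definition wedge_coeff :: "form \<Rightarrow> form \<Rightarrow> complex fps fps" where
  "wedge_coeff \<omega> \<eta> = fst \<omega> * snd \<eta> - snd \<omega> * fst \<eta>"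

definition form_pullback :: "complex fps \<Rightarrow> complex fps \<Rightarrow> form \<Rightarrow> complex fps" where
  "form_pullback a b \<omega> =
     subst_curve (fst \<omega>) a b * fps_deriv a + subst_curve (snd \<omega>) a b * fps_deriv b"

definition form_value :: "complex fps \<Rightarrow> complex fps \<Rightarrow> form \<Rightarrow> enat" where
  "form_value a b \<omega> = fps_ord (form_pullback a b \<omega>) + 1"

definition form_values :: "complex fps \<Rightarrow> complex fps \<Rightarrow> enat set" where
  "form_values a b = form_value a b ` forms"

text \<open>
  Differences are taken in \<^typ>\<open>ereal\<close>, as subtraction on \<^typ>\<open>enat\<close> truncates. The infimum of a
  nonempty set of \<^typ>\<open>enat\<close> is its minimum.
\<close>

definition zariski_invariant :: "complex fps fps \<Rightarrow> nat \<Rightarrow> complex fps \<Rightarrow> ereal" where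
  "zariski_invariant F n y =
     (let D = form_values (fps_X ^ n) y - value_semigroup F
      in if D = {} then \<infinity> else ereal_of_enat (Inf D) - ereal (real n))"

text \<open>
  The forms \<open>n x dy - m y dx + Q1 dx + Q2 dy\<close> with the stated conditions on \<open>Q1\<close> and \<open>Q2\<close>.
  The division \<open>n div gcd n m\<close> is exact. The subtraction in the bound for \<open>Q2\<close> does not
  truncate if \<open>n > 0\<close>.
\<close>

definition forms_D1 :: "nat \<Rightarrow> nat \<Rightarrow> form set" where
  "forms_D1 n m =
     {(- (of_nat m * var_y) + fps_of_poly Q1, of_nat n * var_x + fps_of_poly Q2) | Q1 Q2.
        Q1 \<in> conv_polys \<and> Q2 \<in> conv_polys \<and>
        fps_of_poly Q1 \<in> ideal_gen {var_x ^ 2, var_x * var_y, var_y ^ 2} \<and>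
        fps_of_poly Q2 \<in> ideal_gen {var_x ^ 2, var_y} \<and>
        degree Q1 < n div gcd n m \<and>
        degree Q2 < n div gcd n m - 1 \<and>
        ereal_of_enat (fps_ord (poly Q1 0)) > ereal (real m / real n)}"

definition is_maximum :: "'a::linorder set \<Rightarrow> 'a \<Rightarrow> bool" where
  "is_maximum S m \<longleftrightarrow> m \<in> S \<and> (\<forall>s\<in>S. s \<le> m)"

end

theory Submission
  imports Defs "HOL-Computational_Algebra.Field_as_Ring"
begin

text \<open>
  Let \<open>F(t ^ n, y(t)) = 0\<close> with \<open>m = ord y\<close>. Over the series in \<open>t\<close> the polynomial \<open>F\<close> is the product
  of the factors \<open>Y - y(\<zeta> ^ i * t)\<close> with \<open>\<zeta> ^ n = 1\<close>. Peeling off one factor at a time gives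
  \<open>I(F, G) = ord G(t ^ n, y(t))\<close>. The same argument with the Puiseux roots \<open>z\<close> of \<open>F_y\<close> gives
  \<open>I(F, F_y) = \<mu> + n - 1\<close>, because \<open>d/du F(u ^ N, z(u)) = N * u ^ (N - 1) * F_x(u ^ N, z(u))\<close>.
  On the curve \<open>\<omega> \<and> dF\<close> is \<open>F_y\<close> times the pullback of \<open>\<omega>\<close> divided by \<open>n * t ^ (n - 1)\<close>, so the two
  maxima agree.

  Give \<open>x\<close> and \<open>y\<close> the weights \<open>n\<close> and \<open>m\<close>. Every weighted homogeneous form is a combination of an
  exact form and a multiple of \<open>n x dy - m y dx\<close>, which is the initial part of every \<open>\<omega>\<close> in the family.
  Hence every form \<open>\<eta>\<close> is \<open>dh + g * \<omega>\<close> up to terms of high weight, and if \<open>\<eta>\<close> had a smaller value than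
  \<open>\<omega>\<close>, this value would be that of \<open>dh\<close>, an element of the semigroup. So no \<open>\<omega>\<close> exceeds the least value
  outside the semigroup.

  Conversely a value \<open>n * a + m * b\<close> can be increased by subtracting a monomial form. Below the first
  exponent that sees the coefficients of \<open>y\<close> outside the multiples of \<open>gcd n m\<close>, which bounds the values of
  the family, all elements of the semigroup have this form. If \<open>gcd n m = 1\<close>, values may grow beyond the
  conductor; then Lagrange interpolation produces a convergent form of the family that vanishes on the curve.
\<close>

unbundle no vec_syntax
no_notation vector_scalar_mult (infixl "*s" 70)

section \<open>Codimension of subspaces\<close>

text \<open>The multiplicities are suprema over convergent families modulo convergent ideals, while
  the Puiseux roots that compute them come from Hensel's lemma without any control of convergence.
  Lengths are therefore computed over formal series, where substituting \<open>t ^ N\<close> for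
  \<open>x\<close> multiplies a length by \<open>N\<close>. Only the finished number is carried back
  to convergent series, which works because an ideal of finite codimension contains all series of
  high order. The degree bounds of the family make values controllable: for
  \<open>b < n div gcd n m\<close> distinct monomials have distinct weights
  \<open>n * a + m * b\<close>, so a polynomial of such low degree in \<open>y\<close> suffers no
  cancellation on the curve. Reduction modulo a monic polynomial of degree
  \<open>n div gcd n m\<close> with large order on the curve brings every small semigroup value to
  this shape, and the monomial form needed for the correction stays inside the family. If
  \<open>gcd n m = 1\<close>, infinitely many corrections may be possible, and their limit is a
  priori only formal; hence the separate construction of a convergent form.\<close>

definition indep_mod :: "('a::field \<Rightarrow> 'b::ab_group_add \<Rightarrow> 'b) \<Rightarrow> 'b set \<Rightarrow> (nat \<Rightarrow> 'b) \<Rightarrow> nat \<Rightarrow> bool" where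
  "indep_mod s W b d \<longleftrightarrow> (\<forall>c. (\<Sum>i<d. s (c i) (b i)) \<in> W \<longrightarrow> (\<forall>i<d. c i = 0))"

text \<open>A basis of \<open>V\<close> modulo \<open>W\<close> by representatives. Unlike the
  supremum in \<open>codim\<close>, this relation can be followed through exact sequences;
  \<open>codim_eq\<close> links the two.\<close>

definition has_codim :: "('a::field \<Rightarrow> 'b::ab_group_add \<Rightarrow> 'b) \<Rightarrow> 'b set \<Rightarrow> 'b set \<Rightarrow> nat \<Rightarrow> bool" where
  "has_codim s V W d \<longleftrightarrow> (\<exists>b. (\<forall>i<d. b i \<in> V) \<and> indep_mod s W b d \<and>
     (\<forall>v\<in>V. \<exists>c. v - (\<Sum>i<d. s (c i) (b i)) \<in> W))"

definition codim :: "('a::field \<Rightarrow> 'b::ab_group_add \<Rightarrow> 'b) \<Rightarrow> 'b set \<Rightarrow> 'b set \<Rightarrow> enat" where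
  "codim s V W = Sup {enat (card B) | B. finite B \<and> B \<subseteq> V \<and>
     (\<forall>c. (\<Sum>b\<in>B. s (c b) b) \<in> W \<longrightarrow> (\<forall>b\<in>B. c b = 0))}"

context vector_space begin

text \<open>A relation among the \<open>b'\<close> is, up to an element of \<open>W\<close>, a
  relation among the \<open>b\<close>. So independence modulo \<open>W\<close> survives a change of
  representatives and becomes ordinary independence.\<close>

lemma indep_mod_inj:
  fixes k :: nat
  assumes W: "subspace W" and ind: "indep_mod scale W b k"
    and b': "\<And>i. i < k \<Longrightarrow> b i - b' i \<in> W"
  shows "inj_on b' {..<k}" "independent (b' ` {..<k})"
proof -
  have red: "\<forall>i<k. c i = 0" if "(\<Sum>i<k. c i *s b' i) = 0" for c
  proof -
    have "(\<Sum>i<k. c i *s b i) = (\<Sum>i<k. c i *s (b i - b' i)) + (\<Sum>i<k. c i *s b' i)"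
      by (simp add: scale_right_diff_distrib sum_subtractf)
    also have "\<dots> \<in> W" using that W b'
      by (auto intro!: subspace_sum subspace_scale)
    finally show ?thesis using ind by (simp add: indep_mod_def)
  qed
  show inj: "inj_on b' {..<k}"
  proof (rule inj_onI, rule ccontr)
    fix i j assume ij: "i \<in> {..<k}" "j \<in> {..<k}" "b' i = b' j" "i \<noteq> j"
    define c where "c = (\<lambda>l. if l = i then 1 else if l = j then - 1 else 0 :: 'a)"
    have "(\<Sum>l<k. c l *s b' l) = (\<Sum>l\<in>{i,j}. c l *s b' l)"
      by (rule sum.mono_neutral_right) (use ij in \<open>auto simp: c_def\<close>)
    also have "\<dots> = 0" using ij by (simp add: c_def)
    finally have "c i = 0" using red ij by auto
    then show False by (simp add: c_def)
  qed
  show "independent (b' ` {..<k})"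
  proof (rule independent_if_scalars_zero)
    fix f x assume s: "(\<Sum>x\<in>b' ` {..<k}. f x *s x) = 0" and x: "x \<in> b' ` {..<k}"
    have "(\<Sum>i<k. f (b' i) *s b' i) = 0" using s inj by (simp add: sum.reindex)
    from red[OF this] x show "f x = 0" by auto
  qed auto
qed

text \<open>Each \<open>b i\<close> is moved within its class into the span of \<open>t\<close>. The
  moved vectors are independent in the ordinary sense, and the usual exchange bound applies.\<close>

lemma steinitz_mod:
  fixes k d :: nat
  assumes W: "subspace W" and ind: "indep_mod scale W b k"
    and span: "\<And>i. i < k \<Longrightarrow> \<exists>c. b i - (\<Sum>j<d. c j *s t j) \<in> W"
  shows "k \<le> d"
proof -
  have "\<exists>C. \<forall>i<k. b i - (\<Sum>j<d. C i j *s t j) \<in> W" using span by metis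
  then obtain C where C: "\<And>i. i < k \<Longrightarrow> b i - (\<Sum>j<d. C i j *s t j) \<in> W" by blast
  define b' where "b' = (\<lambda>i. \<Sum>j<d. C i j *s t j)"
  note i = indep_mod_inj[OF W ind, of b', unfolded b'_def, OF C, folded b'_def]
  have "b' ` {..<k} \<subseteq> span (t ` {..<d})"
    unfolding b'_def by (intro image_subsetI span_sum span_scale span_base) auto
  then have "card (b' ` {..<k}) \<le> card (t ` {..<d})"
    using independent_span_bound i(2) by blast
  then show ?thesis using i(1) card_image_le[of "{..<d}" t] by (simp add: card_image)
qed

lemma indep_family_set:
  assumes "finite B" "\<forall>c. (\<Sum>b\<in>B. c b *s b) \<in> W \<longrightarrow> (\<forall>b\<in>B. c b = 0)"
  obtains f where "bij_betw f {..<card B} B"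
    "indep_mod scale W f (card B)"
proof -
  obtain f where f: "bij_betw f {..<card B} B"
    using ex_bij_betw_nat_finite[OF assms(1)] by (auto simp: atLeast0LessThan)
  show ?thesis
  proof (rule that[OF f], unfold indep_mod_def, intro allI impI)
    fix c i assume i: "i < card B" and c: "(\<Sum>i<card B. c i *s f i) \<in> W"
    let ?g = "inv_into {..<card B} f"
    have "(\<Sum>b\<in>B. c (?g b) *s b) = (\<Sum>i<card B. c (?g (f i)) *s f i)"
      using sum.reindex_bij_betw[OF f, of "\<lambda>b. c (?g b) *s b"] by simp
    also have "\<dots> = (\<Sum>i<card B. c i *s f i)"
      using f by (intro sum.cong) (auto simp: bij_betw_def)
    finally have "(\<Sum>b\<in>B. c (?g b) *s b) \<in> W" using c by simp
    then have "\<forall>b\<in>B. c (?g b) = 0" using assms(2)[rule_format, of "\<lambda>b. c (?g b)"] by blast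
    moreover have "?g (f i) = i" "f i \<in> B" using f i by (auto simp: bij_betw_def)
    ultimately show "c i = 0" by metis
  qed
qed

lemma has_codim_imp_bound:
  assumes "subspace W" "has_codim scale V W d"
    "indep_mod scale W b k" "\<And>i. i < k \<Longrightarrow> b i \<in> V"
  shows "k \<le> d"
proof -
  from assms(2) obtain t where "\<And>v. v \<in> V \<Longrightarrow> \<exists>c. v - (\<Sum>i<d. c i *s t i) \<in> W"
    unfolding has_codim_def by blast
  with assms(4) have "\<And>i. i < k \<Longrightarrow> \<exists>c. b i - (\<Sum>j<d. c j *s t j) \<in> W" by blast
  with steinitz_mod[OF assms(1,3)] show ?thesis by blast
qed

lemma indep_family_codim:
  assumes W: "subspace W" and b: "\<And>i. i < d \<Longrightarrow> b i \<in> V"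
    and ind: "indep_mod scale W b d"
  shows "enat d \<le> codim scale V W"
proof -
  have inj: "inj_on b {..<d}" using indep_mod_inj(1)[OF W ind, of b] W by (simp add: subspace_0)
  have "\<forall>x\<in>b ` {..<d}. c x = 0" if "(\<Sum>x\<in>b ` {..<d}. c x *s x) \<in> W" for c
    using ind[unfolded indep_mod_def, rule_format, of "c \<circ> b"] that inj by (auto simp: sum.reindex)
  then have "enat d \<in> {enat (card B) | B. finite B \<and> B \<subseteq> V \<and>
     (\<forall>c. (\<Sum>b\<in>B. c b *s b) \<in> W \<longrightarrow> (\<forall>b\<in>B. c b = 0))}"
    using inj b by (intro CollectI exI[of _ "b ` {..<d}"]) (auto simp: card_image)
  then show ?thesis unfolding codim_def by (rule Sup_upper)
qed

lemma codim_eq: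
  assumes W: "subspace W" and h: "has_codim scale V W d"
  shows "codim scale V W = enat d"
proof (rule antisym)
  show "codim scale V W \<le> enat d" unfolding codim_def
  proof (rule Sup_least, clarify)
    fix B assume B: "finite B" "B \<subseteq> V" "\<forall>c. (\<Sum>b\<in>B. c b *s b) \<in> W \<longrightarrow> (\<forall>b\<in>B. c b = 0)"
    obtain f where f: "bij_betw f {..<card B} B"
      "indep_mod scale W f (card B)"
      using indep_family_set[OF B(1,3)] by blast
    show "enat (card B) \<le> enat d"
      using has_codim_imp_bound[OF W h f(2)] f(1) B(2) by (auto simp: bij_betw_def)
  qed
  show "enat d \<le> codim scale V W"
    using h indep_family_codim[OF W] unfolding has_codim_def by meson
qed

lemma has_codim_unique:
  "subspace W \<Longrightarrow> has_codim scale V W d \<Longrightarrow> has_codim scale V W d' \<Longrightarrow> d = d'"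
  using codim_eq[of W V d] codim_eq[of W V d'] by simp

text \<open>The bound \<open>K\<close> provides an independent family of maximal length, and
  maximality forces it to span: a vector outside could be appended.\<close>

lemma has_codim_exists:
  assumes W: "subspace W"
    and bd: "\<And>k b. (\<And>i. i < k \<Longrightarrow> b i \<in> V) \<Longrightarrow>
      indep_mod scale W b k \<Longrightarrow> k \<le> K"
  shows "\<exists>d. has_codim scale V W d"
proof -
  define P where "P = (\<lambda>k. \<exists>b. (\<forall>i<k. b i \<in> V) \<and> indep_mod scale W b k)"
  have P0: "P 0" by (simp add: P_def indep_mod_def)
  have PK: "\<And>k. P k \<Longrightarrow> k \<le> K" unfolding P_def using bd by blast
  define d where "d = (GREATEST k. P k)"
  have "P d" unfolding d_def using P0 PK by (rule GreatestI_nat)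
  have nP: "\<not> P (Suc d)" using Greatest_le_nat[of P "Suc d" K] PK unfolding d_def by auto
  from \<open>P d\<close> obtain b where b: "\<And>i. i < d \<Longrightarrow> b i \<in> V"
    "indep_mod scale W b d" unfolding P_def by blast
  have "\<exists>c. v - (\<Sum>i<d. c i *s b i) \<in> W" if v: "v \<in> V" for v
  proof (rule ccontr)
    assume nv: "\<nexists>c. v - (\<Sum>i<d. c i *s b i) \<in> W"
    define b' where "b' = b(d := v)"
    have "\<forall>i<Suc d. c i = 0" if c: "(\<Sum>i<Suc d. c i *s b' i) \<in> W" for c
    proof -
      have e: "(\<Sum>i<Suc d. c i *s b' i) = (\<Sum>i<d. c i *s b i) + c d *s v"
        by (simp add: b'_def)
      have "c d = 0"
      proof (rule ccontr)
        assume nz: "c d \<noteq> 0"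
        have "inverse (c d) *s ((\<Sum>i<d. c i *s b i) + c d *s v) \<in> W"
          using c e W subspace_scale by simp
        also have "inverse (c d) *s ((\<Sum>i<d. c i *s b i) + c d *s v)
          = v - (\<Sum>i<d. (- inverse (c d) * c i) *s b i)"
          using nz by (simp add: scale_right_distrib scale_sum_right sum_negf)
        finally have "\<exists>c. v - (\<Sum>i<d. c i *s b i) \<in> W"
          by (intro exI[of _ "\<lambda>i. - inverse (c d) * c i"])
        with nv show False ..
      qed
      then show ?thesis using b(2)[unfolded indep_mod_def, rule_format, of c] c e by (auto simp: less_Suc_eq)
    qed
    moreover have "\<forall>i<Suc d. b' i \<in> V" using b(1) v by (auto simp: b'_def less_Suc_eq)
    ultimately show False using nP unfolding P_def indep_mod_def by blast
  qed
  then show ?thesis using b unfolding has_codim_def by blast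
qed

text \<open>The two bases are concatenated. A relation modulo \<open>U\<close> is first read modulo
  \<open>W\<close>, which kills the coefficients of \<open>b1\<close>; what remains is a relation
  among the \<open>b2\<close>.\<close>

lemma has_codim_trans:
  assumes sub: "U \<subseteq> W" "W \<subseteq> V" and U: "subspace U" and W: "subspace W"
    and h1: "has_codim scale V W p" and h2: "has_codim scale W U q"
  shows "has_codim scale V U (p + q)"
proof -
  obtain b1 where b1: "\<And>i. i < p \<Longrightarrow> b1 i \<in> V" "indep_mod scale W b1 p"
    "\<And>v. v \<in> V \<Longrightarrow> \<exists>c. v - (\<Sum>i<p. c i *s b1 i) \<in> W" using h1 unfolding has_codim_def by blast
  obtain b2 where b2: "\<And>i. i < q \<Longrightarrow> b2 i \<in> W" "indep_mod scale U b2 q"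
    "\<And>v. v \<in> W \<Longrightarrow> \<exists>c. v - (\<Sum>i<q. c i *s b2 i) \<in> U" using h2 unfolding has_codim_def by blast
  define b where "b = (\<lambda>i. if i < p then b1 i else b2 (i - p))"
  have sp: "(\<Sum>i<p+q. c i *s b i) = (\<Sum>i<p. c i *s b1 i) + (\<Sum>i<q. c (p + i) *s b2 i)" for c
  proof -
    have "(\<Sum>i<p+k. c i *s b i) = (\<Sum>i<p. c i *s b1 i) + (\<Sum>i<k. c (p + i) *s b2 i)" for k
      by (induction k) (simp_all add: b_def add.assoc)
    then show ?thesis .
  qed
  show ?thesis unfolding has_codim_def indep_mod_def
  proof (intro exI[of _ b] conjI allI impI ballI)
    show "b i \<in> V" if "i < p + q" for i using that b1(1) b2(1) sub by (auto simp: b_def)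
    fix c i assume s: "(\<Sum>i<p + q. c i *s b i) \<in> U" and i: "i < p + q"
    have w2: "(\<Sum>i<q. c (p + i) *s b2 i) \<in> W" using b2(1) W by (auto intro!: subspace_sum subspace_scale)
    have "(\<Sum>i<p. c i *s b1 i) = (\<Sum>i<p + q. c i *s b i) - (\<Sum>i<q. c (p + i) *s b2 i)" by (simp add: sp)
    also have "\<dots> \<in> W" using s w2 sub W by (auto intro: subspace_diff)
    finally have z: "\<forall>i<p. c i = 0" using b1(2) by (simp add: indep_mod_def)
    then have "(\<Sum>i<q. c (p + i) *s b2 i) \<in> U" using s by (simp add: sp)
    with b2(2)[unfolded indep_mod_def, rule_format, of "\<lambda>i. c (p + i)"] have "\<forall>i<q. c (p + i) = 0" by blast
    moreover have "i = p + (i - p)" "i - p < q" if "\<not> i < p" using that i by auto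
    ultimately show "c i = 0" using z by metis
  next
    fix v assume "v \<in> V"
    then obtain c1 where c1: "v - (\<Sum>i<p. c1 i *s b1 i) \<in> W" using b1(3) by blast
    then obtain c2 where c2: "v - (\<Sum>i<p. c1 i *s b1 i) - (\<Sum>i<q. c2 i *s b2 i) \<in> U" using b2(3) by blast
    define c where "c = (\<lambda>i. if i < p then c1 i else c2 (i - p))"
    have "v - (\<Sum>i<p+q. c i *s b i) \<in> U" using c2 unfolding sp by (simp add: c_def algebra_simps)
    then show "\<exists>c. v - (\<Sum>i<p+q. c i *s b i) \<in> U" by blast
  qed
qed

lemma has_codim_refl: "subspace V \<Longrightarrow> has_codim scale V V 0"
  unfolding has_codim_def indep_mod_def by auto

end

context vector_space_pair begin

text \<open>\<open>f\<close> induces an isomorphism from \<open>V\<close> modulo the preimage of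
  \<open>W2\<close> to \<open>V2\<close> modulo \<open>W2\<close>, surjective by the assumption on
  \<open>V2\<close>. Here a basis is pushed forward along it.\<close>

lemma has_codim_image:
  assumes f: "Vector_Spaces.linear s1 s2 f" and W2: "vs2.subspace W2" 
    and fV: "\<And>v. v \<in> V \<Longrightarrow> f v \<in> V2" and V2: "\<And>z. z \<in> V2 \<Longrightarrow> \<exists>v\<in>V. z - f v \<in> W2"
    and h: "has_codim s1 V (V \<inter> f -` W2) d" and V: "vs1.subspace V"
  shows "has_codim s2 V2 W2 d"
proof -
  interpret f: Vector_Spaces.linear s1 s2 f by (rule f)
  obtain b where b: "\<And>i. i < d \<Longrightarrow> b i \<in> V"
    "indep_mod s1 (V \<inter> f -` W2) b d"
    "\<And>v. v \<in> V \<Longrightarrow> \<exists>c. v - (\<Sum>i<d. s1 (c i) (b i)) \<in> V \<inter> f -` W2"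
    using h unfolding has_codim_def by blast
  have fs: "f (\<Sum>i<d. s1 (c i) (b i)) = (\<Sum>i<d. s2 (c i) (f (b i)))" for c
    by (simp add: f.sum f.scale)
  show ?thesis unfolding has_codim_def indep_mod_def
  proof (intro exI[of _ "f \<circ> b"] conjI allI impI ballI)
    show "(f \<circ> b) i \<in> V2" if "i < d" for i using that b fV by simp
    fix c i assume "(\<Sum>i<d. s2 (c i) ((f \<circ> b) i)) \<in> W2" "i < d"
    then show "c i = 0" using b(2)[unfolded indep_mod_def, rule_format, of c i] b(1) fs[of c] V
      by (auto intro!: vs1.subspace_sum vs1.subspace_scale)
  next
    fix z assume "z \<in> V2"
    then obtain v where v: "v \<in> V" "z - f v \<in> W2" using V2 by blast
    then obtain c where c: "v - (\<Sum>i<d. s1 (c i) (b i)) \<in> V \<inter> f -` W2" using b(3) by blast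
    have "z - (\<Sum>i<d. s2 (c i) ((f \<circ> b) i)) = (z - f v) + f (v - (\<Sum>i<d. s1 (c i) (b i)))"
      by (simp add: f.diff fs)
    also have "\<dots> \<in> W2" using v c W2 by (auto intro: vs2.subspace_add)
    finally show "\<exists>c. z - (\<Sum>i<d. s2 (c i) ((f \<circ> b) i)) \<in> W2" by blast
  qed
qed

text \<open>The same isomorphism in the other direction: basis elements are lifted, each up to an
  error in \<open>W2\<close>.\<close>

lemma has_codim_preimage:
  assumes f: "Vector_Spaces.linear s1 s2 f" and W2: "vs2.subspace W2" 
    and fV: "\<And>v. v \<in> V \<Longrightarrow> f v \<in> V2" and V2: "\<And>z. z \<in> V2 \<Longrightarrow> \<exists>v\<in>V. z - f v \<in> W2"
    and h: "has_codim s2 V2 W2 d" and V: "vs1.subspace V"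
  shows "has_codim s1 V (V \<inter> f -` W2) d"
proof -
  interpret f: Vector_Spaces.linear s1 s2 f by (rule f)
  obtain b where b: "\<And>i. i < d \<Longrightarrow> b i \<in> V2"
    "indep_mod s2 W2 b d"
    "\<And>v. v \<in> V2 \<Longrightarrow> \<exists>c. v - (\<Sum>i<d. s2 (c i) (b i)) \<in> W2"
    using h unfolding has_codim_def by blast
  have "\<exists>a. \<forall>i<d. a i \<in> V \<and> b i - f (a i) \<in> W2" using V2 b(1) bchoice[of "{..<d}" "\<lambda>i a. a \<in> V \<and> b i - f a \<in> W2"]
    by (auto simp: Bex_def)
  then obtain a where a: "\<And>i. i < d \<Longrightarrow> a i \<in> V" "\<And>i. i < d \<Longrightarrow> b i - f (a i) \<in> W2" by blast
  have sV: "(\<Sum>i<d. s1 (c i) (a i)) \<in> V" for c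
    using a V by (auto intro!: vs1.subspace_sum vs1.subspace_scale)
  have fs: "(\<Sum>i<d. s2 (c i) (b i)) - f (\<Sum>i<d. s1 (c i) (a i)) \<in> W2" for c
  proof -
    have "(\<Sum>i<d. s2 (c i) (b i)) - f (\<Sum>i<d. s1 (c i) (a i)) = (\<Sum>i<d. s2 (c i) (b i - f (a i)))"
      by (simp add: f.sum f.scale sum_subtractf vs2.scale_right_diff_distrib)
    also have "\<dots> \<in> W2" using a W2 by (auto intro!: vs2.subspace_sum vs2.subspace_scale)
    finally show ?thesis .
  qed
  show ?thesis unfolding has_codim_def indep_mod_def
  proof (intro exI[of _ a] conjI allI impI ballI)
    show "a i \<in> V" if "i < d" for i using that a by simp
    fix c i assume "(\<Sum>i<d. s1 (c i) (a i)) \<in> V \<inter> f -` W2" and i: "i < d"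
    then have "f (\<Sum>i<d. s1 (c i) (a i)) \<in> W2" by simp
    from vs2.subspace_add[OF W2 fs[of c] this] show "c i = 0" using b(2)[unfolded indep_mod_def, rule_format, of c i] i by simp
  next
    fix v assume v: "v \<in> V"
    then obtain c where c: "f v - (\<Sum>i<d. s2 (c i) (b i)) \<in> W2" using b(3) fV by blast
    have "f (v - (\<Sum>i<d. s1 (c i) (a i))) \<in> W2"
      using vs2.subspace_add[OF W2 c fs[of c]] by (simp add: f.diff)
    then have "v - (\<Sum>i<d. s1 (c i) (a i)) \<in> V \<inter> f -` W2" using v sV V by (auto intro: vs1.subspace_diff)
    then show "\<exists>c. v - (\<Sum>i<d. s1 (c i) (a i)) \<in> V \<inter> f -` W2" by blast
  qed
qed

end

section \<open>Substitution of a curve\<close>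

abbreviation cst :: "complex \<Rightarrow> complex fps fps" where "cst c \<equiv> fps_const (fps_const c)"

lemma fps_X_power_dvd_iff: "fps_X ^ k dvd (f :: 'a::comm_ring_1 fps) \<longleftrightarrow> (\<forall>i<k. f $ i = 0)"
proof
  assume "fps_X ^ k dvd f"
  then obtain g where "f = fps_X ^ k * g" ..
  then show "\<forall>i<k. f $ i = 0" by (simp add: fps_X_power_mult_nth)
next
  assume "\<forall>i<k. f $ i = 0"
  then have "f = fps_X ^ k * fps_shift k f" by (intro fps_ext) (simp add: fps_X_power_mult_nth)
  then show "fps_X ^ k dvd f" by (rule dvdI)
qed

lemma fps_X_dvd_iff: "fps_X dvd (f :: 'a::comm_ring_1 fps) \<longleftrightarrow> f $ 0 = 0"
  using fps_X_power_dvd_iff[of 1 f] by simp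

lemma fps_eq_0_if_X_power_dvd:
  "(\<And>k. fps_X ^ k dvd (f :: 'a::comm_ring_1 fps)) \<Longrightarrow> f = 0"
  by (intro fps_ext) (auto simp: fps_X_power_dvd_iff)

lemma fps_split: "G = fps_const (G $ 0) + fps_X * fps_shift 1 (G :: 'a::comm_ring_1 fps)"
  by (intro fps_ext) (auto simp: fps_X_mult_nth)

lemma fps_fps_split:
  "G = cst (G $ 0 $ 0) + var_x * fps_const (fps_shift 1 (G $ 0)) + var_y * fps_shift 1 G"
proof -
  have "fps_const (G $ 0) = cst (G $ 0 $ 0) + var_x * fps_const (fps_shift 1 (G $ 0))"
    by (simp only: fps_const_add fps_const_mult fps_split[symmetric])
  then show ?thesis using fps_split[of G] by simp
qed

text \<open>Substitution is determined by how it treats constants and multiplication by \<open>x\<close> and \<open>y\<close>: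
  the difference of two candidates is divisible by every power of the parameter.\<close>

lemma vanishing_operator:
  fixes D :: "complex fps fps \<Rightarrow> 'a::comm_ring_1 fps"
  assumes add: "\<And>G H. D (G + H) = D G + D H" and cst: "\<And>c. D (cst c) = 0"
    and x: "\<And>G. D (var_x * G) = a * D G" and y: "\<And>G. D (var_y * G) = b * D G"
    and a: "fps_X dvd a" and b: "fps_X dvd b"
  shows "D G = 0"
proof (rule fps_eq_0_if_X_power_dvd)
  show "fps_X ^ k dvd D G" for k
  proof (induction k arbitrary: G)
    case (Suc k)
    have "D G = a * D (fps_const (fps_shift 1 (G $ 0))) + b * D (fps_shift 1 G)"
      by (subst fps_fps_split) (simp only: add cst x y add_0_left)
    then show ?case using Suc a b by (auto intro!: dvd_add mult_dvd_mono)
  qed simp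
qed

lemma monomial_nth_eq_0:
  fixes a b :: "complex fps"
  assumes "fps_X ^ p dvd a" "fps_X ^ q dvd b" "N < p * i + q * j"
  shows "(a ^ i * b ^ j) $ N = 0"
proof -
  have "(fps_X ^ p) ^ i * (fps_X ^ q) ^ j dvd a ^ i * b ^ j"
    using assms by (intro mult_dvd_mono dvd_power_same) 
  then have "fps_X ^ (p * i + q * j) dvd a ^ i * b ^ j" by (simp add: power_mult power_add)
  then show ?thesis using assms(3) by (simp add: fps_X_power_dvd_iff)
qed

text \<open>A monomial of degree above \<open>n\<close> does not reach the coefficient of
  \<open>t ^ n\<close>, so both ranges may be enlarged independently. Multiplication by one variable
  shifts only one of them, which is where unequal bounds arise.\<close>

lemma subst_nth:
  assumes ab: "fps_X dvd a" "fps_X dvd b" and n: "n \<le> M" "n \<le> L"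
  shows "subst_curve G a b $ n = (\<Sum>i\<le>M. \<Sum>j\<le>L. G $ j $ i * (a ^ i * b ^ j) $ n)"
proof -
  have z: "(a ^ i * b ^ j) $ n = 0" if "n < i + j" for i j
    using monomial_nth_eq_0[of 1 a 1 b n i j] ab that by simp
  have "(\<Sum>i\<le>M. \<Sum>j\<le>L. G $ j $ i * (a ^ i * b ^ j) $ n) = (\<Sum>i\<le>n. \<Sum>j\<le>L. G $ j $ i * (a ^ i * b ^ j) $ n)"
    by (rule sum.mono_neutral_right) (use n z in \<open>auto intro!: sum.neutral\<close>)
  also have "\<dots> = (\<Sum>i\<le>n. \<Sum>j\<le>n. G $ j $ i * (a ^ i * b ^ j) $ n)"
    by (intro sum.cong sum.mono_neutral_right) (use n z in \<open>auto\<close>)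
  finally show ?thesis by (simp add: subst_curve_def)
qed

lemma subst_add: "subst_curve (G + H) a b = subst_curve G a b + subst_curve H a b"
  by (intro fps_ext) (simp add: subst_curve_def sum.distrib algebra_simps)

lemma subst_cst [simp]: "subst_curve (cst c) a b = fps_const c"
proof (intro fps_ext)
  fix n
  have "subst_curve (cst c) a b $ n = (\<Sum>i\<in>{0}. \<Sum>j\<in>{0}. cst c $ j $ i * (a ^ i * b ^ j) $ n)"
    unfolding subst_curve_def fps_nth_Abs_fps
    by (rule sum.mono_neutral_cong_right) (auto intro!: sum.neutral sum.mono_neutral_right)
  then show "subst_curve (cst c) a b $ n = fps_const c $ n" by simp
qed

lemma subst_0 [simp]: "subst_curve 0 a b = 0"
  by (simp add: subst_curve_def fps_eq_iff)

lemma subst_1 [simp]: "subst_curve 1 a b = 1"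
  using subst_cst[of 1] by simp

lemma mult_sum_nth:
  "(a * h) $ n = (\<Sum>k\<le>n. (a $ k) * (h $ (n - k) :: 'a::comm_ring_1))"
  by (simp add: fps_mult_nth atLeast0AtMost)

lemma subst_var_mult_aux:
  assumes ab: "fps_X dvd a" "fps_X dvd b"
  shows "(\<Sum>i\<le>n. \<Sum>j\<le>n. G $ j $ i * (h * (a ^ i * b ^ j)) $ n) = (h * subst_curve G a b) $ n"
proof -
  have "(h * subst_curve G a b) $ n = (\<Sum>k\<le>n. h $ k * (\<Sum>i\<le>n. \<Sum>j\<le>n. G $ j $ i * (a ^ i * b ^ j) $ (n - k)))"
    by (subst mult_sum_nth, rule sum.cong[OF refl], subst subst_nth[OF ab, of _ n n]) simp_all
  also have "\<dots> = (\<Sum>i\<le>n. \<Sum>j\<le>n. \<Sum>k\<le>n. G $ j $ i * (h $ k * (a ^ i * b ^ j) $ (n - k)))"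
    unfolding sum_distrib_left mult.left_commute[of "h $ _"]
    by (subst sum.swap, rule sum.cong[OF refl], subst sum.swap, rule refl)
  also have "\<dots> = (\<Sum>i\<le>n. \<Sum>j\<le>n. G $ j $ i * (h * (a ^ i * b ^ j)) $ n)"
    by (simp add: mult_sum_nth sum_distrib_left)
  finally show ?thesis ..
qed

lemma subst_var_y_mult:
  assumes ab: "fps_X dvd a" "fps_X dvd b"
  shows "subst_curve (var_y * G) a b = b * subst_curve G a b"
proof (intro fps_ext)
  fix n
  have "subst_curve (var_y * G) a b $ n = (\<Sum>i\<le>n. \<Sum>j\<le>Suc n. (var_y * G) $ j $ i * (a ^ i * b ^ j) $ n)"
    using subst_nth[OF ab, of n n "Suc n"] by simp
  also have "\<dots> = (\<Sum>i\<le>n. \<Sum>j\<le>n. G $ j $ i * (b * (a ^ i * b ^ j)) $ n)"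
    by (simp add: sum.atMost_Suc_shift mult_ac del: sum.atMost_Suc)
  also have "\<dots> = (b * subst_curve G a b) $ n" by (rule subst_var_mult_aux[OF ab])
  finally show "subst_curve (var_y * G) a b $ n = (b * subst_curve G a b) $ n" .
qed

lemma subst_var_x_mult:
  assumes ab: "fps_X dvd a" "fps_X dvd b"
  shows "subst_curve (var_x * G) a b = a * subst_curve G a b"
proof (intro fps_ext)
  fix n
  have "subst_curve (var_x * G) a b $ n = (\<Sum>i\<le>Suc n. \<Sum>j\<le>n. (var_x * G) $ j $ i * (a ^ i * b ^ j) $ n)"
    using subst_nth[OF ab, of n "Suc n" n] by simp
  also have "\<dots> = (\<Sum>i\<le>n. \<Sum>j\<le>n. G $ j $ i * (a * (a ^ i * b ^ j)) $ n)"
    by (simp add: sum.atMost_Suc_shift mult_ac del: sum.atMost_Suc)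
  also have "\<dots> = (a * subst_curve G a b) $ n" by (rule subst_var_mult_aux[OF ab])
  finally show "subst_curve (var_x * G) a b $ n = (a * subst_curve G a b) $ n" .
qed

lemma subst_cst_mult: "subst_curve (cst c * G) a b = fps_const c * subst_curve G a b"
  by (intro fps_ext) (simp add: subst_curve_def sum_distrib_left mult_ac)

lemma subst_uminus: "subst_curve (- G) a b = - subst_curve G a b"
  by (intro fps_ext) (simp add: subst_curve_def sum_negf)

lemma subst_diff: "subst_curve (G - H) a b = subst_curve G a b - subst_curve H a b"
  using subst_add[of G "- H"] by (simp add: subst_uminus)

lemma subst_mult:
  assumes ab: "fps_X dvd a" "fps_X dvd b"
  shows "subst_curve (G * H) a b = subst_curve G a b * subst_curve H a b"
proof -
  have "subst_curve (G * H) a b - subst_curve G a b * subst_curve H a b = 0"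
    by (rule vanishing_operator[where a = a and b = b and
          D = "\<lambda>G. subst_curve (G * H) a b - subst_curve G a b * subst_curve H a b"], 
        unfold mult.assoc distrib_right subst_add subst_cst_mult subst_cst subst_var_x_mult[OF ab]
          subst_var_y_mult[OF ab])
       (simp_all add: ab right_diff_distrib)
  then show ?thesis by simp
qed

lemma subst_var_x: "fps_X dvd a \<Longrightarrow> fps_X dvd b \<Longrightarrow> subst_curve var_x a b = a"
  using subst_var_x_mult[of a b 1] by simp

lemma subst_var_y: "fps_X dvd a \<Longrightarrow> fps_X dvd b \<Longrightarrow> subst_curve var_y a b = b"
  using subst_var_y_mult[of a b 1] by simp

lemma subst_power: "fps_X dvd a \<Longrightarrow> fps_X dvd b \<Longrightarrow> subst_curve (G ^ k) a b = subst_curve G a b ^ k"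
  by (induction k) (simp_all add: subst_mult)

lemma subst_sum: "subst_curve (\<Sum>i\<in>A. G i) a b = (\<Sum>i\<in>A. subst_curve (G i) a b)"
  by (induction A rule: infinite_finite_induct) (simp_all add: subst_add)

lemma subst_of_nat: "subst_curve (of_nat m) a b = of_nat m"
  by (metis fps_of_nat subst_cst)

lemma partial_x_add: "partial_x (G + H) = partial_x G + partial_x H"
  by (simp add: partial_x_def fps_eq_iff algebra_simps)

lemma partial_x_cst [simp]: "partial_x (cst c) = 0"
  by (intro fps_ext) (simp add: partial_x_def)

lemma partial_x_var_x_mult: "partial_x (var_x * G) = G + var_x * partial_x G"
  by (intro fps_ext) (simp add: partial_x_def)

lemma partial_x_var_y_mult: "partial_x (var_y * G) = var_y * partial_x G"
  by (intro fps_ext) (simp add: partial_x_def fps_X_mult_nth)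

lemma partial_y_add: "partial_y (G + H) = partial_y G + partial_y H"
  by (simp add: partial_y_def)

lemma partial_y_cst [simp]: "partial_y (cst c) = 0"
  by (simp add: partial_y_def)

lemma partial_y_var_x_mult: "partial_y (var_x * G) = var_x * partial_y G"
  by (simp add: partial_y_def)

lemma partial_y_var_y_mult: "partial_y (var_y * G) = G + var_y * partial_y G"
  by (simp add: partial_y_def)

text \<open>The difference of both sides is again an operator as in
  \<open>vanishing_operator\<close>: the extra terms that the product rule creates for
  \<open>var_x * G\<close> and \<open>var_y * G\<close> cancel.\<close>

lemma subst_chain_rule:
  assumes ab: "fps_X dvd a" "fps_X dvd b"
  shows "fps_deriv (subst_curve G a b) =
    subst_curve (partial_x G) a b * fps_deriv a + subst_curve (partial_y G) a b * fps_deriv b"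
proof -
  have "fps_deriv (subst_curve G a b) -
    (subst_curve (partial_x G) a b * fps_deriv a + subst_curve (partial_y G) a b * fps_deriv b) = 0"
    by (rule vanishing_operator[where a = a and b = b and D = "\<lambda>G. fps_deriv (subst_curve G a b) -
          (subst_curve (partial_x G) a b * fps_deriv a + subst_curve (partial_y G) a b * fps_deriv b)"], 
        unfold partial_x_add partial_y_add partial_x_cst partial_y_cst partial_x_var_x_mult
          partial_y_var_x_mult partial_x_var_y_mult partial_y_var_y_mult subst_add subst_cst
          subst_var_x_mult[OF ab] subst_var_y_mult[OF ab])
       (simp_all add: ab algebra_simps)
  then show ?thesis by simp
qed

lemma subst_compose:
  assumes ab: "fps_X dvd a" "fps_X dvd b" and c: "fps_X dvd (c :: complex fps)"
  shows "subst_curve G a b oo c = subst_curve G (a oo c) (b oo c)"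
proof -
  have c0: "c $ 0 = 0" using c by (simp add: fps_X_dvd_iff)
  have ac: "fps_X dvd (a oo c)" "fps_X dvd (b oo c)" using ab by (auto simp: fps_X_dvd_iff)
  have "(subst_curve G a b oo c) - subst_curve G (a oo c) (b oo c) = 0"
    by (rule vanishing_operator[where a = "a oo c" and b = "b oo c" and
          D = "\<lambda>G. (subst_curve G a b oo c) - subst_curve G (a oo c) (b oo c)"], 
        unfold subst_add subst_cst subst_var_x_mult[OF ab] subst_var_y_mult[OF ab]
          subst_var_x_mult[OF ac] subst_var_y_mult[OF ac] fps_compose_add_distrib
          fps_compose_mult_distrib[OF c0])
       (simp_all add: ac right_diff_distrib)
  then show ?thesis by simp
qed

lemma subst_fps_const:
  assumes ab: "fps_X dvd a" "fps_X dvd b"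
  shows "subst_curve (fps_const f) a b = f oo a"
proof (intro fps_ext)
  fix n
  have "subst_curve (fps_const f) a b $ n = (\<Sum>i\<le>n. \<Sum>j\<in>{0}. fps_const f $ j $ i * (a ^ i * b ^ j) $ n)"
    unfolding subst_curve_def fps_nth_Abs_fps
    by (intro sum.cong sum.mono_neutral_right) auto
  then show "subst_curve (fps_const f) a b $ n = (f oo a) $ n"
    by (simp add: fps_compose_nth atLeast0AtMost)
qed

lemma subst_fps_of_poly:
  assumes ab: "fps_X dvd a" "fps_X dvd b"
  shows "subst_curve (fps_of_poly p) a b = poly (map_poly (\<lambda>f. f oo a) p) b"
proof (induction p)
  case (pCons f p)
  have "subst_curve (fps_of_poly (pCons f p)) a b = (f oo a) + b * subst_curve (fps_of_poly p) a b"
    by (simp add: fps_of_poly_pCons subst_add subst_fps_const[OF ab] subst_var_y_mult[OF ab] mult.commute)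
  then show ?case using pCons by (simp add: map_poly_pCons)
qed simp

section \<open>Codimension of ideals of formal power series\<close>

abbreviation scl :: "complex \<Rightarrow> complex fps fps \<Rightarrow> complex fps fps" where
  "scl \<equiv> \<lambda>c G. cst c * G"

abbreviation scl1 :: "complex \<Rightarrow> complex fps \<Rightarrow> complex fps" where
  "scl1 \<equiv> \<lambda>c f. fps_const c * f"

interpretation E: vector_space scl
  by unfold_locales (simp_all add: algebra_simps fps_const_add[symmetric] del: fps_const_add)

interpretation F1: vector_space scl1
  by unfold_locales (simp_all add: algebra_simps fps_const_add[symmetric] del: fps_const_add)

interpretation EE: vector_space_pair scl scl ..
interpretation EF: vector_space_pair scl scl1 ..

lemma E_linearI:
  "(\<And>x y. f (x + y) = f x + f y) \<Longrightarrow> (\<And>c x. f (cst c * x) = cst c * f x) \<Longrightarrow> Vector_Spaces.linear scl scl f"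
  by unfold_locales auto

lemma EF_linearI:
  "(\<And>x y. f (x + y) = f x + f y) \<Longrightarrow> (\<And>c x. f (cst c * x) = fps_const c * f x) \<Longrightarrow> Vector_Spaces.linear scl scl1 f"
  by unfold_locales auto

definition ideal2 :: "complex fps fps \<Rightarrow> complex fps fps \<Rightarrow> complex fps fps set" where
  "ideal2 P G = {a * P + b * G | a b. True}"

lemma ideal2_I [intro]: "H = a * P + b * G \<Longrightarrow> H \<in> ideal2 P G"
  by (auto simp: ideal2_def)

lemma ideal2_add: "x \<in> ideal2 P G \<Longrightarrow> y \<in> ideal2 P G \<Longrightarrow> x + y \<in> ideal2 P G"
proof -
  assume "x \<in> ideal2 P G" "y \<in> ideal2 P G"
  then obtain a b a' b' where "x = a * P + b * G" "y = a' * P + b' * G" by (auto simp: ideal2_def)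
  then show ?thesis by (intro ideal2_I[of _ "a + a'" _ "b + b'"]) (simp add: algebra_simps)
qed

lemma ideal2_mult: "x \<in> ideal2 P G \<Longrightarrow> y * x \<in> ideal2 P G"
proof -
  assume "x \<in> ideal2 P G"
  then obtain a b where "x = a * P + b * G" by (auto simp: ideal2_def)
  then show ?thesis by (intro ideal2_I[of _ "y * a" _ "y * b"]) (simp add: algebra_simps)
qed

lemma ideal2_0: "0 \<in> ideal2 P G" by (rule ideal2_I[of _ 0 _ 0]) simp

lemma subspace_ideal2: "E.subspace (ideal2 P G)"
  unfolding E.subspace_def by (auto intro: ideal2_add ideal2_mult ideal2_0)

lemma has_codim_fps_X_power: "has_codim scl1 UNIV {h. fps_X ^ k dvd h} k"
  unfolding has_codim_def indep_mod_def
proof (intro exI[of _ "\<lambda>i. fps_X ^ i"] conjI allI impI ballI)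
  have s: "(\<Sum>i<k. fps_const (c i) * fps_X ^ i) $ n = (if n < k then c n else 0)" for c :: "nat \<Rightarrow> complex" and n
    by (simp add: fps_sum_nth fps_X_power_iff if_distrib if_distribR sum.delta' cong: if_cong)
  show "c i = 0" if "(\<Sum>i<k. fps_const (c i) * fps_X ^ i) \<in> {h. fps_X ^ k dvd h}" "i < k" for c :: "nat \<Rightarrow> complex" and i
    using that unfolding mem_Collect_eq fps_X_power_dvd_iff by (auto simp: s)
  show "\<exists>c. v - (\<Sum>i<k. fps_const (c i) * fps_X ^ i) \<in> {h. fps_X ^ k dvd h}" for v :: "complex fps"
    by (intro exI[of _ "fps_nth v"]) (unfold mem_Collect_eq fps_X_power_dvd_iff, simp add: s)
qed simp

text \<open>Division by a linear factor in closed form, as in Horner's scheme: the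
  \<open>j\<close>-th coefficient of the quotient is the value at \<open>y = z\<close> of what
  remains of \<open>H\<close> after dropping its first \<open>Suc j\<close> coefficients and
  shifting down.\<close>

lemma var_y_minus_dvd:
  assumes z: "fps_X dvd z" and H: "subst_curve H fps_X z = 0"
  shows "(var_y - fps_const z) dvd H"
proof -
  let ?S = "\<lambda>G. subst_curve G fps_X z"
  define q where "q = Abs_fps (\<lambda>j. ?S (fps_shift (Suc j) H))"
  have S: "?S G = G $ 0 + z * ?S (fps_shift 1 G)" for G
    by (subst fps_split[of G], subst subst_add)
       (simp only: subst_fps_const[OF dvd_refl z] subst_var_y_mult[OF dvd_refl z] fps_compose_fps_X)
  have shift: "fps_shift (Suc 0) (fps_shift j H) = fps_shift (Suc j) H" for j
    by (rule fps_ext) simp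
  have "H = (var_y - fps_const z) * q"
  proof (rule fps_ext)
    fix j show "H $ j = ((var_y - fps_const z) * q) $ j"
      using S[of "fps_shift j H"] H
      by (cases j) (simp_all add: q_def left_diff_distrib eq_neg_iff_add_eq_0 shift)
  qed
  then show ?thesis ..
qed

text \<open>Evaluation at \<open>y = z\<close> identifies the quotient by \<open>y - z\<close> with
  the series in \<open>x\<close>, and the image of the ideal is generated by \<open>x ^ k\<close>,
  where \<open>k\<close> is the order of \<open>G(x, z)\<close>.\<close>

lemma has_codim_root:
  assumes z: "fps_X dvd z" and G: "subst_curve G fps_X z \<noteq> 0"
  shows "has_codim scl UNIV (ideal2 (var_y - fps_const z) G) (subdegree (subst_curve G fps_X z))"
proof -
  let ?S = "\<lambda>G. subst_curve G fps_X z"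
  note Sm = subst_mult[OF dvd_refl z]
  define k where "k = subdegree (?S G)"
  have lin: "Vector_Spaces.linear scl scl1 ?S"
    by (rule EF_linearI) (simp_all add: subst_add subst_cst_mult)
  have yz: "?S (var_y - fps_const z) = 0"
    using z by (simp add: subst_diff subst_var_y subst_fps_const)
  have g: "fps_X ^ k dvd h \<longleftrightarrow> ?S G dvd h" for h
    using G fps_dvd_iff[of "?S G" h] fps_dvd_iff[of "fps_X ^ k" h]
    by (cases "h = 0") (auto simp: k_def fps_X_power_subdegree)
  have "has_codim scl UNIV (UNIV \<inter> ?S -` {h. fps_X ^ k dvd h}) k"
  proof (rule EF.has_codim_preimage[OF lin _ _ _ has_codim_fps_X_power])
    show "F1.subspace {h. fps_X ^ k dvd h}"
      by (auto simp: F1.subspace_def)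
    show "\<exists>v\<in>UNIV. w - ?S v \<in> {h. fps_X ^ k dvd h}" for w
      by (intro bexI[of _ "fps_const w"]) (simp_all add: subst_fps_const[OF dvd_refl z])
  qed (auto simp: E.subspace_UNIV)
  also have "UNIV \<inter> ?S -` {h. fps_X ^ k dvd h} = ideal2 (var_y - fps_const z) G" (is "?A = ?B")
  proof (intro equalityI subsetI)
    fix H assume "H \<in> ?A"
    then obtain h where h: "?S H = ?S G * h" using g by (auto elim: dvdE)
    have "?S (H - fps_const h * G) = 0"
      by (simp add: subst_diff Sm h subst_fps_const[OF dvd_refl z] mult.commute)
    from var_y_minus_dvd[OF z this] obtain q where "H - fps_const h * G = (var_y - fps_const z) * q" ..
    then show "H \<in> ?B" by (intro ideal2_I[of _ q _ "fps_const h"]) (simp add: algebra_simps)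
  next
    fix H assume "H \<in> ?B"
    then obtain a b where "H = a * (var_y - fps_const z) + b * G" by (auto simp: ideal2_def)
    then show "H \<in> ?A" by (simp add: subst_add Sm yz g)
  qed
  finally show ?thesis by (simp add: k_def)
qed

text \<open>Exact sequence: multiplication by \<open>Q\<close> maps the quotient by
  \<open>(H, G)\<close> onto the kernel of the projection from the quotient by
  \<open>(Q * H, G)\<close> to the one by \<open>(Q, G)\<close>. The cancellation hypothesis makes
  it injective.\<close>

lemma has_codim_ideal2_mult:
  assumes Q: "Q \<noteq> 0" "\<And>b. Q dvd b * G \<Longrightarrow> Q dvd b"
    and p: "has_codim scl UNIV (ideal2 H G) p" and q: "has_codim scl UNIV (ideal2 Q G) q"
  shows "has_codim scl UNIV (ideal2 (Q * H) G) (q + p)"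
proof (rule E.has_codim_trans[OF _ _ subspace_ideal2 subspace_ideal2 q])
  show "ideal2 (Q * H) G \<subseteq> ideal2 Q G"
    unfolding ideal2_def by (force simp: mult.assoc[symmetric] mult.commute[of Q])
  have e: "UNIV \<inter> (*) Q -` ideal2 (Q * H) G = ideal2 H G" (is "?A = ?B")
  proof (intro equalityI subsetI)
    fix h assume "h \<in> ?A"
    then obtain a b where ab: "Q * h = a * (Q * H) + b * G" by (auto simp: ideal2_def)
    then have "b * G = Q * (h - a * H)" by (simp add: algebra_simps)
    then obtain b' where "b = Q * b'" using Q(2)[of b] by auto
    with ab have "Q * h = Q * (a * H + b' * G)" by (simp add: algebra_simps)
    with Q(1) show "h \<in> ?B" by auto
  next
    fix h assume "h \<in> ?B"
    then obtain a b where "h = a * H + b * G" by (auto simp: ideal2_def)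
    then show "h \<in> ?A" by (auto intro!: ideal2_I[of _ a _ "Q * b"] simp: algebra_simps)
  qed
  show "has_codim scl (ideal2 Q G) (ideal2 (Q * H) G) p"
  proof (rule EE.has_codim_image[where f = "(*) Q" and V = UNIV])
    show "Vector_Spaces.linear scl scl ((*) Q)" by (rule E_linearI) (simp_all add: algebra_simps)
    show "Q * v \<in> ideal2 Q G" for v by (simp add: ideal2_I[of _ v _ 0])
    fix z assume "z \<in> ideal2 Q G"
    then obtain a b where "z = a * Q + b * G" by (auto simp: ideal2_def)
    then show "\<exists>v\<in>UNIV. z - Q * v \<in> ideal2 (Q * H) G"
      by (intro bexI[of _ a] ideal2_I[of _ 0 _ b]) (simp_all add: algebra_simps)
  qed (use p e in \<open>auto simp: subspace_ideal2\<close>)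
qed simp

text \<open>Evaluation at \<open>y = z\<close> is a ring homomorphism into a domain, and its kernel
  is generated by \<open>y - z\<close>.\<close>

lemma var_y_minus_dvd_cancel:
  assumes z: "fps_X dvd z" and G: "subst_curve G fps_X z \<noteq> 0"
    and d: "(var_y - fps_const z) dvd b * G"
  shows "(var_y - fps_const z) dvd b"
proof -
  obtain q where "b * G = (var_y - fps_const z) * q" using d ..
  then have "subst_curve b fps_X z * subst_curve G fps_X z = 0"
    using z by (simp add: subst_mult[symmetric] subst_mult[of _ _ "var_y - _"] subst_diff subst_var_y subst_fps_const)
  then show ?thesis using G z by (intro var_y_minus_dvd) simp_all
qed

lemma has_codim_roots:
  assumes "\<forall>z\<in>set zs. fps_X dvd z \<and> subst_curve G fps_X z \<noteq> 0"
  shows "has_codim scl UNIV (ideal2 (\<Prod>z\<leftarrow>zs. var_y - fps_const z) G)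
    (\<Sum>z\<leftarrow>zs. subdegree (subst_curve G fps_X z))"
  using assms
proof (induction zs)
  case Nil
  have "ideal2 1 G = UNIV" by (auto intro: ideal2_I[of _ _ _ 0])
  then show ?case by (simp add: E.has_codim_refl E.subspace_UNIV)
next
  case (Cons z zs)
  then have z: "fps_X dvd z" "subst_curve G fps_X z \<noteq> 0" by auto
  have "var_y - fps_const z \<noteq> 0"
  proof
    assume "var_y - fps_const z = 0"
    then have "(var_y - fps_const z) $ 1 = 0" by simp
    then show False by simp
  qed
  then show ?case using has_codim_ideal2_mult[OF _ var_y_minus_dvd_cancel[OF z] Cons.IH has_codim_root[OF z]]
    Cons.prems by simp
qed

section \<open>Ramification of the variable x\<close>

definition ramify :: "nat \<Rightarrow> complex fps fps \<Rightarrow> complex fps fps" where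
  "ramify N G = Abs_fps (\<lambda>j. G $ j oo fps_X ^ N)"

text \<open>The series in \<open>x\<close> are free over the series in \<open>x ^ N\<close> with
  basis \<open>1, x, ..., x ^ (N - 1)\<close>; this is the coordinate at
  \<open>x ^ k\<close>.\<close>

definition section1 :: "nat \<Rightarrow> nat \<Rightarrow> complex fps \<Rightarrow> complex fps" where
  "section1 N k f = Abs_fps (\<lambda>i. f $ (N * i + k))"

definition section2 :: "nat \<Rightarrow> nat \<Rightarrow> complex fps fps \<Rightarrow> complex fps fps" where
  "section2 N k G = Abs_fps (\<lambda>j. section1 N k (G $ j))"

lemma compose_X_power_nth:
  assumes "N > 0"
  shows "(f oo fps_X ^ N) $ n = (if N dvd n then f $ (n div N) else (0::'a::comm_ring_1))"
proof -
  have "(f oo fps_X ^ N) $ n = (\<Sum>i=0..n. if n = N * i then f $ i else 0)"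
    unfolding fps_compose_nth power_mult[symmetric] by (simp add: fps_X_power_iff if_distrib cong: if_cong)
  also have "\<dots> = (if N dvd n then f $ (n div N) else 0)"
  proof (cases "N dvd n")
    case True
    then obtain m where m: "n = N * m" ..
    have "(\<Sum>i=0..n. if n = N * i then f $ i else 0) = (\<Sum>i\<in>{m}. f $ i)"
      by (rule sum.mono_neutral_cong_right) (use assms m in auto)
    then show ?thesis using m assms by simp
  qed (auto intro!: sum.neutral)
  finally show ?thesis .
qed

lemma section1_mult:
  assumes "k < N"
  shows "section1 N k (f * (g oo fps_X ^ N)) = section1 N k f * g"
proof (rule fps_ext)
  fix n
  have N: "N > 0" using assms by simp
  have "(f * (g oo fps_X ^ N)) $ (N * n + k) = (\<Sum>l\<le>N * n + k. (g oo fps_X ^ N) $ l * f $ (N * n + k - l))"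
    by (simp add: mult.commute[of f] mult_sum_nth)
  also have "\<dots> = (\<Sum>l\<in>(*) N ` {..n}. (g oo fps_X ^ N) $ l * f $ (N * n + k - l))"
  proof (rule sum.mono_neutral_right)
    show "(*) N ` {..n} \<subseteq> {..N * n + k}" by (auto intro: trans_le_add1)
    show "\<forall>l\<in>{..N * n + k} - (*) N ` {..n}. (g oo fps_X ^ N) $ l * f $ (N * n + k - l) = 0"
    proof
      fix l assume l: "l \<in> {..N * n + k} - (*) N ` {..n}"
      have "\<not> N dvd l"
      proof
        assume "N dvd l" then obtain m where m: "l = N * m" ..
        then have "N * m < N * Suc n" using l assms by (simp add: algebra_simps)
        then have "m < Suc n" by (simp only: mult_less_cancel1)
        then have "m \<le> n" by simp
        then show False using l m by auto
      qed
      then show "(g oo fps_X ^ N) $ l * f $ (N * n + k - l) = 0" by (simp add: compose_X_power_nth N)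
    qed
  qed simp
  also have "\<dots> = (\<Sum>m\<le>n. g $ m * f $ (N * (n - m) + k))"
    using N by (subst sum.reindex) (auto simp: inj_on_def compose_X_power_nth diff_mult_distrib2 intro!: sum.cong)
  also have "\<dots> = (section1 N k f * g) $ n" 
    by (simp add: mult.commute[of _ g] mult_sum_nth section1_def)
  finally show "section1 N k (f * (g oo fps_X ^ N)) $ n = (section1 N k f * g) $ n"
    by (simp add: section1_def)
qed

lemma section1_add: "section1 N k (f + g) = section1 N k f + section1 N k g"
  by (simp add: section1_def fps_eq_iff)

lemma section1_0 [simp]: "section1 N k 0 = 0"
  by (simp add: section1_def fps_eq_iff)

lemma section1_sum: "section1 N k (\<Sum>i\<in>A. f i) = (\<Sum>i\<in>A. section1 N k (f i))"
  by (induction A rule: infinite_finite_induct) (simp_all add: section1_add)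

lemma section1_X_power:
  assumes "j < N" "k < N"
  shows "section1 N k (fps_X ^ j) = (if j = k then 1 else 0)"
proof (rule fps_ext)
  fix i
  have "N * i + k = j \<longleftrightarrow> i = 0 \<and> j = k" using assms by (cases i) auto
  then show "section1 N k (fps_X ^ j) $ i = (if j = k then 1 else 0) $ i"
    by (simp add: section1_def fps_X_power_iff)
qed

lemma section1_expansion:
  assumes "N > 0"
  shows "f = (\<Sum>k<N. fps_X ^ k * (section1 N k f oo fps_X ^ N))"
proof (rule fps_ext)
  fix n
  have "(\<Sum>k<N. fps_X ^ k * (section1 N k f oo fps_X ^ N)) $ n =
      (\<Sum>k\<in>{n mod N}. f $ n)"
    unfolding fps_sum_nth
  proof (rule sum.mono_neutral_cong_right)
    show "\<forall>k\<in>{..<N} - {n mod N}. (fps_X ^ k * (section1 N k f oo fps_X ^ N)) $ n = 0"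
    proof
      fix k assume k: "k \<in> {..<N} - {n mod N}"
      have "\<not> N dvd n - k" if "k \<le> n"
      proof
        assume "N dvd n - k" then obtain m where "n - k = N * m" ..
        then have "n = k + N * m" using that by simp
        moreover have "k < N" using k by simp
        ultimately show False using k by simp
      qed
      then show "(fps_X ^ k * (section1 N k f oo fps_X ^ N)) $ n = 0"
        by (simp add: fps_X_power_mult_nth compose_X_power_nth assms)
    qed
    show "(fps_X ^ k * (section1 N k f oo fps_X ^ N)) $ n = f $ n" if "k \<in> {n mod N}" for k
      using that assms by (auto simp: leD[OF mod_less_eq_dividend[of n N]] fps_X_power_mult_nth compose_X_power_nth section1_def
          minus_mod_eq_mult_div[symmetric] intro: dvd_minus_mod)
  qed (use assms in auto)
  then show "f $ n = (\<Sum>k<N. fps_X ^ k * (section1 N k f oo fps_X ^ N)) $ n" by simp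
qed

lemma ramify_add: "ramify N (G + H) = ramify N G + ramify N H"
  by (simp add: ramify_def fps_eq_iff fps_compose_add_distrib)

lemma ramify_mult: "N > 0 \<Longrightarrow> ramify N (G * H) = ramify N G * ramify N H"
  by (rule fps_ext) (simp add: ramify_def mult_sum_nth fps_compose_sum_distrib fps_compose_mult_distrib)

lemma ramify_cst [simp]: "ramify N (cst c) = cst c"
  by (rule fps_ext) (simp add: ramify_def)

lemma ramify_sum: "ramify N (\<Sum>i\<in>A. G i) = (\<Sum>i\<in>A. ramify N (G i))"
proof (induction A rule: infinite_finite_induct)
  have "ramify N 0 = 0" using ramify_cst[of N 0] by simp
  then show "ramify N (sum G {}) = (\<Sum>i\<in>{}. ramify N (G i))" 
    "\<And>A. infinite A \<Longrightarrow> ramify N (sum G A) = (\<Sum>i\<in>A. ramify N (G i))" by simp_all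
qed (simp add: ramify_add)

lemma subst_ramify:
  assumes N: "N > 0" and z: "fps_X dvd z"
  shows "subst_curve (ramify N G) fps_X z = subst_curve G (fps_X ^ N) z"
proof -
  have XN: "fps_X dvd (fps_X ^ N :: complex fps)" using N by (simp add: dvd_power)
  have ra: "ramify N var_x = fps_const (fps_X ^ N)" "ramify N var_y = var_y"
    by (rule fps_ext, simp add: ramify_def N)+ 
  have "subst_curve (ramify N G) fps_X z - subst_curve G (fps_X ^ N) z = 0"
    by (rule vanishing_operator[where a = "fps_X ^ N" and b = z and
          D = "\<lambda>G. subst_curve (ramify N G) fps_X z - subst_curve G (fps_X ^ N) z"],
        unfold ramify_add ramify_cst ramify_mult[OF N] ra subst_mult[OF dvd_refl z] subst_add
        subst_var_x_mult[OF XN z] subst_var_y_mult[OF XN z] subst_cst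
        subst_fps_const[OF dvd_refl z] subst_var_y[OF dvd_refl z] fps_compose_fps_X)
       (simp_all add: XN z right_diff_distrib)
  then show ?thesis by simp
qed

lemma section2_add: "section2 N k (G + H) = section2 N k G + section2 N k H"
  by (simp add: section2_def fps_eq_iff section1_add)

lemma section2_mult: "k < N \<Longrightarrow> section2 N k (H * ramify N G) = section2 N k H * G"
  by (rule fps_ext) (simp add: section2_def ramify_def fps_mult_nth section1_sum section1_mult)

lemma section2_expansion:
  "N > 0 \<Longrightarrow> H = (\<Sum>k<N. fps_const (fps_X ^ k) * ramify N (section2 N k H))"
  by (rule fps_ext) (simp add: section2_def ramify_def fps_sum_nth section1_expansion[symmetric])

lemma section2_X_power:
  assumes "j < N" "k < N"
  shows "section2 N k (fps_const (fps_X ^ j) * ramify N G) = (if j = k then G else 0)"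
proof -
  have "section2 N k (fps_const (fps_X ^ j)) = (if j = k then 1 else 0)"
    by (rule fps_ext) (simp add: section2_def section1_X_power assms)
  then show ?thesis using assms by (simp add: section2_mult)
qed

text \<open>An ideal generated by ramified series consists of the series whose \<open>N\<close>
  sections all lie in the unramified ideal, so its quotient is made of \<open>N\<close> copies of
  the original one.\<close>

lemma has_codim_ramify:
  assumes N: "N > 0" and D: "has_codim scl UNIV (ideal2 (ramify N P) (ramify N G)) D"
  shows "\<exists>d. has_codim scl UNIV (ideal2 P G) d \<and> D = N * d"
proof -
  let ?I' = "ideal2 (ramify N P) (ramify N G)" and ?I = "ideal2 P G"
  \<comment> \<open>\<open>V j\<close> constrains only the first \<open>j\<close> sections; passing
    to \<open>V (Suc j)\<close> adds one copy of the quotient by \<open>?I\<close>.\<close>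
  define V where "V = (\<lambda>j. {H. \<forall>k<j. section2 N k H \<in> ?I})"
  have lin: "Vector_Spaces.linear scl scl (section2 N k)" if "k < N" for k
  proof (rule E_linearI)
    show "section2 N k (cst c * x) = cst c * section2 N k x" for c x
      using section2_mult[OF that, of x "cst c"] by (simp add: mult.commute)
  qed (rule section2_add)
  have I'V: "?I' = V N"
  proof (intro equalityI subsetI)
    fix H assume "H \<in> ?I'"
    then obtain a b where "H = a * ramify N P + b * ramify N G" by (auto simp: ideal2_def)
    then show "H \<in> V N" by (auto simp: V_def section2_add section2_mult)
  next
    fix H assume H: "H \<in> V N"
    have "fps_const (fps_X ^ k) * ramify N (section2 N k H) \<in> ?I'" if k: "k \<in> {..<N}" for k
    proof -
      obtain a b where "section2 N k H = a * P + b * G"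
        using H k by (auto simp: V_def ideal2_def)
      then have "ramify N (section2 N k H) = ramify N a * ramify N P + ramify N b * ramify N G"
        by (simp add: ramify_add ramify_mult N)
      then show ?thesis by (intro ideal2_mult ideal2_I)
    qed
    then have "(\<Sum>k<N. fps_const (fps_X ^ k) * ramify N (section2 N k H)) \<in> ?I'"
      by (intro E.subspace_sum[OF subspace_ideal2])
    then show "H \<in> ?I'" using section2_expansion[OF N, of H] by simp
  qed
  \<comment> \<open>Finiteness of the unramified codimension has to be deduced from
    \<open>D\<close>: section \<open>0\<close> undoes \<open>ramify\<close>, hence ramified families
    stay independent.\<close>
  have "\<exists>d. has_codim scl UNIV ?I d"
  proof (rule E.has_codim_exists[OF subspace_ideal2, of _ _ _ D])
    fix k b assume ind: "indep_mod scl ?I b k"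
    have "indep_mod scl ?I' (\<lambda>i. ramify N (b i)) k"
      unfolding indep_mod_def
    proof (intro allI impI)
      fix c i assume c: "(\<Sum>i<k. cst (c i) * ramify N (b i)) \<in> ?I'" and i: "i < k"
      have "(\<Sum>i<k. cst (c i) * ramify N (b i)) = ramify N (\<Sum>i<k. cst (c i) * b i)"
        by (simp add: ramify_sum ramify_mult N)
      then have "section2 N 0 (ramify N (\<Sum>i<k. cst (c i) * b i)) \<in> ?I"
        using c N by (auto simp: I'V V_def)
      then have "(\<Sum>i<k. cst (c i) * b i) \<in> ?I"
        using section2_X_power[of 0 N 0 "\<Sum>i<k. cst (c i) * b i"] N by simp
      then show "c i = 0" using ind i by (auto simp: indep_mod_def)
    qed
    then show "k \<le> D" by (rule E.has_codim_imp_bound[OF subspace_ideal2 D]) simp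
  qed
  then obtain d where d: "has_codim scl UNIV ?I d" ..
  have sV: "E.subspace (V j)" if "j \<le> N" for j
  proof -
    have "V j = (\<Inter>k\<in>{..<j}. section2 N k -` ?I)" by (auto simp: V_def)
    moreover have "E.subspace (section2 N k -` ?I)" if "k < N" for k
    proof -
      interpret l: Vector_Spaces.linear scl scl "section2 N k" by (rule lin[OF that])
      show ?thesis using subspace_ideal2[of P G] l.add l.scale l.zero
        by (auto simp: E.subspace_def)
    qed
    ultimately show ?thesis using that by (auto intro!: E.subspace_Inter)
  qed
  have "has_codim scl UNIV (V j) (j * d)" if "j \<le> N" for j
    using that
  proof (induction j)
    case 0
    then show ?case by (simp add: V_def E.has_codim_refl E.subspace_UNIV)
  next
    case (Suc j)
    have e: "V (Suc j) = V j \<inter> section2 N j -` ?I" by (auto simp: V_def less_Suc_eq)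
    have "has_codim scl (V j) (V (Suc j)) d" unfolding e
    proof (rule EE.has_codim_preimage[OF lin subspace_ideal2 _ _ d])
      fix z :: "complex fps fps"
      have "fps_const (fps_X ^ j) * ramify N z \<in> V j"
        using Suc.prems by (auto simp: V_def section2_X_power ideal2_0)
      then show "\<exists>v\<in>V j. z - section2 N j v \<in> ?I"
        using Suc.prems by (intro bexI) (auto simp: section2_X_power ideal2_0)
    qed (use Suc.prems sV in auto)
    then have "has_codim scl UNIV (V (Suc j)) (j * d + d)"
      using Suc by (intro E.has_codim_trans[of "V (Suc j)" "V j"] sV) (auto simp: V_def)
    then show ?case by (simp add: add.commute)
  qed
  from this[of N] have "has_codim scl UNIV ?I' (N * d)" by (simp add: I'V)
  with D have "D = N * d" by (rule E.has_codim_unique[OF subspace_ideal2])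
  with d show ?thesis by blast
qed

text \<open>The roots of \<open>P\<close> live in the variable \<open>t\<close> with
  \<open>x = t ^ N\<close>. Their orders add up to the ramified codimension, and
  \<open>has_codim_ramify\<close> removes the factor \<open>N\<close>.\<close>

theorem has_codim_puiseux:
  assumes N: "N > 0" and P: "ramify N P = (\<Prod>z\<leftarrow>zs. var_y - fps_const z)"
    and zs: "\<forall>z\<in>set zs. fps_X dvd z \<and> subst_curve G (fps_X ^ N) z \<noteq> 0"
  shows "\<exists>d. has_codim scl UNIV (ideal2 P G) d \<and>
    (\<Sum>z\<leftarrow>zs. subdegree (subst_curve G (fps_X ^ N) z)) = N * d"
proof -
  have "(\<Sum>z\<leftarrow>zs. subdegree (subst_curve G (fps_X ^ N) z)) =
      (\<Sum>z\<leftarrow>zs. subdegree (subst_curve (ramify N G) fps_X z))"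
    using zs by (intro arg_cong[of _ _ sum_list] map_cong) (auto simp: subst_ramify N)
  then show ?thesis
    using has_codim_ramify[OF N, of P G] has_codim_roots[of zs "ramify N G"] zs
    by (auto simp: P subst_ramify N)
qed

section \<open>Ideals of finite codimension contain all series of high order\<close>

lemma fps_fps_unit:
  assumes "G $ 0 $ 0 \<noteq> 0"
  shows "\<exists>H. G * H = (1 :: complex fps fps)"
proof -
  have "G $ 0 * inverse (G $ 0) = 1" using assms by (simp add: inverse_mult_eq_1')
  from fps_right_inverse[OF this] show ?thesis by blast
qed

text \<open>Among the first \<open>Suc d\<close> powers of \<open>w\<close> there is a relation
  modulo the ideal. Taking out the lowest power that occurs leaves a unit, so this power itself lies
  in the ideal.\<close>

lemma power_in_ideal2:
  assumes d: "has_codim scl UNIV (ideal2 P G) d" and w: "w = var_x \<or> w = var_y"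
  shows "\<exists>k. w ^ k \<in> ideal2 P G"
proof -
  have "\<not> indep_mod scl (ideal2 P G) (\<lambda>i. w ^ i) (Suc d)"
    using E.has_codim_imp_bound[OF subspace_ideal2 d, of "\<lambda>i. w ^ i" "Suc d"] by auto
  then obtain c l where c: "(\<Sum>i<Suc d. cst (c i) * w ^ i) \<in> ideal2 P G" and l: "l < Suc d" "c l \<noteq> 0"
    by (auto simp: indep_mod_def)
  define k where "k = (LEAST i. i < Suc d \<and> c i \<noteq> 0)"
  have k: "k < Suc d" "c k \<noteq> 0" using LeastI[of "\<lambda>i. i < Suc d \<and> c i \<noteq> 0", OF conjI[OF l]] by (auto simp: k_def)
  have lk: "c i = 0" if "i < k" for i
    using not_less_Least[of i "\<lambda>i. i < Suc d \<and> c i \<noteq> 0"] that k by (auto simp: k_def)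
  define U where "U = (\<Sum>i<Suc d - k. cst (c (k + i)) * w ^ i)"
  have "(\<Sum>i<Suc d. cst (c i) * w ^ i) = (\<Sum>i\<in>(+) k ` {..<Suc d - k}. cst (c i) * w ^ i)"
  proof (rule sum.mono_neutral_right)
    show "\<forall>i\<in>{..<Suc d} - (+) k ` {..<Suc d - k}. cst (c i) * w ^ i = 0"
    proof
      fix i assume i: "i \<in> {..<Suc d} - (+) k ` {..<Suc d - k}"
      have "i < k"
      proof (rule ccontr)
        assume "\<not> i < k"
        then have "i = k + (i - k)" "i - k < Suc d - k" using i by auto
        then show False using i by blast
      qed
      then show "cst (c i) * w ^ i = 0" by (simp add: lk)
    qed
  qed (use k in auto)
  also have "\<dots> = w ^ k * U"
    by (subst sum.reindex) (simp_all add: U_def sum_distrib_left power_add mult_ac)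
  finally have wU: "w ^ k * U \<in> ideal2 P G" using c by simp
  have "U $ 0 $ 0 = (\<Sum>i<Suc d - k. c (k + i) * (w ^ i $ 0 $ 0))"
    by (simp add: U_def fps_sum_nth)
  also have "\<dots> = (\<Sum>i\<in>{0}. c (k + i))"
    by (rule sum.mono_neutral_cong_right) (use k w in \<open>auto simp: fps_power_zeroth power_0_left\<close>)
  finally have "U $ 0 $ 0 \<noteq> 0" using k by simp
  then obtain H where "U * H = 1" using fps_fps_unit by blast
  then have "w ^ k = H * (w ^ k * U)" by (simp add: mult_ac)
  also have "\<dots> \<in> ideal2 P G" using wU by (rule ideal2_mult)
  finally show ?thesis ..
qed

definition ord_ge :: "nat \<Rightarrow> complex fps fps set" where
  "ord_ge k = {G. \<forall>i j. i + j < k \<longrightarrow> G $ j $ i = 0}"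

text \<open>With \<open>x ^ k\<close> and \<open>y ^ l\<close> in the ideal, every monomial of
  degree at least \<open>k + l\<close> is divisible by one of them.\<close>

lemma ord_ge_subset_ideal2:
  assumes "has_codim scl UNIV (ideal2 P G) d"
  shows "\<exists>K. ord_ge K \<subseteq> ideal2 P G"
proof -
  obtain k l where k: "var_x ^ k \<in> ideal2 P G" and l: "var_y ^ l \<in> ideal2 P G"
    using power_in_ideal2[OF assms] by blast
  have "H \<in> ideal2 P G" if H: "H \<in> ord_ge (k + l)" for H
  proof -
    define A where "A = Abs_fps (\<lambda>j. if j < l then fps_shift k (H $ j) else 0)"
    define B where "B = fps_shift l H"
    have "H = A * var_x ^ k + B * var_y ^ l"
    proof (rule fps_ext, rule fps_ext)
      fix j i
      show "H $ j $ i = (A * var_x ^ k + B * var_y ^ l) $ j $ i"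
        using H by (auto simp: A_def B_def ord_ge_def fps_const_power fps_X_power_mult_right_nth)
    qed
    then show ?thesis using k l by (simp add: ideal2_add ideal2_mult)
  qed
  then show ?thesis by blast
qed

section \<open>Convergent power series\<close>

lemma fps_conv_radius_pos_iff:
  "fps_conv_radius f > 0 \<longleftrightarrow> (\<exists>C K. \<forall>n. norm (f $ n :: complex) \<le> C * K ^ n)"
proof
  assume "fps_conv_radius f > 0"
  then obtain r where r: "0 < ereal r" "ereal r < fps_conv_radius f" using ereal_dense2 by blast
  then have "summable (\<lambda>n. norm (f $ n * of_real r ^ n))"
    unfolding fps_conv_radius_def by (intro abs_summable_in_conv_radius) simp
  from summable_LIMSEQ_zero[OF this] have "Bseq (\<lambda>n. norm (f $ n * of_real r ^ n))"
    by (rule convergent_imp_Bseq[OF convergentI])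
  then obtain C where C: "\<And>n. norm (f $ n * of_real r ^ n) \<le> C" unfolding Bseq_def by auto
  have "norm (f $ n) \<le> C * inverse r ^ n" for n
    using C[of n] r by (simp add: norm_mult norm_power field_simps)
  then show "\<exists>C K. \<forall>n. norm (f $ n) \<le> C * K ^ n" by blast
next
  assume "\<exists>C K. \<forall>n. norm (f $ n) \<le> C * K ^ n"
  then obtain C K where CK: "\<And>n. norm (f $ n) \<le> C * K ^ n" by blast
  define L where "L = \<bar>K\<bar> + 1"
  have L: "L > 0" "\<bar>K\<bar> < L" by (auto simp: L_def)
  have "summable (\<lambda>n. f $ n * of_real (inverse L) ^ n)"
  proof (rule summable_comparison_test'[of "\<lambda>n. \<bar>C\<bar> * (\<bar>K\<bar> / L) ^ n" 0])
    show "summable (\<lambda>n. \<bar>C\<bar> * (\<bar>K\<bar> / L) ^ n)" using L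
      by (intro summable_mult summable_geometric) simp
    fix n
    have "norm (f $ n) \<le> \<bar>C\<bar> * \<bar>K\<bar> ^ n"
      using CK[of n] by (simp add: abs_mult[symmetric] power_abs[symmetric])
    then have "norm (f $ n) * inverse L ^ n \<le> \<bar>C\<bar> * \<bar>K\<bar> ^ n * inverse L ^ n"
      using L by (intro mult_right_mono) auto
    then show "norm (f $ n * of_real (inverse L) ^ n) \<le> \<bar>C\<bar> * (\<bar>K\<bar> / L) ^ n"
      using L by (simp add: norm_mult norm_power norm_inverse divide_inverse power_mult_distrib mult.assoc)
  qed
  from conv_radius_geI[OF this] have "fps_conv_radius f \<ge> ereal (inverse L)"
    using L by (simp add: fps_conv_radius_def norm_inverse)
  moreover have "ereal (inverse L) > 0" using L by simp
  ultimately show "fps_conv_radius f > 0" by (rule less_le_trans[rotated])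
qed

text \<open>Normalizing the constants to be at least \<open>1\<close> allows both to be enlarged
  freely when several estimates are merged.\<close>

lemma conv_series_iff:
  "G \<in> conv_series \<longleftrightarrow> (\<exists>C K. C \<ge> 1 \<and> K \<ge> 1 \<and> (\<forall>i j. norm (G $ j $ i) \<le> C * K ^ (i + j)))"
proof
  assume "G \<in> conv_series"
  then obtain r where r: "r > 0" and s: "(\<lambda>(i, j). norm (G $ j $ i) * r ^ (i + j)) summable_on (UNIV :: (nat \<times> nat) set)"
    by (auto simp: conv_series_def)
  define C where "C = infsum (\<lambda>(i, j). norm (G $ j $ i) * r ^ (i + j)) (UNIV :: (nat \<times> nat) set)"
  have le: "norm (G $ j $ i) * r ^ (i + j) \<le> C" for i j
    using finite_sum_le_infsum[OF s, of "{(i, j)}"] r by (auto simp: C_def)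
  define K where "K = max 1 (inverse r)"
  have "norm (G $ j $ i) \<le> max 1 C * K ^ (i + j)" for i j
  proof -
    have "norm (G $ j $ i) = norm (G $ j $ i) * r ^ (i + j) * inverse r ^ (i + j)"
      using r by (simp add: mult.assoc right_inverse flip: power_mult_distrib)
    also have "\<dots> \<le> max 1 C * K ^ (i + j)"
      using le[of j i] r by (intro mult_mono power_mono) (auto simp: K_def)
    finally show ?thesis .
  qed
  then show "\<exists>C K. C \<ge> 1 \<and> K \<ge> 1 \<and> (\<forall>i j. norm (G $ j $ i) \<le> C * K ^ (i + j))"
    by (intro exI[of _ "max 1 C"] exI[of _ K]) (auto simp: K_def)
next
  assume "\<exists>C K. C \<ge> 1 \<and> K \<ge> 1 \<and> (\<forall>i j. norm (G $ j $ i) \<le> C * K ^ (i + j))"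
  then obtain C K where C: "C \<ge> 1" "K \<ge> 1" and le: "\<And>i j. norm (G $ j $ i) \<le> C * K ^ (i + j)" by blast
  \<comment> \<open>This radius makes \<open>K * r\<close> equal to \<open>1/2\<close>, so the
    double geometric series is bounded by \<open>4\<close>.\<close>
  define r where "r = inverse (2 * K)"
  have r: "r > 0" using C by (simp add: r_def)
  have b: "norm (G $ j $ i) * r ^ (i + j) \<le> C * ((1/2) ^ i * (1/2) ^ j)" for i j
  proof -
    have "norm (G $ j $ i) * r ^ (i + j) \<le> C * K ^ (i + j) * r ^ (i + j)"
      using le r by (intro mult_right_mono) auto
    also have "\<dots> = C * (K * r) ^ (i + j)" by (simp add: power_mult_distrib mult.assoc)
    also have "K * r = 1/2" using C by (simp add: r_def)
    finally show ?thesis by (simp add: power_add)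
  qed
  have g: "(\<Sum>i<n. (1/2) ^ i) \<le> (2::real)" for n
    using geometric_sum[of "1/2 :: real" n] by simp
  have "(\<lambda>(i, j). norm (G $ j $ i) * r ^ (i + j)) summable_on (UNIV :: (nat \<times> nat) set)"
  proof (rule nonneg_bdd_above_summable_on)
    show "bdd_above (sum (\<lambda>(i, j). norm (G $ j $ i) * r ^ (i + j)) ` {F. F \<subseteq> UNIV \<and> finite F})"
    proof (rule bdd_aboveI2[of _ _ "C * 4"], clarify)
      fix F :: "(nat \<times> nat) set" assume F: "finite F"
      obtain n where n: "fst ` F \<union> snd ` F \<subseteq> {..<n}"
        using finite_nat_bounded[of "fst ` F \<union> snd ` F"] F by auto
      have n: "F \<subseteq> {..<n} \<times> {..<n}"
      proof
        fix p assume "p \<in> F"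
        then have "fst p \<in> fst ` F \<union> snd ` F" "snd p \<in> fst ` F \<union> snd ` F" by simp_all
        with n show "p \<in> {..<n} \<times> {..<n}" by (metis mem_Times_iff subsetD)
      qed
      have "(\<Sum>(i, j)\<in>F. norm (G $ j $ i) * r ^ (i + j)) \<le> (\<Sum>(i, j)\<in>F. C * ((1/2) ^ i * (1/2) ^ j))"
        using b by (intro sum_mono) (simp add: case_prod_unfold)
      also have "\<dots> \<le> (\<Sum>(i, j)\<in>{..<n} \<times> {..<n}. C * ((1/2) ^ i * (1/2) ^ j))"
        using n C by (intro sum_mono2) auto
      also have "\<dots> = (\<Sum>i<n. \<Sum>j<n. C * ((1/2) ^ i * (1/2) ^ j))"
        by (rule sum.cartesian_product[symmetric])
      also have "\<dots> = C * ((\<Sum>i<n. (1/2) ^ i) * (\<Sum>j<n. (1/2) ^ j))"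
        by (subst sum_product) (simp only: sum_distrib_left)
      also have "\<dots> \<le> C * (2 * 2)"
        using C g by (intro mult_left_mono mult_mono) (auto intro!: sum_nonneg)
      finally show "(\<Sum>(i, j)\<in>F. norm (G $ j $ i) * r ^ (i + j)) \<le> C * 4" by simp
    qed
  qed (use r in auto)
  then show "G \<in> conv_series" using r by (auto simp: conv_series_def)
qed

lemma conv_series_I:
  assumes "\<And>i j. norm (G $ j $ i) \<le> C * K ^ (i + j)"
  shows "G \<in> conv_series"
  unfolding conv_series_iff
proof (intro exI conjI allI)
  fix i j
  have "norm (G $ j $ i) \<le> \<bar>C\<bar> * \<bar>K\<bar> ^ (i + j)"
    using assms[of j i] by (simp add: abs_mult[symmetric] power_abs[symmetric])
  also have "\<dots> \<le> (max 1 \<bar>C\<bar>) * (max 1 \<bar>K\<bar>) ^ (i + j)" by (intro mult_mono power_mono) auto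
  finally show "norm (G $ j $ i) \<le> (max 1 \<bar>C\<bar>) * (max 1 \<bar>K\<bar>) ^ (i + j)" .
qed auto

lemma of_nat_le_power: "real (Suc n) \<le> 2 ^ n"
  by (induction n) auto

text \<open>The factor \<open>2 ^ (i + j)\<close> leaves room for the integer factor of a
  derivative, the offsets \<open>a\<close> and \<open>b\<close> for shifts of the
  coefficients.\<close>

lemma conv_series_compare:
  assumes "G \<in> conv_series"
    and "\<And>i j. norm (H $ j $ i) \<le> (A * 2 ^ (i + j)) * norm (G $ (j + a) $ (i + b))"
  shows "H \<in> conv_series"
proof -
  obtain C K where C: "C \<ge> 1" "K \<ge> 1" and le: "\<And>i j. norm (G $ j $ i) \<le> C * K ^ (i + j)"
    using assms(1) by (auto simp: conv_series_iff)
  have "norm (H $ j $ i) \<le> (\<bar>A\<bar> * C * K ^ (a + b)) * (2 * K) ^ (i + j)" for i j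
  proof -
    have "norm (H $ j $ i) \<le> (\<bar>A\<bar> * 2 ^ (i + j)) * norm (G $ (j + a) $ (i + b))"
      by (rule order_trans[OF assms(2)]) (intro mult_right_mono, auto)
    also have "\<dots> \<le> (\<bar>A\<bar> * 2 ^ (i + j)) * (C * K ^ ((i + b) + (j + a)))"
      using le by (intro mult_left_mono) auto
    finally show ?thesis by (simp add: power_add power_mult_distrib mult_ac)
  qed
  then show ?thesis by (rule conv_series_I)
qed

lemma conv_add [intro]:
  assumes "G \<in> conv_series" "H \<in> conv_series" shows "G + H \<in> conv_series"
proof -
  obtain C K where C: "C \<ge> 1" "K \<ge> 1" and le: "\<And>i j. norm (G $ j $ i) \<le> C * K ^ (i + j)"
    using assms(1) by (auto simp: conv_series_iff)
  obtain D L where D: "D \<ge> 1" "L \<ge> 1" and le': "\<And>i j. norm (H $ j $ i) \<le> D * L ^ (i + j)"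
    using assms(2) by (auto simp: conv_series_iff)
  have "norm ((G + H) $ j $ i) \<le> (C + D) * (max K L) ^ (i + j)" for i j
  proof -
    have "norm ((G + H) $ j $ i) \<le> C * K ^ (i + j) + D * L ^ (i + j)"
      using norm_triangle_mono[OF le[of j i] le'[of j i]] by simp
    also have "\<dots> \<le> C * (max K L) ^ (i + j) + D * (max K L) ^ (i + j)"
      using C D by (intro add_mono mult_left_mono power_mono) auto
    finally show ?thesis by (simp add: algebra_simps)
  qed
  then show ?thesis by (rule conv_series_I)
qed

lemma mult_nth2:
  "(G * H) $ j $ i = (\<Sum>l\<le>j. \<Sum>k\<le>i. G $ l $ k * H $ (j - l) $ (i - k :: nat) :: 'a::comm_ring_1)"
  by (simp add: mult_sum_nth fps_sum_nth)

text \<open>The coefficient is a sum of \<open>Suc i * Suc j\<close> terms with a common bound;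
  their number is at most \<open>2 ^ (i + j)\<close> and is absorbed by doubling the ratio.\<close>

lemma conv_mult [intro]:
  assumes "G \<in> conv_series" "H \<in> conv_series" shows "G * H \<in> conv_series"
proof -
  obtain C K where C: "C \<ge> 1" "K \<ge> 1" and le: "\<And>i j. norm (G $ j $ i) \<le> C * K ^ (i + j)"
    using assms(1) by (auto simp: conv_series_iff)
  obtain D L where D: "D \<ge> 1" "L \<ge> 1" and le': "\<And>i j. norm (H $ j $ i) \<le> D * L ^ (i + j)"
    using assms(2) by (auto simp: conv_series_iff)
  define M where "M = max K L"
  have M: "M \<ge> 1" using C by (simp add: M_def)
  have "norm ((G * H) $ j $ i) \<le> (C * D) * (2 * M) ^ (i + j)" for i j
  proof -
    have "norm ((G * H) $ j $ i) \<le> (\<Sum>l\<le>j. \<Sum>k\<le>i. norm (G $ l $ k * H $ (j - l) $ (i - k)))"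
      unfolding mult_nth2 by (intro sum_norm_le order_refl)
    also have "\<dots> \<le> (\<Sum>l\<le>j. \<Sum>k\<le>i. C * D * M ^ (i + j))"
    proof (intro sum_mono)
      fix l k assume lk: "l \<in> {..j}" "k \<in> {..i}"
      have "norm (G $ l $ k * H $ (j - l) $ (i - k)) \<le> (C * M ^ (k + l)) * (D * M ^ ((i - k) + (j - l)))"
        unfolding norm_mult
      proof (rule mult_mono)
        show "norm (G $ l $ k) \<le> C * M ^ (k + l)"
          using C by (intro order_trans[OF le] mult_left_mono power_mono) (auto simp: M_def)
        show "norm (H $ (j - l) $ (i - k)) \<le> D * M ^ (i - k + (j - l))"
          using D by (intro order_trans[OF le'] mult_left_mono power_mono) (auto simp: M_def)
      qed (use C D M in auto)
      also have "\<dots> = C * D * M ^ ((k + l) + ((i - k) + (j - l)))" by (simp add: power_add)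
      also have "(k + l) + ((i - k) + (j - l)) = i + j" using lk by simp
      finally show "norm (G $ l $ k * H $ (j - l) $ (i - k)) \<le> C * D * M ^ (i + j)" .
    qed
    also have "\<dots> = (real (Suc i) * real (Suc j)) * (C * D * M ^ (i + j))" by simp
    also have "\<dots> \<le> (2 ^ i * 2 ^ j) * (C * D * M ^ (i + j))"
      using C D M of_nat_le_power[of i] of_nat_le_power[of j] by (intro mult_right_mono mult_mono) auto
    finally show ?thesis by (simp add: power_add power_mult_distrib mult_ac)
  qed
  then show ?thesis by (rule conv_series_I)
qed

lemma conv_fps_const: "fps_conv_radius f > 0 \<Longrightarrow> fps_const f \<in> conv_series"
proof -
  assume "fps_conv_radius f > 0"
  then obtain C K where CK: "\<And>n. norm (f $ n) \<le> C * K ^ n" by (auto simp: fps_conv_radius_pos_iff)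
  have "0 \<le> C" using CK[of 0] norm_ge_zero[of "f $ 0"] by (simp del: norm_ge_zero)
  have "norm (fps_const f $ j $ i) \<le> C * \<bar>K\<bar> ^ (i + j)" for i j
    using CK[of i] \<open>0 \<le> C\<close> by (cases j) (auto intro: order_trans[OF CK] simp: power_abs[symmetric] intro!: mult_left_mono)
  then show ?thesis by (rule conv_series_I)
qed

lemma conv_cst [simp, intro]: "cst c \<in> conv_series"
  by (rule conv_fps_const) simp

lemma conv_0 [simp, intro]: "0 \<in> conv_series" and conv_1 [simp, intro]: "1 \<in> conv_series"
  using conv_cst[of 0] conv_cst[of 1] by simp_all

lemma conv_var_x [simp, intro]: "var_x \<in> conv_series"
  by (rule conv_fps_const) simp

lemma conv_var_y [simp, intro]: "var_y \<in> conv_series"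
  by (rule conv_series_I[of _ 1 1]) (auto simp: fps_X_def)

lemma conv_uminus [intro]: "G \<in> conv_series \<Longrightarrow> - G \<in> conv_series"
  using conv_mult[OF conv_cst[of "- 1"], of G] by (simp flip: fps_const_neg)

lemma conv_diff [intro]: "G \<in> conv_series \<Longrightarrow> H \<in> conv_series \<Longrightarrow> G - H \<in> conv_series"
  using conv_add[OF _ conv_uminus, of G H] by simp

lemma conv_power [intro]: "G \<in> conv_series \<Longrightarrow> G ^ n \<in> conv_series"
  by (induction n) auto

lemma conv_of_nat [simp, intro]: "of_nat n \<in> conv_series"
  by (metis conv_cst fps_of_nat)

lemma subspace_conv: "E.subspace conv_series"
  by (auto simp: E.subspace_def)

lemma conv_partial_x [intro]: "G \<in> conv_series \<Longrightarrow> partial_x G \<in> conv_series"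
proof (rule conv_series_compare[where a = 0 and b = 1 and A = 1 and G = G])
  fix i j
  have "real (Suc i) \<le> 2 ^ (i + j)"
    using of_nat_le_power[of i] by (rule order_trans) (simp add: power_increasing)
  then show "norm (partial_x G $ j $ i) \<le> 1 * 2 ^ (i + j) * norm (G $ (j + 0) $ (i + 1))"
    by (auto simp: partial_x_def norm_mult simp del: of_nat_Suc intro!: mult_right_mono)
qed

lemma fps_of_nat_mult_nth: "(of_nat n * f :: 'a::comm_ring_1 fps) $ i = of_nat n * f $ i"
  by (simp flip: fps_of_nat)

lemma conv_partial_y [intro]: "G \<in> conv_series \<Longrightarrow> partial_y G \<in> conv_series"
proof (rule conv_series_compare[where a = 1 and b = 0 and A = 1 and G = G])
  fix i j
  have "real (Suc j) \<le> 2 ^ (i + j)"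
    using of_nat_le_power[of j] by (rule order_trans) (simp add: power_increasing)
  moreover have "partial_y G $ j $ i = of_nat (Suc j) * G $ (j + 1) $ i"
    by (simp add: partial_y_def fps_of_nat_mult_nth del: of_nat_Suc)
  ultimately show "norm (partial_y G $ j $ i) \<le> 1 * 2 ^ (i + j) * norm (G $ (j + 1) $ (i + 0))"
    by (auto simp: norm_mult simp del: of_nat_Suc intro!: mult_right_mono)
qed

lemma conv_fps_of_poly: "p \<in> conv_polys \<Longrightarrow> fps_of_poly p \<in> conv_series"
proof (induction p)
  case (pCons a p)
  have "fps_conv_radius a > 0" "p \<in> conv_polys"
    using pCons.prems unfolding conv_polys_def
    by (auto dest: spec[of _ 0] spec[of _ "Suc _"] simp: coeff_pCons split: nat.splits)
       (metis coeff_pCons_0, metis coeff_pCons_Suc)?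
  then show ?case using pCons.IH by (auto simp: fps_of_poly_pCons intro!: conv_add conv_mult conv_fps_const)
qed simp

text \<open>Majorant argument: after scaling, \<open>G\<close> is \<open>1 - h\<close> with
  \<open>h\<close> vanishing at the origin, and the formal inverse satisfies
  \<open>u = 1 + h * u\<close>, which bounds each coefficient by earlier ones.\<close>

lemma conv_unit:
  assumes G: "G \<in> conv_series" and G0: "G $ 0 $ 0 \<noteq> 0"
  shows "\<exists>H\<in>conv_series. G * H = 1"
proof -
  define c where "c = G $ 0 $ 0"
  define h where "h = 1 - cst (inverse c) * G"
  have h: "h \<in> conv_series" "h $ 0 $ 0 = 0" using G G0 by (auto simp: h_def c_def)
  obtain u where u: "(1 - h) * u = 1" using fps_fps_unit[of "1 - h"] h by auto
  obtain C K where C: "C \<ge> 1" "K \<ge> 1" and le: "\<And>i j. norm (h $ j $ i) \<le> C * K ^ (i + j)"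
    using h by (auto simp: conv_series_iff)
  \<comment> \<open>The relation \<open>6 * q * C = 1\<close> closes the induction: the sum of
    \<open>q ^ (l + k)\<close> over all \<open>(l, k)\<close> in the range except
    \<open>(0, 0)\<close> is at most \<open>(1 + 2 * q) ^ 2 - 1\<close>, hence at most
    \<open>6 * q\<close>.\<close>
  define q where "q = inverse (6 * C)"
  define M where "M = K * (6 * C)"
  have q: "0 < q" "q \<le> 1/2" and qM: "q * M = K" and qC: "6 * q * C = 1" and M: "M > 0"
    using C by (auto simp: q_def M_def field_simps)
  have geo: "(\<Sum>k\<le>n. q ^ k) \<le> 1 + 2 * q" for n
  proof -
    have "(\<Sum>k\<le>n. q ^ k) = (1 - q ^ Suc n) / (1 - q)"
      using q sum_gp0[of q n] by simp
    also have "\<dots> \<le> 1 / (1 - q)" using q by (intro divide_right_mono) auto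
    also have "\<dots> \<le> 1 + 2 * q" using q by (simp add: field_simps) 
    finally show ?thesis .
  qed
  have ueq: "u = 1 + h * u" using u by (simp add: algebra_simps)
  have "norm (u $ j $ i) \<le> M ^ (i + j)" for i j
  proof (induction "i + j" arbitrary: i j rule: less_induct)
    case less
    show ?case
    proof (cases "i + j = 0")
      case True
      then show ?thesis using arg_cong[OF ueq, of "\<lambda>f. f $ 0 $ 0"] h by (simp add: mult_nth2)
    next
      case False
      let ?A = "{..j} \<times> {..i}"
      have "u $ j $ i = 1 $ j $ i + (h * u) $ j $ i"
        using arg_cong[OF ueq, of "\<lambda>f. f $ j $ i"] by (simp only: fps_add_nth)
      also have "(1 :: complex fps fps) $ j $ i = 0" using False by (cases j) auto
      also have "0 + (h * u) $ j $ i = (\<Sum>(l,k)\<in>?A. h $ l $ k * u $ (j - l) $ (i - k))"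
        by (simp only: mult_nth2 sum.cartesian_product add_0_left)
      also have "\<dots> = (\<Sum>(l,k)\<in>?A - {(0,0)}. h $ l $ k * u $ (j - l) $ (i - k))"
        using h by (intro sum.mono_neutral_right) auto
      finally have "norm (u $ j $ i) \<le> (\<Sum>(l,k)\<in>?A - {(0,0)}. norm (h $ l $ k * u $ (j - l) $ (i - k)))"
        by (simp add: norm_sum case_prod_unfold)
      also have "\<dots> \<le> (\<Sum>(l,k)\<in>?A - {(0,0)}. M ^ (i + j) * C * (q ^ l * q ^ k))"
      proof (rule sum_mono)
        fix p assume "p \<in> ?A - {(0,0)}"
        moreover obtain l k where p: "p = (l, k)" by (cases p)
        ultimately have lk: "l \<le> j" "k \<le> i" "(l, k) \<noteq> (0, 0)" by auto
        have "norm (h $ l $ k * u $ (j - l) $ (i - k)) \<le> (C * K ^ (k + l)) * M ^ ((i - k) + (j - l))"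
          unfolding norm_mult using le lk C M by (intro mult_mono less) auto
        also have "\<dots> = C * (q ^ l * q ^ k) * M ^ ((k + l) + ((i - k) + (j - l)))"
          by (simp add: qM[symmetric] power_mult_distrib power_add)
        also have "(k + l) + ((i - k) + (j - l)) = i + j" using lk by simp
        finally show "(case p of (l,k) \<Rightarrow> norm (h $ l $ k * u $ (j - l) $ (i - k)))
            \<le> (case p of (l,k) \<Rightarrow> M ^ (i + j) * C * (q ^ l * q ^ k))"
          by (simp add: mult_ac p)
      qed
      also have "\<dots> = M ^ (i + j) * C * ((\<Sum>(l,k)\<in>?A. q ^ l * q ^ k) - 1)"
        unfolding case_prod_unfold sum_distrib_left[symmetric] by (subst sum_diff1) auto
      also have "(\<Sum>(l,k)\<in>?A. q ^ l * q ^ k) = (\<Sum>l\<le>j. q ^ l) * (\<Sum>k\<le>i. q ^ k)"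
        by (simp add: sum_product sum.cartesian_product)
      also have "M ^ (i + j) * C * ((\<Sum>l\<le>j. q ^ l) * (\<Sum>k\<le>i. q ^ k) - 1)
          \<le> M ^ (i + j) * C * ((1 + 2 * q) * (1 + 2 * q) - 1)"
        using C M q geo by (intro mult_left_mono diff_right_mono mult_mono) (auto intro!: sum_nonneg)
      also have "(1 + 2 * q) * (1 + 2 * q) - 1 \<le> 6 * q" 
      proof -
        have "q * q \<le> q * (1/2)" using q by (intro mult_left_mono) auto
        then show ?thesis by (simp add: algebra_simps)
      qed
      then have "M ^ (i + j) * C * ((1 + 2 * q) * (1 + 2 * q) - 1) \<le> M ^ (i + j) * C * (6 * q)"
        using C M by (intro mult_left_mono) auto
      also have "\<dots> = M ^ (i + j)" using qC by (simp add: mult_ac)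
      finally show ?thesis .
    qed
  qed
  then have "u \<in> conv_series" by (intro conv_series_I[of _ 1 M]) simp
  then have "cst (inverse c) * u \<in> conv_series" by auto
  moreover have "G * (cst (inverse c) * u) = 1"
    using u by (simp add: h_def mult_ac)
  ultimately show ?thesis by blast
qed

section \<open>Ideals of convergent series and comparison with formal ideals\<close>

lemma ideal_gen_add: "x \<in> ideal_gen S \<Longrightarrow> z \<in> ideal_gen S \<Longrightarrow> x + z \<in> ideal_gen S"
proof -
  assume "x \<in> ideal_gen S" "z \<in> ideal_gen S"
  then obtain a b where "x = (\<Sum>s\<in>S. a s * s)" "\<forall>s\<in>S. a s \<in> conv_series"
    "z = (\<Sum>s\<in>S. b s * s)" "\<forall>s\<in>S. b s \<in> conv_series" by (auto simp: ideal_gen_def)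
  then show ?thesis unfolding ideal_gen_def
    by (intro CollectI exI[of _ "\<lambda>s. a s + b s"]) (auto simp: sum.distrib distrib_right)
qed

lemma ideal_gen_mult: "x \<in> ideal_gen S \<Longrightarrow> z \<in> conv_series \<Longrightarrow> z * x \<in> ideal_gen S"
proof -
  assume z: "z \<in> conv_series" and "x \<in> ideal_gen S"
  then obtain a where "x = (\<Sum>s\<in>S. a s * s)" "\<forall>s\<in>S. a s \<in> conv_series"
    by (auto simp: ideal_gen_def)
  then show ?thesis using z unfolding ideal_gen_def
    by (intro CollectI exI[of _ "\<lambda>s. z * a s"]) (auto simp: sum_distrib_left mult.assoc)
qed

lemma ideal_gen_0: "0 \<in> ideal_gen S"
  unfolding ideal_gen_def by (intro CollectI exI[of _ "\<lambda>_. 0"]) simp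

lemma subspace_ideal_gen: "E.subspace (ideal_gen S)"
  unfolding E.subspace_def by (auto intro: ideal_gen_add ideal_gen_mult ideal_gen_0)

lemma ideal_gen_sum: "(\<And>i. i \<in> A \<Longrightarrow> f i \<in> ideal_gen S) \<Longrightarrow> sum f A \<in> ideal_gen S"
  by (rule E.subspace_sum[OF subspace_ideal_gen])

lemma ideal_gen_mult_gen:
  assumes "finite S" "s \<in> S" "c \<in> conv_series" shows "c * s \<in> ideal_gen S"
proof -
  have "(\<Sum>t\<in>S. (if t = s then c else 0) * t) = (\<Sum>t\<in>{s}. c * t)"
    by (rule sum.mono_neutral_cong_right) (use assms in auto)
  then show ?thesis unfolding ideal_gen_def using assms
    by (intro CollectI exI[of _ "\<lambda>t. if t = s then c else 0"]) auto
qed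

text \<open>If \<open>P = G\<close>, the generating set has one element and the two coefficients
  merge into one; this is why both inclusions distinguish cases.\<close>

lemma ideal_gen_pair:
  "ideal_gen {P, G} = {a * P + b * G | a b. a \<in> conv_series \<and> b \<in> conv_series}"
proof (intro equalityI subsetI)
  fix H assume "H \<in> ideal_gen {P, G}"
  then obtain a where a: "H = (\<Sum>s\<in>{P, G}. a s * s)" "\<forall>s\<in>{P, G}. a s \<in> conv_series"
    by (auto simp: ideal_gen_def)
  show "H \<in> {a * P + b * G | a b. a \<in> conv_series \<and> b \<in> conv_series}"
  proof (cases "P = G")
    case True
    then have "H = a P * P + 0 * G" using a by simp
    then show ?thesis using a(2) conv_0 by blast
  next
    case False
    then have "H = a P * P + a G * G" using a by simp
    then show ?thesis using a(2) by blast
  qed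
next
  fix H assume "H \<in> {a * P + b * G | a b. a \<in> conv_series \<and> b \<in> conv_series}"
  then obtain a b where ab: "H = a * P + b * G" "a \<in> conv_series" "b \<in> conv_series" by blast
  show "H \<in> ideal_gen {P, G}"
  proof (cases "P = G")
    case True
    then have "H = (\<Sum>s\<in>{P, G}. (\<lambda>s. a + b) s * s)" using ab by (simp add: algebra_simps)
    then show ?thesis using ab(2,3) unfolding ideal_gen_def by (auto intro!: exI[of _ "\<lambda>s. a + b"])
  next
    case False
    then have "H = (\<Sum>s\<in>{P, G}. (\<lambda>s. if s = P then a else b) s * s)" using ab by simp
    then show ?thesis using ab(2,3) unfolding ideal_gen_def
      by (intro CollectI exI[of _ "\<lambda>s. if s = P then a else b"]) auto
  qed
qed

lemma quotient_dim_codim: "quotient_dim I = codim scl conv_series I"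
  by (simp add: quotient_dim_def codim_def)

text \<open>Induction on the generators: the coefficient of \<open>e a\<close> in its own relation
  has no constant term, so \<open>1 - c a\<close> is a unit and \<open>e a\<close> can be eliminated
  from the other relations.\<close>

lemma nakayama:
  assumes "finite A"
    and "\<And>i. i \<in> A \<Longrightarrow> \<exists>j\<in>ideal_gen {P, G}. \<exists>c. (\<forall>k\<in>A. c k \<in> conv_series \<and> c k $ 0 $ 0 = 0) \<and>
      e i = j + (\<Sum>k\<in>A. c k * e k)"
  shows "\<forall>i\<in>A. e i \<in> ideal_gen {P, G}"
  using assms
proof (induction A)
  case (insert a A)
  let ?J = "ideal_gen {P, G}"
  obtain j c where j: "j \<in> ?J" and c: "\<And>k. k \<in> insert a A \<Longrightarrow> c k \<in> conv_series \<and> c k $ 0 $ 0 = 0"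
    and ea: "e a = j + (\<Sum>k\<in>insert a A. c k * e k)" using insert.prems[of a] by blast
  have "1 - c a \<in> conv_series" "(1 - c a) $ 0 $ 0 \<noteq> 0" using c[of a] by auto
  from conv_unit[OF this] obtain w where w: "w \<in> conv_series" "(1 - c a) * w = 1" by blast
  have "(1 - c a) * e a = j + (\<Sum>k\<in>A. c k * e k)" using ea insert.hyps by (simp add: algebra_simps)
  then have "w * ((1 - c a) * e a) = w * j + (\<Sum>k\<in>A. w * c k * e k)"
    by (simp add: distrib_left sum_distrib_left mult.assoc)
  moreover have "w * ((1 - c a) * e a) = e a" using w(2) by (metis mult.assoc mult.commute mult_1)
  ultimately have ea': "e a = w * j + (\<Sum>k\<in>A. w * c k * e k)" by simp
  have J: "\<forall>i\<in>A. e i \<in> ?J"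
  proof (rule insert.IH)
    fix i assume i: "i \<in> A"
    then obtain j' c' where j': "j' \<in> ?J" and c': "\<And>k. k \<in> insert a A \<Longrightarrow> c' k \<in> conv_series \<and> c' k $ 0 $ 0 = 0"
      and ei: "e i = j' + (\<Sum>k\<in>insert a A. c' k * e k)" using insert.prems[of i] by blast
    have "e i = (j' + c' a * (w * j)) + (\<Sum>k\<in>A. (c' k + c' a * (w * c k)) * e k)"
    proof -
      have "e i = j' + c' a * (w * j + (\<Sum>k\<in>A. w * c k * e k)) + (\<Sum>k\<in>A. c' k * e k)"
        using ei insert.hyps by (simp add: ea'[symmetric] add.assoc)
      then show ?thesis by (simp add: distrib_left distrib_right sum.distrib sum_distrib_left mult.assoc add_ac)
    qed
    moreover have "j' + c' a * (w * j) \<in> ?J"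
      using j j' c' w by (auto intro!: ideal_gen_add ideal_gen_mult)
    moreover have "\<forall>k\<in>A. c' k + c' a * (w * c k) \<in> conv_series \<and> (c' k + c' a * (w * c k)) $ 0 $ 0 = 0"
      using c c' w by auto
    ultimately show "\<exists>j\<in>?J. \<exists>c. (\<forall>k\<in>A. c k \<in> conv_series \<and> c k $ 0 $ 0 = 0) \<and>
      e i = j + (\<Sum>k\<in>A. c k * e k)" by (intro bexI exI conjI)
  qed
  have "e a \<in> ?J" unfolding ea'
    using J j c w by (intro ideal_gen_add ideal_gen_sum ideal_gen_mult conv_mult) auto
  with J show ?case by simp
qed simp

text \<open>A polynomial, hence convergent for every formal \<open>G\<close>; it replaces formal
  coefficients at the price of an error in \<open>ord_ge N\<close>.\<close>

definition truncate2 :: "nat \<Rightarrow> complex fps fps \<Rightarrow> complex fps fps" where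
  "truncate2 N G = Abs_fps (\<lambda>j. Abs_fps (\<lambda>i. if i + j < N then G $ j $ i else 0))"

lemma conv_truncate2 [simp, intro]: "truncate2 N G \<in> conv_series"
proof (rule conv_series_I)
  fix i j
  show "norm (truncate2 N G $ j $ i) \<le> (\<Sum>(i,j)\<in>{..<N} \<times> {..<N}. norm (G $ j $ i)) * 1 ^ (i + j)"
  proof (cases "i + j < N")
    case True
    then have "norm (G $ j $ i) = (\<Sum>(i,j)\<in>{(i,j)}. norm (G $ j $ i))" by simp
    also have "\<dots> \<le> (\<Sum>(i,j)\<in>{..<N} \<times> {..<N}. norm (G $ j $ i))"
      using True by (intro sum_mono2) auto
    finally show ?thesis using True by (simp add: truncate2_def)
  qed (auto simp: truncate2_def intro!: sum_nonneg)
qed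

lemma truncate2_ord_ge: "G - truncate2 N G \<in> ord_ge N"
  by (simp add: truncate2_def ord_ge_def)

lemma ord_ge_add: "G \<in> ord_ge N \<Longrightarrow> H \<in> ord_ge N \<Longrightarrow> G + H \<in> ord_ge N"
  by (simp add: ord_ge_def)

lemma ord_ge_mult: "G \<in> ord_ge N \<Longrightarrow> H * G \<in> ord_ge N"
  unfolding ord_ge_def by (auto simp: mult_nth2 intro!: sum.neutral)

lemma monomial_mult_nth:
  "(a * (var_x ^ k * var_y ^ l)) $ j $ i = (if k \<le> i \<and> l \<le> j then a $ (j - l) $ (i - k) else 0)"
  by (simp add: mult.assoc[symmetric] fps_X_power_mult_right_nth fps_const_power)

lemma ord_ge_expansion:
  assumes H: "H \<in> conv_series" "H \<in> ord_ge N"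
  shows "\<exists>a. (\<forall>i\<le>N. a i \<in> conv_series) \<and> (H \<in> ord_ge (Suc N) \<longrightarrow> (\<forall>i\<le>N. a i $ 0 $ 0 = 0)) \<and>
    H = (\<Sum>i\<le>N. a i * (var_x ^ i * var_y ^ (N - i)))"
proof -
  \<comment> \<open>Each monomial of \<open>H\<close> is charged to exactly one \<open>i\<close>,
    the smaller of its \<open>x\<close>-exponent and \<open>N\<close>. The constant terms of the
    \<open>a i\<close> are thus the coefficients of degree \<open>N\<close>.\<close>
  define a where "a = (\<lambda>i. Abs_fps (\<lambda>l. Abs_fps (\<lambda>k. if i = N then H $ l $ (k + N)
      else if k = 0 then H $ (l + (N - i)) $ i else 0)))"
  show ?thesis
  proof (intro exI[of _ a] conjI allI impI)
    fix i assume i: "i \<le> N"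
    show "a i \<in> conv_series"
    proof (rule conv_series_compare[OF H(1), of _ 1 "N - i" i])
      fix k l
      have "norm (a i $ l $ k) \<le> norm (H $ (l + (N - i)) $ (k + i))" by (auto simp: a_def)
      also have "\<dots> \<le> 1 * 2 ^ (k + l) * norm (H $ (l + (N - i)) $ (k + i))"
        by (simp add: mult_le_cancel_right1)
      finally show "norm (a i $ l $ k) \<le> 1 * 2 ^ (k + l) * norm (H $ (l + (N - i)) $ (k + i))" .
    qed
    show "a i $ 0 $ 0 = 0" if "H \<in> ord_ge (Suc N)"
      using that i by (auto simp: a_def ord_ge_def)
  next
    show "H = (\<Sum>i\<le>N. a i * (var_x ^ i * var_y ^ (N - i)))"
    proof (rule fps_ext, rule fps_ext)
      fix j m
      have "(\<Sum>i\<le>N. a i * (var_x ^ i * var_y ^ (N - i))) $ j $ m =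
          (\<Sum>i\<in>{min m N}. H $ j $ m)"
        unfolding fps_sum_nth monomial_mult_nth
        by (rule sum.mono_neutral_cong_right) (use H(2) in \<open>auto simp: a_def ord_ge_def min_def\<close>)
      then show "H $ j $ m = (\<Sum>i\<le>N. a i * (var_x ^ i * var_y ^ (N - i))) $ j $ m" by simp
    qed
  qed
qed

text \<open>Cutting off the formal coefficients of the degree \<open>K\<close> monomials
  \<open>e i\<close> leaves an error of order \<open>Suc K\<close>. This error is a combination of
  the \<open>e k\<close> with coefficients vanishing at the origin, the situation of
  \<open>nakayama\<close>.\<close>

lemma ord_ge_subset_ideal_gen:
  assumes PG: "P \<in> conv_series" "G \<in> conv_series" and K: "ord_ge K \<subseteq> ideal2 P G"
  shows "conv_series \<inter> ord_ge K \<subseteq> ideal_gen {P, G}"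
proof -
  let ?J = "ideal_gen {P, G}"
  define e where "e = (\<lambda>i. var_x ^ i * var_y ^ (K - i))"
  have ec: "e i \<in> conv_series" for i
    unfolding e_def by (intro conv_mult conv_power conv_var_x conv_var_y)
  have eK: "e i \<in> ord_ge K" if "i \<le> K" for i
    unfolding ord_ge_def using that monomial_mult_nth[of 1 i "K - i"]
    by (auto simp: e_def fps_one_nth split: if_splits)
  have "\<forall>i\<in>{..K}. e i \<in> ?J"
  proof (rule nakayama)
    fix i assume i: "i \<in> {..K}"
    then obtain a b where ab: "e i = a * P + b * G" using eK K by (force simp: ideal2_def)
    define j where "j = truncate2 (Suc K) a * P + truncate2 (Suc K) b * G"
    have j: "j \<in> ?J" unfolding j_def ideal_gen_pair by blast
    have jc: "j \<in> conv_series" using PG by (auto simp: j_def)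
    have "e i - j = P * (a - truncate2 (Suc K) a) + G * (b - truncate2 (Suc K) b)"
      by (simp add: ab j_def algebra_simps)
    also have "\<dots> \<in> ord_ge (Suc K)" by (intro ord_ge_add ord_ge_mult truncate2_ord_ge)
    finally have o: "e i - j \<in> ord_ge (Suc K)" .
    then have "e i - j \<in> ord_ge K" by (simp add: ord_ge_def)
    from ord_ge_expansion[OF conv_diff[OF ec jc] this] o obtain c where
      "\<forall>k\<le>K. c k \<in> conv_series" "\<forall>k\<le>K. c k $ 0 $ 0 = 0" "e i - j = (\<Sum>k\<le>K. c k * e k)"
      unfolding e_def by blast
    then show "\<exists>j\<in>?J. \<exists>c. (\<forall>k\<in>{..K}. c k \<in> conv_series \<and> c k $ 0 $ 0 = 0) \<and>
        e i = j + (\<Sum>k\<in>{..K}. c k * e k)"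
      using j by (intro bexI[of _ j] exI[of _ c]) (auto simp: diff_eq_eq add.commute)
  qed simp
  then have eJ: "e i \<in> ?J" if "i \<le> K" for i using that by simp
  show ?thesis
  proof clarify
    fix H assume "H \<in> conv_series" "H \<in> ord_ge K"
    from ord_ge_expansion[OF this] obtain c where
      "\<forall>k\<le>K. c k \<in> conv_series" "H = (\<Sum>k\<le>K. c k * e k)"
      unfolding e_def by blast
    then show "H \<in> ?J" using eJ by (auto intro!: ideal_gen_sum ideal_gen_mult)
  qed
qed

text \<open>No Weierstrass division is needed here, because the ideal contains a power of the maximal
  ideal: it suffices to truncate the formal coefficients and to apply Nakayama's lemma.\<close>

theorem quotient_dim_formal:
  assumes PG: "P \<in> conv_series" "G \<in> conv_series" and d: "has_codim scl UNIV (ideal2 P G) d"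
  shows "quotient_dim (ideal_gen {P, G}) = enat d"
proof -
  let ?J = "ideal_gen {P, G}"
  obtain K where K: "ord_ge K \<subseteq> ideal2 P G" using ord_ge_subset_ideal2[OF d] by blast
  note KJ = ord_ge_subset_ideal_gen[OF PG K]
  have "conv_series \<inter> (\<lambda>v. v) -` ideal2 P G = ?J"
  proof (intro equalityI subsetI)
    fix H assume "H \<in> conv_series \<inter> (\<lambda>v. v) -` ideal2 P G"
    then obtain a b where H: "H \<in> conv_series" "H = a * P + b * G" by (auto simp: ideal2_def)
    define j where "j = truncate2 K a * P + truncate2 K b * G"
    have j: "j \<in> ?J" unfolding j_def ideal_gen_pair by blast
    have jc: "j \<in> conv_series" using PG by (auto simp: j_def)
    have "H - j = P * (a - truncate2 K a) + G * (b - truncate2 K b)"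
      by (simp add: H j_def algebra_simps)
    also have "\<dots> \<in> ord_ge K" by (intro ord_ge_add ord_ge_mult truncate2_ord_ge)
    finally have "H - j \<in> ?J" using KJ conv_diff[OF H(1) jc] by blast
    from ideal_gen_add[OF this j] show "H \<in> ?J" by simp
  next
    fix H assume "H \<in> ?J"
    then show "H \<in> conv_series \<inter> (\<lambda>v. v) -` ideal2 P G" using PG by (auto simp: ideal_gen_pair ideal2_def)
  qed
  \<comment> \<open>Convergent series surject onto the formal quotient, since a series differs from
    its truncation by an element of \<open>ord_ge K\<close>.\<close>
  moreover have "has_codim scl conv_series (conv_series \<inter> (\<lambda>v. v) -` ideal2 P G) d"
  proof (rule EE.has_codim_preimage[OF _ subspace_ideal2 _ _ d subspace_conv])
    show "Vector_Spaces.linear scl scl (\<lambda>v. v)" by (rule E_linearI) auto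
    show "\<exists>v\<in>conv_series. z - v \<in> ideal2 P G" for z
      using K truncate2_ord_ge[of z K] by (intro bexI[of _ "truncate2 K z"]) auto
  qed auto
  ultimately have "has_codim scl conv_series ?J d" by simp
  then show ?thesis unfolding quotient_dim_codim by (rule E.codim_eq[OF subspace_ideal_gen])
qed

text \<open>Both generators vanish on the curve \<open>(t ^ n, b)\<close>, hence so does the whole
  ideal, while distinct powers of \<open>x\<close> pull back to distinct powers of
  \<open>t\<close>.\<close>

lemma quotient_dim_infinite:
  assumes n: "n > 0" and b: "fps_X dvd b"
    and P: "subst_curve P (fps_X ^ n) b = 0" and G: "subst_curve G (fps_X ^ n) b = 0"
  shows "quotient_dim (ideal_gen {P, G}) = \<infinity>"
proof -
  let ?S = "\<lambda>H. subst_curve H (fps_X ^ n) b"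
  have Xn: "fps_X dvd (fps_X ^ n :: complex fps)" using n by (simp add: dvd_power)
  have "enat d \<le> quotient_dim (ideal_gen {P, G})" for d
    unfolding quotient_dim_codim
  proof (rule E.indep_family_codim[OF subspace_ideal_gen])
    show "indep_mod scl (ideal_gen {P, G}) (\<lambda>i. var_x ^ i) d"
      unfolding indep_mod_def
    proof (intro allI impI)
      fix c i assume "(\<Sum>i<d. cst (c i) * var_x ^ i) \<in> ideal_gen {P, G}" and i: "i < d"
      then obtain p q where "(\<Sum>i<d. cst (c i) * var_x ^ i) = p * P + q * G"
        by (auto simp: ideal_gen_pair)
      then have "?S (\<Sum>i<d. cst (c i) * var_x ^ i) = ?S (p * P + q * G)" by (rule arg_cong)
      also have "\<dots> = 0" by (simp add: subst_add subst_mult[OF Xn b] P G)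
      also have "?S (\<Sum>i<d. cst (c i) * var_x ^ i) = (\<Sum>l<d. fps_const (c l) * fps_X ^ (n * l))"
        unfolding subst_sum subst_cst_mult subst_power[OF Xn b] subst_var_x[OF Xn b] power_mult ..
      finally have "(\<Sum>l<d. fps_const (c l) * fps_X ^ (n * l)) $ (n * i) = 0" by simp
      also have "(\<Sum>l<d. fps_const (c l) * fps_X ^ (n * l)) $ (n * i) = (\<Sum>l\<in>{i}. c l)"
        unfolding fps_sum_nth using n i
        by (intro sum.mono_neutral_cong_right) (auto simp: fps_X_power_iff)
      finally show "c i = 0" by simp
    qed
  qed (intro conv_power conv_var_x)
  note le = this
  show ?thesis
  proof (cases "quotient_dim (ideal_gen {P, G})")
    case (enat k)
    then show ?thesis using le[of "Suc k"] by simp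
  qed
qed

section \<open>Hensel's lemma and the Newton-Puiseux theorem\<close>

text \<open>Unlike \<open>degree p < D\<close>, this holds for the zero polynomial also if
  \<open>D = 0\<close>.\<close>

definition vanishes_from :: "nat \<Rightarrow> 'a::zero poly \<Rightarrow> bool" where
  "vanishes_from D p \<longleftrightarrow> (\<forall>i\<ge>D. coeff p i = 0)"

lemma vanishes_from_mult:
  fixes p q :: "'a::comm_ring_1 poly"
  assumes "vanishes_from D q"
  shows "vanishes_from (degree p + D) (p * q)"
  unfolding vanishes_from_def coeff_mult
proof (intro allI impI sum.neutral ballI)
  fix i k assume "i \<ge> degree p + D" "k \<in> {..i}"
  then show "coeff p k * coeff q (i - k) = 0"
    using assms by (cases "k \<le> degree p") (auto simp: vanishes_from_def coeff_eq_0)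
qed

lemma vanishes_from_cancel:
  fixes p q :: "'a::idom poly"
  assumes p: "lead_coeff p = 1" and v: "vanishes_from (degree p + D) (p * q)"
  shows "vanishes_from D q"
proof (cases "q = 0 \<or> degree q < D")
  case False
  then have "coeff (p * q) (degree p + degree q) = 0" using v by (auto simp: vanishes_from_def)
  then show ?thesis using p False by (simp add: coeff_mult_degree_sum)
qed (auto simp: vanishes_from_def coeff_eq_0)

text \<open>Reducing \<open>u\<close> modulo \<open>q\<close> makes its degree small; the degree of
  \<open>v\<close> is then forced by the equation, since \<open>q\<close> is monic.\<close>

lemma bezout_small:
  fixes q r c :: "complex poly"
  assumes cop: "coprime q r" and q: "lead_coeff q = 1" and r: "lead_coeff r = 1"
    and c: "vanishes_from (degree q + degree r) c"
  shows "\<exists>u v. r * u + q * v = c \<and> vanishes_from (degree q) u \<and> vanishes_from (degree r) v"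
proof -
  have q0: "q \<noteq> 0" using q by auto
  obtain a b where ab: "a * q + b * r = 1"
    using bezout_coefficients_fst_snd[of q r] coprime_imp_gcd_eq_1[OF cop] by metis
  define u where "u = (c * b) mod q"
  define v where "v = c * a + r * ((c * b) div q)"
  have "q * ((c * b) div q) + u = c * b" by (simp add: u_def)
  then have "u = c * b - q * ((c * b) div q)" by (simp add: algebra_simps)
  then have "r * u + q * v = c * (a * q + b * r)" by (simp add: v_def ring_distribs mult_ac)
  then have eq: "r * u + q * v = c" by (simp add: ab)
  have u: "vanishes_from (degree q) u"
  proof (cases "u = 0")
    case False
    then have "degree u < degree q" using degree_mod_less[OF q0, of "c * b"] by (simp add: u_def)
    then show ?thesis by (auto simp: vanishes_from_def coeff_eq_0)
  qed (simp add: vanishes_from_def)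
  have "q * v = c - r * u" using eq by (simp add: algebra_simps)
  moreover have "vanishes_from (degree q + degree r) (c - r * u)"
    using c vanishes_from_mult[OF u, of r] by (simp add: vanishes_from_def add.commute)
  ultimately have "vanishes_from (degree r) v" by (metis vanishes_from_cancel[OF q])
  with eq u show ?thesis by blast
qed

lemma coeff_sum_monom_fps:
  "coeff (\<Sum>j\<le>n. monom (f j) j) i = (if i \<le> n then f i else (0::'a::comm_monoid_add))"
  by (simp add: coeff_sum coeff_monom sum.delta)

text \<open>The factors are built one power of the variable at a time: order \<open>k\<close> asks
  for \<open>r0 * Q k + q0 * R k\<close> to equal a polynomial known from earlier orders, and
  \<open>bezout_small\<close> solves this with degrees low enough to keep both factors
  monic.\<close>

theorem hensel_fps:
  fixes p :: "complex fps poly" and q0 r0 :: "complex poly"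
  assumes p: "lead_coeff p = 1" and p0: "map_poly (\<lambda>a. a $ 0) p = q0 * r0"
    and cop: "coprime q0 r0" and q0: "lead_coeff q0 = 1" and r0: "lead_coeff r0 = 1"
  shows "\<exists>q r. p = q * r \<and> lead_coeff q = 1 \<and> degree q = degree q0 \<and>
    lead_coeff r = 1 \<and> degree r = degree r0"
proof -
  define pk where "pk = (\<lambda>k. map_poly (\<lambda>a. a $ k) p)"
  have cpk: "coeff (pk k) i = coeff p i $ k" for k i by (simp add: pk_def coeff_map_poly)
  have nz: "q0 \<noteq> 0" "r0 \<noteq> 0" using q0 r0 by auto
  have degp: "degree p = degree q0 + degree r0"
  proof -
    have "coeff (pk 0) (degree p) = 1" using p by (simp add: cpk)
    moreover have "coeff (pk 0) i = 0" if "i > degree p" for i using that by (simp add: cpk coeff_eq_0)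
    ultimately have "degree (pk 0) = degree p" by (intro antisym degree_le le_degree) auto
    then show ?thesis using p0 nz by (simp add: pk_def degree_mult_eq)
  qed
  \<comment> \<open>\<open>p\<close> is monic, so its top coefficient contributes to order
    \<open>0\<close> only.\<close>
  have pks: "vanishes_from (degree q0 + degree r0) (pk k)" if "k > 0" for k
    unfolding vanishes_from_def
  proof (intro allI impI)
    fix i assume i: "i \<ge> degree q0 + degree r0"
    have "coeff p i $ k = 0"
    proof (cases "i = degree p")
      case True then show ?thesis using p that by simp
    next
      case False then show ?thesis using i degp by (simp add: coeff_eq_0)
    qed
    then show "coeff (pk k) i = 0" by (simp add: cpk)
  qed
  define P where "P = (\<lambda>(f :: nat \<Rightarrow> complex poly \<times> complex poly) k s. if k = 0 then s = (q0, r0) else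
     r0 * fst s + q0 * snd s = pk k - (\<Sum>i\<in>{1..<k}. fst (f i) * snd (f (k - i))) \<and>
     vanishes_from (degree q0) (fst s) \<and> vanishes_from (degree r0) (snd s))"
  have "\<exists>f. \<forall>k. P f k (f k)"
  proof (rule dependent_wf_choice[of less_than])
    show "wf less_than" by (rule wf_less_than)
    show "P f k s = P g k s" if "\<And>i. (i, k) \<in> less_than \<Longrightarrow> f i = g i" for f g k s
    proof -
      have "(\<Sum>i\<in>{1..<k}. fst (f i) * snd (f (k - i))) = (\<Sum>i\<in>{1..<k}. fst (g i) * snd (g (k - i)))"
        using that by (intro sum.cong) auto
      then show ?thesis by (simp add: P_def)
    qed
    show "\<exists>s. P f k s" if prev: "\<And>i. (i, k) \<in> less_than \<Longrightarrow> P f i (f i)" for f k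
    proof (cases "k = 0")
      case False
      have sm: "vanishes_from (degree q0 + degree r0) (fst (f i) * snd (f (k - i)))" if "i \<in> {1..<k}" for i
      proof -
        have f: "vanishes_from (degree q0) (fst (f i))" "vanishes_from (degree r0) (snd (f (k - i)))"
          using prev[of i] prev[of "k - i"] that by (auto simp: P_def split: if_splits)
        show ?thesis
        proof (cases "fst (f i) = 0")
          case nz: False
          have "degree (fst (f i)) < degree q0"
            using f(1) nz by (force simp: vanishes_from_def not_less[symmetric])
          then show ?thesis using vanishes_from_mult[OF f(2), of "fst (f i)"] by (auto simp: vanishes_from_def)
        qed (simp add: vanishes_from_def)
      qed
      have "vanishes_from (degree q0 + degree r0) (pk k - (\<Sum>i\<in>{1..<k}. fst (f i) * snd (f (k - i))))"
        using pks[of k] False sm by (auto simp: vanishes_from_def coeff_sum intro!: sum.neutral)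
      from bezout_small[OF cop q0 r0 this] show ?thesis using False by (auto simp: P_def)
    qed (simp add: P_def)
  qed
  then obtain f where f: "\<And>k. P f k (f k)" by blast
  define Q R where "Q = (\<lambda>k. fst (f k))" and "R = (\<lambda>k. snd (f k))"
  have f0: "Q 0 = q0" "R 0 = r0" using f[of 0] by (auto simp: P_def Q_def R_def)
  have fk: "r0 * Q k + q0 * R k = pk k - (\<Sum>i\<in>{1..<k}. Q i * R (k - i))"
    "vanishes_from (degree q0) (Q k)" "vanishes_from (degree r0) (R k)" if "k > 0" for k
    using f[of k] that by (auto simp: P_def Q_def R_def)
  have conv: "(\<Sum>i\<le>k. Q i * R (k - i)) = pk k" for k
  proof (cases "k = 0")
    case True then show ?thesis using p0 by (simp add: f0 pk_def)
  next
    case False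
    then have "{..k} = insert 0 (insert k {1..<k})" by auto
    then show ?thesis using False fk(1)[of k] by (simp add: f0 algebra_simps)
  qed
  have Qz: "coeff (Q k) i = (if i = degree q0 then (if k = 0 then 1 else 0) else 0)" if "i \<ge> degree q0" for k i
    using that fk(2)[of k] q0 by (cases "k = 0") (auto simp: f0 vanishes_from_def coeff_eq_0)
  have Rz: "coeff (R k) i = (if i = degree r0 then (if k = 0 then 1 else 0) else 0)" if "i \<ge> degree r0" for k i
    using that fk(3)[of k] r0 by (cases "k = 0") (auto simp: f0 vanishes_from_def coeff_eq_0)
  define q where "q = (\<Sum>j\<le>degree q0. monom (Abs_fps (\<lambda>k. coeff (Q k) j)) j)"
  define r where "r = (\<Sum>j\<le>degree r0. monom (Abs_fps (\<lambda>k. coeff (R k) j)) j)"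
  have cq: "coeff q j $ k = coeff (Q k) j" and cr: "coeff r j $ k = coeff (R k) j" for j k
    by (auto simp: q_def r_def coeff_sum_monom_fps Qz Rz)
  have dq: "coeff q (degree q0) = 1" "\<And>i. i > degree q0 \<Longrightarrow> coeff q i = 0"
    and dr: "coeff r (degree r0) = 1" "\<And>i. i > degree r0 \<Longrightarrow> coeff r i = 0"
    by (auto simp: fps_eq_iff cq cr Qz Rz)
  have d: "degree q = degree q0" "degree r = degree r0"
    using dq dr by (intro antisym degree_le le_degree; simp)+
  have "p = q * r"
  proof (rule poly_eqI, rule fps_ext)
    fix i k
    have "coeff (q * r) i $ k = (\<Sum>j\<le>i. \<Sum>l\<le>k. coeff (Q l) j * coeff (R (k - l)) (i - j))"
      by (simp add: coeff_mult fps_sum_nth mult_sum_nth cq cr)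
    also have "\<dots> = (\<Sum>l\<le>k. \<Sum>j\<le>i. coeff (Q l) j * coeff (R (k - l)) (i - j))" by (rule sum.swap)
    also have "\<dots> = coeff (\<Sum>l\<le>k. Q l * R (k - l)) i" by (simp add: coeff_sum coeff_mult)
    finally show "coeff p i $ k = coeff (q * r) i $ k" by (simp add: conv cpk)
  qed
  with d dq dr show ?thesis by (intro exI[of _ q] exI[of _ r]) simp
qed

section \<open>Splitting of polynomials after ramification\<close>

definition ramify_poly :: "nat \<Rightarrow> complex fps poly \<Rightarrow> complex fps poly" where
  "ramify_poly N p = map_poly (\<lambda>a. a oo fps_X ^ N) p"

lemma coeff_ramify_poly: "coeff (ramify_poly N p) i = coeff p i oo fps_X ^ N"
  by (simp add: ramify_poly_def coeff_map_poly)

lemma ramify_poly_pCons: "ramify_poly N (pCons a p) = pCons (a oo fps_X ^ N) (ramify_poly N p)"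
  by (rule poly_eqI) (auto simp: coeff_ramify_poly coeff_pCons split: nat.splits)

lemma ramify_poly_0 [simp]: "ramify_poly N 0 = 0"
  by (simp add: ramify_poly_def)

lemma ramify_poly_1 [simp]: "ramify_poly N 1 = 1"
  using ramify_poly_pCons[of N 1 0] by (simp add: one_pCons)

lemma ramify_poly_add: "ramify_poly N (p + q) = ramify_poly N p + ramify_poly N q"
  by (rule poly_eqI) (simp add: coeff_ramify_poly fps_compose_add_distrib)

lemma ramify_poly_mult: "N > 0 \<Longrightarrow> ramify_poly N (p * q) = ramify_poly N p * ramify_poly N q"
  by (rule poly_eqI) (simp add: coeff_ramify_poly coeff_mult fps_compose_sum_distrib fps_compose_mult_distrib)

lemma ramify_poly_pcompose:
  "N > 0 \<Longrightarrow> ramify_poly N (pcompose p q) = pcompose (ramify_poly N p) (ramify_poly N q)"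
  by (induction p) (simp_all add: pcompose_pCons ramify_poly_add ramify_poly_mult ramify_poly_pCons)

lemma ramify_poly_ramify_poly:
  assumes "N > 0" "M > 0" shows "ramify_poly M (ramify_poly N p) = ramify_poly (N * M) p"
proof (rule poly_eqI)
  have "(fps_X ^ N oo fps_X ^ M :: complex fps) = fps_X ^ (N * M)"
    using assms by (simp add: fps_compose_power[symmetric] power_mult mult.commute)
  then show "coeff (ramify_poly M (ramify_poly N p)) i = coeff (ramify_poly (N * M) p) i" for i
    using assms fps_compose_assoc[of "fps_X ^ M" "fps_X ^ N" "coeff p i"] by (simp add: coeff_ramify_poly)
qed

lemma ramify_poly_prod_roots:
  "N > 0 \<Longrightarrow> ramify_poly N (\<Prod>z\<leftarrow>zs. [:- z, 1:]) = (\<Prod>z\<leftarrow>zs. [:- (z oo fps_X ^ N), 1:])"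
  by (induction zs) (simp_all only: list.map prod_list.Nil prod_list.Cons ramify_poly_1 ramify_poly_mult ramify_poly_pCons
    fps_compose_uminus fps_compose_1 ramify_poly_0)

definition splits_ramified :: "complex fps poly \<Rightarrow> bool" where
  "splits_ramified p \<longleftrightarrow> (\<exists>N>0. \<exists>zs. ramify_poly N p = (\<Prod>z\<leftarrow>zs. [:- z, 1:]))"

lemma splits_ramified_mult:
  assumes "splits_ramified p" "splits_ramified q" shows "splits_ramified (p * q)"
proof -
  obtain N zs where N: "N > 0" "ramify_poly N p = (\<Prod>z\<leftarrow>zs. [:- z, 1:])"
    using assms(1) by (auto simp: splits_ramified_def)
  obtain M ws where M: "M > 0" "ramify_poly M q = (\<Prod>z\<leftarrow>ws. [:- z, 1:])"
    using assms(2) by (auto simp: splits_ramified_def)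
  have "ramify_poly (N * M) (p * q) = ramify_poly M (ramify_poly N p) * ramify_poly N (ramify_poly M q)"
    using N(1) M(1) by (simp add: ramify_poly_mult ramify_poly_ramify_poly mult.commute)
  also have "\<dots> = (\<Prod>z\<leftarrow>map (\<lambda>z. z oo fps_X ^ M) zs @ map (\<lambda>z. z oo fps_X ^ N) ws. [:- z, 1:])"
    unfolding N(2) M(2) by (simp add: ramify_poly_prod_roots N(1) M(1) o_def)
  finally show ?thesis using N(1) M(1) unfolding splits_ramified_def by (meson mult_pos_pos)
qed

lemma splits_ramified_ramify: "N > 0 \<Longrightarrow> splits_ramified (ramify_poly N p) \<Longrightarrow> splits_ramified p"
  unfolding splits_ramified_def by (metis ramify_poly_ramify_poly mult_pos_pos)

lemma pcompose_prod_roots: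
  "pcompose (\<Prod>z\<leftarrow>zs. [:- z, 1:]) q = (\<Prod>z\<leftarrow>zs. q - [:z :: 'a::comm_ring_1:])"
proof (induction zs)
  case (Cons z zs)
  have "pcompose [:- z, 1:] q = q - [:z:]"
    by (rule poly_eqI) (simp add: pcompose_pCons coeff_pCons algebra_simps split: nat.splits)
  with Cons show ?case by (simp add: pcompose_mult del: mult_pCons_left)
qed (simp add: pcompose_1)

lemma splits_ramified_shift:
  assumes "splits_ramified (pcompose p [:c, 1:])" shows "splits_ramified p"
proof -
  obtain N zs where N: "N > 0" and e: "ramify_poly N (pcompose p [:c, 1:]) = (\<Prod>z\<leftarrow>zs. [:- z, 1:])"
    using assms by (auto simp: splits_ramified_def)
  let ?c = "c oo fps_X ^ N"
  have "pcompose (ramify_poly N p) [:?c, 1:] = (\<Prod>z\<leftarrow>zs. [:- z, 1:])"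
    using e N by (simp add: ramify_poly_pcompose ramify_poly_pCons)
  then have "pcompose (pcompose (ramify_poly N p) [:?c, 1:]) [:- ?c, 1:] = (\<Prod>z\<leftarrow>zs. [:- ?c, 1:] - [:z:])"
    by (simp add: pcompose_prod_roots)
  also have "pcompose (pcompose (ramify_poly N p) [:?c, 1:]) [:- ?c, 1:] = ramify_poly N p"
    by (simp add: pcompose_assoc[symmetric] pcompose_pCons)
  also have "(\<Prod>z\<leftarrow>zs. [:- ?c, 1:] - [:z:]) = (\<Prod>z\<leftarrow>map (\<lambda>z. z + ?c) zs. [:- z, 1:])"
  proof -
    have "[:- ?c, 1:] - [:z:] = [:- (z + ?c), 1:]" for z by simp
    then show ?thesis by (simp only: list.map_comp o_def)
  qed
  finally show ?thesis using N unfolding splits_ramified_def by blast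
qed

lemma coeff_pcompose_scale: "coeff (pcompose p [:0, s:]) i = s ^ i * coeff (p :: 'a::comm_ring_1 poly) i"
  by (induction p arbitrary: i) (auto simp: pcompose_pCons coeff_pCons split: nat.splits)

lemma ramify_poly_smult:
  "N > 0 \<Longrightarrow> ramify_poly N (smult a p) = smult (a oo fps_X ^ N) (ramify_poly N p)"
  by (rule poly_eqI) (simp add: coeff_ramify_poly fps_compose_mult_distrib)

lemma degree_ramify_poly:
  assumes "lead_coeff p = 1" shows "degree (ramify_poly N p) = degree p"
proof (rule antisym)
  show "degree (ramify_poly N p) \<le> degree p"
    by (rule degree_le) (simp add: coeff_ramify_poly coeff_eq_0)
  show "degree p \<le> degree (ramify_poly N p)"
    by (rule le_degree) (simp add: coeff_ramify_poly assms)
qed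

lemma degree_prod_roots: "degree (\<Prod>z\<leftarrow>zs. [:- z, 1 :: 'a::idom:]) = length zs"
proof (induction zs)
  case (Cons z zs)
  have "(\<Prod>z\<leftarrow>zs. [:- z, 1 :: 'a:]) \<noteq> 0" by (auto simp: prod_list_zero_iff)
  then show ?case using Cons by (simp add: degree_mult_eq del: mult_pCons_left)
qed simp

lemma smult_prod_roots:
  "pcompose (\<Prod>z\<leftarrow>map ((*) s) zs. [:- z, 1:]) [:0, s:] = smult (s ^ length zs) (\<Prod>z\<leftarrow>zs. [:- z, 1 :: 'a::idom:])"
proof (induction zs)
  case (Cons z zs)
  have "pcompose [:- (s * z), 1:] [:0, s:] = smult s [:- z, 1:]" by (simp add: pcompose_pCons)
  then show ?case using Cons
    by (simp add: pcompose_mult mult.commute[of "s ^ length zs" s] del: mult_pCons_left mult_pCons_right smult_pCons)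
qed (simp add: pcompose_1)

text \<open>The roots of \<open>p\<close> are \<open>s\<close> times those of \<open>p1\<close>.
  Since \<open>s\<close> stays nonzero after every ramification, its powers can be cancelled
  coefficient by coefficient.\<close>

lemma splits_ramified_scale:
  assumes s: "\<And>N. N > 0 \<Longrightarrow> (s oo fps_X ^ N) \<noteq> 0" and e: "pcompose p [:0, s:] = smult (s ^ degree p1) p1"
    and d: "lead_coeff p1 = 1" and p1: "splits_ramified p1"
  shows "splits_ramified p"
proof -
  obtain N zs where N: "N > 0" and z: "ramify_poly N p1 = (\<Prod>z\<leftarrow>zs. [:- z, 1:])"
    using p1 by (auto simp: splits_ramified_def)
  let ?s = "s oo fps_X ^ N"
  have len: "length zs = degree p1"
    using degree_prod_roots[of zs] degree_ramify_poly[OF d, of N] z by simp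
  have X0: "(fps_X ^ N :: complex fps) $ 0 = 0" using N by simp
  have "ramify_poly N (pcompose p [:0, s:]) = ramify_poly N (smult (s ^ degree p1) p1)" by (simp add: e)
  then have "pcompose (ramify_poly N p) [:0, ?s:] = smult (?s ^ degree p1) (ramify_poly N p1)"
    using N by (simp add: ramify_poly_pcompose ramify_poly_pCons ramify_poly_smult fps_compose_power[OF X0])
  also have "\<dots> = pcompose (\<Prod>z\<leftarrow>map ((*) ?s) zs. [:- z, 1:]) [:0, ?s:]"
    unfolding smult_prod_roots len z ..
  finally have "ramify_poly N p = (\<Prod>z\<leftarrow>map ((*) ?s) zs. [:- z, 1:])"
    using s[OF N] by (auto simp: poly_eq_iff coeff_pcompose_scale)
  then show ?thesis using N unfolding splits_ramified_def by blast
qed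

lemma coeff_pcompose_shift_top:
  "degree p \<le> d \<Longrightarrow> coeff (pcompose p [:c, 1 :: 'a::comm_ring_1:]) d = coeff p d"
proof (induction d arbitrary: p)
  case 0
  then obtain a where "p = [:a:]" by (metis degree_0_id le_zero_eq)
  then show ?case by (simp add: pcompose_pCons)
next
  case (Suc d)
  obtain a p' where p: "p = pCons a p'" by (cases p)
  then have d: "degree p' \<le> d" using Suc.prems by (auto split: if_splits)
  have "degree (pcompose p' [:c, 1:]) \<le> d"
    using degree_pcompose_le[of p' "[:c, 1:]"] d by simp
  then have "coeff (pcompose p' [:c, 1:]) (Suc d) = 0" by (simp add: coeff_eq_0)
  then show ?case using Suc.IH[OF d] by (simp add: p pcompose_pCons)
qed

lemma coeff_pcompose_shift_second:
  "degree p \<le> Suc d \<Longrightarrow> coeff (pcompose p [:c, 1 :: 'a::comm_ring_1:]) d = coeff p d + of_nat (Suc d) * c * coeff p (Suc d)"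
proof (induction d arbitrary: p)
  case 0
  obtain a p' where p: "p = pCons a p'" by (cases p)
  then have "degree p' \<le> 0" using 0 by (auto split: if_splits)
  then obtain b where "p' = [:b:]" by (metis degree_0_id le_zero_eq)
  then show ?case by (simp add: p pcompose_pCons mult.commute)
next
  case (Suc d)
  obtain a p' where p: "p = pCons a p'" by (cases p)
  then have d: "degree p' \<le> Suc d" using Suc.prems by (auto split: if_splits)
  show ?case using Suc.IH[OF d] coeff_pcompose_shift_top[OF d, of c]
    by (simp add: p pcompose_pCons algebra_simps)
qed

lemma ramify_poly_Suc_0: "ramify_poly (Suc 0) p = p"
  by (rule poly_eqI) (simp add: coeff_ramify_poly)

lemma splits_ramified_linear_power: "splits_ramified (monom 1 d)"
  unfolding splits_ramified_def
proof (intro exI conjI)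
  have "[:0, 1:] ^ d = (\<Prod>z\<leftarrow>replicate d 0. [:- z, 1 :: complex fps:])"
    by (induction d) (simp_all del: mult_pCons_left)
  then show "ramify_poly (Suc 0) (monom 1 d) = (\<Prod>z\<leftarrow>replicate d 0. [:- z, 1:])"
    unfolding ramify_poly_Suc_0 by (simp add: monom_altdef)
qed simp

text \<open>Split off the full power of one root \<open>z\<close>. If nothing else remained,
  \<open>p\<close> would be a power of \<open>Y - z\<close>; the vanishing second coefficient forces
  \<open>z = 0\<close>, and then no lower coefficient could be nonzero.\<close>

lemma exists_coprime_factorization:
  fixes p :: "complex poly"
  assumes lead: "lead_coeff p = 1" and c: "coeff p (degree p - 1) = 0"
    and i: "i < degree p" "coeff p i \<noteq> 0"
  shows "\<exists>q r. p = q * r \<and> coprime q r \<and> lead_coeff q = 1 \<and> lead_coeff r = 1 \<and>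
    degree q < degree p \<and> degree r < degree p"
proof -
  have p0: "p \<noteq> 0" using lead by auto
  have "\<not> constant (poly p)" using i(1) by (simp add: constant_degree)
  then obtain z where z: "poly p z = 0" using fundamental_theorem_of_algebra by blast
  define e where "e = order z p"
  define l where "l = [:- z, 1:]"
  obtain w where w: "p = l ^ e * w" "\<not> l dvd w"
    using order_decomp[OF p0, of z] by (auto simp: e_def l_def)
  have e: "e > 0" using z p0 order_root[of p z] by (auto simp: e_def)
  have "lead_coeff (l ^ e) = lead_coeff l ^ e" by (rule lead_coeff_power)
  then have le: "lead_coeff (l ^ e) = 1" "degree (l ^ e) = e"
    by (simp_all add: l_def degree_power_eq)
  have w0: "w \<noteq> 0" using w p0 by auto
  have lw: "lead_coeff w = 1" using lead le by (simp add: w(1) lead_coeff_mult)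
  have deg: "degree p = e + degree w" using w0 le p0 by (simp add: w(1) degree_mult_eq)
  have "degree w \<noteq> 0"
  proof
    assume dw: "degree w = 0"
    then have "w = 1" using lw by (metis degree_0_id one_pCons)
    then have p: "p = [:- z, 1:] ^ e" "degree p = e" using w deg dw by (auto simp: l_def)
    have "coeff p (e - 1) = of_nat (e choose (e - 1)) * (- z)"
      unfolding p(1) using e by (subst coeff_linear_poly_power) auto
    moreover have "e choose (e - 1) = e" using e by (cases e) simp_all
    ultimately have "z = 0" using c p(2) e by auto
    then have "p = monom 1 e" using p(1) by (simp add: monom_altdef)
    then show False using i p(2) by (simp add: coeff_monom)
  qed
  moreover have "coprime (l ^ e) w"
  proof -
    have "prime_elem l" unfolding l_def
      by (rule prime_elem_linear_field_poly) simp
    from prime_elem_imp_coprime[OF this w(2)] show ?thesis by simp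
  qed
  ultimately show ?thesis using w(1) le lw deg e by (intro exI[of _ "l ^ e"] exI[of _ w]) auto
qed

text \<open>Newton-Puiseux: after killing the second coefficient and rescaling by the steepest slope of the
  Newton polygon, the reduction has two distinct roots, so Hensel's lemma lowers the degree.\<close>

theorem puiseux:
  fixes p :: "complex fps poly"
  assumes "lead_coeff p = 1"
  shows "splits_ramified p"
  using assms
proof (induction "degree p" arbitrary: p rule: less_induct)
  case (less p0)
  define d where "d = degree p0"
  show ?case
  proof (cases "d = 0")
    case True
    then have "p0 = 1" using less.prems by (metis d_def degree_0_id one_pCons)
    then show ?thesis using splits_ramified_linear_power[of 0] by simp
  next
    case False
    \<comment> \<open>Translation by the mean of the roots makes the coefficient at
      \<open>d - 1\<close> vanish.\<close>
    define c where "c = fps_const (- inverse (of_nat d)) * coeff p0 (d - 1)"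
    define p where "p = pcompose p0 [:c, 1:]"
    have cd: "coeff p d = 1" using less.prems by (simp add: p_def d_def coeff_pcompose_shift_top)
    have degp: "degree p = d" by (simp add: p_def d_def degree_pcompose)
    have "coeff p (d - 1) = coeff p0 (d - 1) + of_nat d * c * coeff p0 d"
      using coeff_pcompose_shift_second[of p0 "d - 1" c] False by (simp add: p_def d_def)
    also have "\<dots> = coeff p0 (d - 1) + fps_const (of_nat d * (- inverse (of_nat d))) * coeff p0 (d - 1)"
      using less.prems by (simp add: c_def d_def fps_of_nat[symmetric] mult.assoc[symmetric] del: fps_of_nat)
    also have "\<dots> = 0" using False by simp
    finally have cd1: "coeff p (d - 1) = 0" .
    have "splits_ramified p"
    proof (cases "\<forall>i<d. coeff p i = 0")
      case True
      then have "p = monom 1 d"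
        using cd degp by (intro poly_eqI) (metis coeff_eq_0 coeff_monom linorder_neqE_nat)
      then show ?thesis using splits_ramified_linear_power by simp
    next
      case False
      define S where "S = {i. i < d \<and> coeff p i \<noteq> 0}"
      have S: "finite S" "S \<noteq> {}" using False by (auto simp: S_def)
      \<comment> \<open>Divisible by every \<open>d - i\<close>, so after \<open>x = t ^ M\<close>
        the slopes \<open>e i\<close> are integers.\<close>
      define M where "M = (fact d :: nat)"
      have M: "M > 0" by (simp add: M_def)
      define e where "e = (\<lambda>i. subdegree (coeff p i) * (M div (d - i)))"
      define H where "H = Min (e ` S)"
      have e: "e i * (d - i) = M * subdegree (coeff p i)" if "i < d" for i
      proof -
        have "(d - i) dvd M" unfolding M_def using that by (intro dvd_fact) auto
        then show ?thesis by (simp add: e_def mult.assoc mult.commute)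
      qed
      have "H \<in> e ` S" unfolding H_def using S by (intro Min_in) auto
      then obtain i0 where i0: "i0 \<in> S" "H = e i0" by blast
      have HS: "H * (d - i) \<le> M * subdegree (coeff p i)" if "i \<in> S" for i
      proof -
        have "H \<le> e i" unfolding H_def using S that by (intro Min_le) auto
        then have "H * (d - i) \<le> e i * (d - i)" by (rule mult_le_mono1)
        also have "\<dots> = M * subdegree (coeff p i)" using e[of i] that by (simp add: S_def)
        finally show ?thesis .
      qed
      define q where "q = ramify_poly M p"
      have dv: "fps_X ^ ((d - i) * H) dvd coeff q i" if "i \<le> d" for i
      proof (cases "i \<in> S")
        case True
        show ?thesis unfolding fps_X_power_dvd_iff q_def coeff_ramify_poly
        proof (intro allI impI)
          fix k assume k: "k < (d - i) * H"
          have "coeff p i $ (k div M) = 0"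
            using HS[OF True] k M by (intro nth_less_subdegree_zero) (simp add: div_less_iff_less_mult mult.commute)
          then show "(coeff p i oo fps_X ^ M) $ k = 0" using M by (simp add: compose_X_power_nth)
        qed
      next
        case False
        then have "i = d \<or> coeff q i = 0" using that by (auto simp: S_def q_def coeff_ramify_poly)
        then show ?thesis by auto
      qed
      \<comment> \<open>\<open>p1\<close> is \<open>q\<close> at \<open>t ^ H * Y\<close> divided by
        \<open>t ^ (d * H)\<close>. Minimality of \<open>H\<close> makes its coefficients power
        series, and the index attaining the minimum yields a nonzero coefficient at
        \<open>t = 0\<close>.\<close>
      define p1 where "p1 = (\<Sum>j\<le>d. monom (fps_shift ((d - j) * H) (coeff q j)) j)"
      have cp1: "coeff p1 j = (if j \<le> d then fps_shift ((d - j) * H) (coeff q j) else 0)" for j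
        by (simp add: p1_def coeff_sum_monom_fps)
      have p1d: "coeff p1 d = 1" by (simp add: cp1 q_def coeff_ramify_poly cd)
      have degp1: "degree p1 = d"
        using p1d by (intro antisym degree_le le_degree) (auto simp: cp1)
      have scale: "pcompose q [:0, fps_X ^ H:] = smult ((fps_X ^ H) ^ degree p1) p1"
      proof (rule poly_eqI)
        fix j
        show "coeff (pcompose q [:0, fps_X ^ H:]) j = coeff (smult ((fps_X ^ H) ^ degree p1) p1) j"
        proof (cases "j \<le> d")
          case True
          from dv[OF True] obtain h where h: "coeff q j = fps_X ^ ((d - j) * H) * h" ..
          have shift: "fps_shift k (fps_X ^ k * h) = h" for k
            by (rule fps_ext) (simp add: fps_X_power_mult_nth)
          have s: "(fps_X ^ H) ^ d = (fps_X ^ H) ^ j * fps_X ^ ((d - j) * H :: nat)"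
            using True by (simp add: power_mult[symmetric] power_add[symmetric] algebra_simps)
          show ?thesis
            by (simp only: coeff_pcompose_scale coeff_smult cp1 degp1 True if_True h shift s mult.assoc)
        next
          case False
          then have "coeff q j = 0" using degp by (simp add: q_def coeff_ramify_poly coeff_eq_0)
          then show ?thesis using False by (simp add: coeff_pcompose_scale cp1)
        qed
      qed
      define pb where "pb = map_poly (\<lambda>a. a $ 0) p1"
      have cpb: "coeff pb j = coeff p1 j $ 0" for j by (simp add: pb_def coeff_map_poly)
      have degpb: "degree pb = d"
        using p1d by (intro antisym degree_le le_degree) (auto simp: cpb cp1)
      have "coeff pb (d - 1) = 0" by (simp add: cpb cp1 q_def coeff_ramify_poly cd1[simplified])
      moreover have "coeff pb i0 \<noteq> 0" "i0 < d"
      proof -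
        have i: "i0 < d" "coeff p i0 \<noteq> 0" using i0 by (auto simp: S_def)
        have "coeff pb i0 = (coeff p i0 oo fps_X ^ M) $ ((d - i0) * H)"
          using i by (simp add: cpb cp1 q_def coeff_ramify_poly)
        also have "(d - i0) * H = M * subdegree (coeff p i0)"
          using e[OF i(1)] i0(2) by (simp add: mult.commute)
        also have "(coeff p i0 oo fps_X ^ M) $ \<dots> = coeff p i0 $ subdegree (coeff p i0)"
          using M by (simp add: compose_X_power_nth)
        finally show "coeff pb i0 \<noteq> 0" using i(2) by simp
        show "i0 < d" by (rule i(1))
      qed
      ultimately obtain q0 r0 where qr0: "pb = q0 * r0" "coprime q0 r0" "lead_coeff q0 = 1" "lead_coeff r0 = 1"
        "degree q0 < d" "degree r0 < d"
        using exists_coprime_factorization[of pb i0] by (auto simp: degpb cpb p1d)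
      have "lead_coeff p1 = 1" by (simp add: degp1 p1d)
      from hensel_fps[OF this qr0(1)[unfolded pb_def] qr0(2-4)] obtain q1 r1 where
        qr1: "p1 = q1 * r1" "lead_coeff q1 = 1" "degree q1 = degree q0" "lead_coeff r1 = 1" "degree r1 = degree r0"
        by blast
      have "splits_ramified q1" "splits_ramified r1"
        using less.hyps[of q1] less.hyps[of r1] qr1 qr0 by (auto simp: d_def)
      then have sp1: "splits_ramified p1" unfolding qr1(1) by (rule splits_ramified_mult)
      have "splits_ramified q"
      proof (rule splits_ramified_scale[OF _ scale _ sp1])
        show "(fps_X ^ H oo fps_X ^ N :: complex fps) \<noteq> 0" if "N > 0" for N
          using that by (simp add: fps_compose_power[symmetric])
      qed (simp add: degp1 p1d)
      then show ?thesis unfolding q_def by (rule splits_ramified_ramify[OF M])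
    qed
    then show ?thesis unfolding p_def by (rule splits_ramified_shift)
  qed
qed

section \<open>Intersection multiplicity and Milnor number of a branch\<close>

lemma prod_roots_dvd:
  fixes p :: "'a::idom poly"
  assumes "distinct zs" "\<forall>z\<in>set zs. poly p z = 0"
  shows "(\<Prod>z\<leftarrow>zs. [:- z, 1:]) dvd p"
  using assms
proof (induction zs arbitrary: p)
  case (Cons z zs)
  then obtain q where q: "p = [:- z, 1:] * q" by (auto simp: poly_eq_0_iff_dvd)
  have "\<forall>w\<in>set zs. poly q w = 0"
  proof
    fix w assume w: "w \<in> set zs"
    then have "poly p w = 0" "w \<noteq> z" using Cons.prems by auto
    then show "poly q w = 0" by (simp add: q)
  qed
  then have "(\<Prod>z\<leftarrow>zs. [:- z, 1:]) dvd q" using Cons by auto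
  then show ?case unfolding q by (simp add: mult_dvd_mono del: mult_pCons_left)
qed simp

lemma poly_prod_roots: "poly (\<Prod>z\<leftarrow>zs. [:- z, 1 :: 'a::comm_ring_1:]) w = (\<Prod>z\<leftarrow>zs. w - z)"
  by (induction zs) (simp_all add: algebra_simps)

lemma lead_coeff_prod_roots: "lead_coeff (\<Prod>z\<leftarrow>zs. [:- z, 1 :: 'a::idom:]) = 1"
  by (induction zs) (simp_all add: lead_coeff_mult del: mult_pCons_left)

lemma prod_roots_eq:
  fixes p :: "'a::idom poly"
  assumes zs: "distinct zs" "\<forall>z\<in>set zs. poly p z = 0" and p: "lead_coeff p = 1" "degree p = length zs"
  shows "p = (\<Prod>z\<leftarrow>zs. [:- z, 1:])"
proof -
  obtain q where q: "p = (\<Prod>z\<leftarrow>zs. [:- z, 1:]) * q" using prod_roots_dvd[OF zs] ..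
  have "p \<noteq> 0" using p by auto
  then have "degree q = 0" using p(2) by (auto simp: q degree_mult_eq degree_prod_roots)
  moreover have "lead_coeff q = 1" using p(1) by (simp only: q lead_coeff_mult lead_coeff_prod_roots mult_1)
  ultimately have "q = 1" by (metis degree_0_id one_pCons)
  then show ?thesis using q by simp
qed

lemma ramify_fps_of_poly: "ramify N (fps_of_poly p) = fps_of_poly (ramify_poly N p)"
  by (rule fps_ext) (simp add: ramify_def coeff_ramify_poly)

lemma fps_of_poly_prod_roots:
  "fps_of_poly (\<Prod>z\<leftarrow>zs. [:- z, 1:]) = (\<Prod>z\<leftarrow>zs. var_y - fps_const z)"
proof (induction zs)
  case (Cons z zs)
  have "fps_of_poly [:- z, 1:] = var_y - fps_const z"
    by (simp add: fps_of_poly_pCons)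
  with Cons show ?case by (simp add: fps_of_poly_mult del: mult_pCons_left)
qed simp

lemma ideal2_commute: "ideal2 P G = ideal2 G P"
  unfolding ideal2_def by (metis add.commute)

lemma ideal2_cst_mult:
  assumes "c \<noteq> 0" shows "ideal2 (cst c * P) G = ideal2 P G"
proof (intro equalityI subsetI)
  fix H assume "H \<in> ideal2 (cst c * P) G"
  then obtain a b where "H = a * (cst c * P) + b * G" by (auto simp: ideal2_def)
  then show "H \<in> ideal2 P G" by (intro ideal2_I[of _ "a * cst c" _ b]) (simp add: mult.assoc)
next
  fix H assume "H \<in> ideal2 P G"
  then obtain a b where "H = a * P + b * G" by (auto simp: ideal2_def)
  moreover have "cst (inverse c) * (cst c * P) = P" using assms by (simp add: mult.assoc[symmetric])
  ultimately show "H \<in> ideal2 (cst c * P) G"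
    by (intro ideal2_I[of _ "a * cst (inverse c)" _ b]) (simp only: mult.assoc)
qed

lemma subdegree_fps_deriv':
  fixes f :: "'a::{comm_ring_1, idom, ring_char_0} fps"
  assumes "f \<noteq> 0" "f $ 0 = 0"
  shows "fps_deriv f \<noteq> 0" "Suc (subdegree (fps_deriv f)) = subdegree f"
proof -
  have s: "subdegree f > 0" using assms by (metis nth_subdegree_nonzero gr0I)
  have nz: "fps_deriv f $ (subdegree f - 1) \<noteq> 0" using s assms(1) by (simp del: of_nat_Suc)
  then show "fps_deriv f \<noteq> 0" by (metis fps_zero_nth)
  have "subdegree (fps_deriv f) = subdegree f - 1"
    by (rule subdegreeI) (use nz in \<open>auto simp: nth_less_subdegree_zero\<close>)
  then show "Suc (subdegree (fps_deriv f)) = subdegree f" using s by simp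
qed

section \<open>Roots of unity and the conjugates of a parametrized branch\<close>

definition root_of_unity :: "nat \<Rightarrow> complex" where
  "root_of_unity n = exp (2 * of_real pi * \<i> / of_nat n)"

lemma root_of_unity_power_eq_1_iff: "n > 0 \<Longrightarrow> root_of_unity n ^ k = 1 \<longleftrightarrow> n dvd k"
  using complex_root_unity_eq_1[of n k]
  by (simp add: root_of_unity_def exp_of_nat_mult[symmetric] mult_ac)

lemma root_of_unity_nonzero [simp]: "root_of_unity n \<noteq> 0"
  by (simp add: root_of_unity_def)

text \<open>The substitution of \<open>\<zeta> ^ i * t\<close> for \<open>t\<close>, that is, the
  Galois action over the series in \<open>t ^ n\<close>.\<close>

definition rotate_fps :: "nat \<Rightarrow> nat \<Rightarrow> complex fps \<Rightarrow> complex fps" where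
  "rotate_fps n i f = f oo (fps_const (root_of_unity n ^ i) * fps_X)"

lemma rotate_fps_nth: "rotate_fps n i f $ k = root_of_unity n ^ (i * k) * f $ k"
  by (simp add: rotate_fps_def fps_compose_linear power_mult)

lemma rotate_fps_0 [simp]: "rotate_fps n 0 f = f"
  by (rule fps_ext) (simp add: rotate_fps_nth)

lemma rotate_fps_eq_0_iff [simp]: "rotate_fps n i f = 0 \<longleftrightarrow> f = 0"
  by (simp add: fps_eq_iff rotate_fps_nth)

lemma subdegree_rotate_fps [simp]: "subdegree (rotate_fps n i f) = subdegree f"
proof (cases "f = 0")
  case False
  then show ?thesis by (intro subdegreeI) (auto simp: rotate_fps_nth)
next
  case True
  then show ?thesis by (simp add: rotate_fps_def)
qed

lemma rotate_fps_mult: "rotate_fps n i (f * g) = rotate_fps n i f * rotate_fps n i g"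
  unfolding rotate_fps_def by (rule fps_compose_mult_distrib) simp

lemma rotate_fps_X_power: "n > 0 \<Longrightarrow> rotate_fps n i (fps_X ^ n) = fps_X ^ n"
  using root_of_unity_power_eq_1_iff[of n "i * n"]
  by (intro fps_ext) (simp add: rotate_fps_nth fps_X_power_iff)

lemma rotate_subst:
  assumes "n > 0" "fps_X dvd b"
  shows "rotate_fps n i (subst_curve G (fps_X ^ n) b) = subst_curve G (fps_X ^ n) (rotate_fps n i b)"
proof -
  have "fps_X dvd (fps_X ^ n :: complex fps)" using assms by (simp add: dvd_power)
  then show ?thesis
    using subst_compose[of "fps_X ^ n" b "fps_const (root_of_unity n ^ i) * fps_X" G] assms
      rotate_fps_X_power[of n i] by (simp add: rotate_fps_def)
qed

locale branch =
  fixes F :: "complex fps poly" and n m :: nat and y :: "complex fps"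
  assumes weier: "weierstrass_poly F" and degF: "degree F = n"
    and n: "n > 0" and m: "m > 0"
    and puis: "primitive_puiseux (fps_of_poly F) n m y"
begin

abbreviation FF :: "complex fps fps" where "FF \<equiv> fps_of_poly F"

definition pull :: "complex fps fps \<Rightarrow> complex fps" where "pull G = subst_curve G (fps_X ^ n) y"

definition conjugate :: "nat \<Rightarrow> complex fps" where "conjugate i = rotate_fps n i y"

lemma Xn: "fps_X dvd (fps_X ^ n :: complex fps)" using n by (simp add: dvd_power)

lemma y_nth: "k < m \<Longrightarrow> y $ k = 0" "y $ m \<noteq> 0"
  using puis by (auto simp: primitive_puiseux_def)

lemma Xy: "fps_X dvd y" using y_nth m by (simp add: fps_X_dvd_iff)

lemma F_pull: "pull FF = 0"
  using puis by (simp add: primitive_puiseux_def pull_def)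

lemma leadF: "lead_coeff F = 1" using weier by (simp add: weierstrass_poly_def)

lemma convF: "FF \<in> conv_series"
  using weier by (simp add: weierstrass_poly_def conv_fps_of_poly)

lemma conjugate_0 [simp]: "conjugate 0 = y" by (simp add: conjugate_def)

lemma X_conjugate: "fps_X dvd conjugate i"
  using Xy by (simp add: fps_X_dvd_iff conjugate_def rotate_fps_nth)

lemma subst_conjugate: "subst_curve G (fps_X ^ n) (conjugate i) = rotate_fps n i (pull G)"
  using rotate_subst[OF n Xy, of i G] by (simp add: pull_def conjugate_def)

text \<open>Primitivity enters here: equal conjugates give \<open>n dvd (i - j) * k\<close> for
  every exponent \<open>k\<close> of \<open>y\<close>, and the gcd of these exponents with
  \<open>n\<close> is \<open>1\<close>. Subtraction truncates, so the two divisibilities together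
  express congruence modulo \<open>n\<close>.\<close>

lemma conjugate_eq_iff: "conjugate i = conjugate j \<longleftrightarrow> n dvd (i - j) \<and> n dvd (j - i)"
proof -
  have one: "n dvd (i - j)" if ij: "conjugate i = conjugate j" "j \<le> i" for i j
  proof -
    let ?\<zeta> = "root_of_unity n"
    have d: "n dvd (i - j) * k" if k: "y $ k \<noteq> 0" for k
    proof -
      have "?\<zeta> ^ (i * k) * y $ k = ?\<zeta> ^ (j * k) * y $ k"
        using arg_cong[OF ij(1), of "\<lambda>f. f $ k"] by (simp add: conjugate_def rotate_fps_nth)
      then have "?\<zeta> ^ (i * k) = ?\<zeta> ^ (j * k)" using k by simp
      moreover have "i * k = (i - j) * k + j * k" using ij(2) by (simp add: diff_mult_distrib)
      ultimately have "?\<zeta> ^ ((i - j) * k) = 1" by (simp add: power_add)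
      then show ?thesis using root_of_unity_power_eq_1_iff[OF n] by simp
    qed
    have "n dvd Gcd ((*) (i - j) ` insert n {k. y $ k \<noteq> 0})" by (rule Gcd_greatest) (use d in auto)
    also have "\<dots> = (i - j) * Gcd (insert n {k. y $ k \<noteq> 0})" by (subst Gcd_mult) simp
    also have "Gcd (insert n {k. y $ k \<noteq> 0}) = 1" using puis by (simp add: primitive_puiseux_def)
    finally show ?thesis by simp
  qed
  have two: "conjugate i = conjugate j" if ij: "n dvd (i - j)" "j \<le> i" for i j
  proof -
    have "root_of_unity n ^ (i * k) = root_of_unity n ^ (j * k)" for k
    proof -
      have "i * k = (i - j) * k + j * k" using ij(2) by (simp add: diff_mult_distrib)
      moreover have "root_of_unity n ^ ((i - j) * k) = 1"
        using ij(1) root_of_unity_power_eq_1_iff[OF n] by simp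
      ultimately show ?thesis by (simp add: power_add)
    qed
    then show ?thesis by (intro fps_ext) (simp add: conjugate_def rotate_fps_nth)
  qed
  show ?thesis
  proof (cases "j \<le> i")
    case True then show ?thesis using one[of i j] two[of i j] by auto
  next
    case False then show ?thesis using one[of j i] two[of j i] by auto
  qed
qed

lemma distinct_conjugates: "distinct (map conjugate [0..<n])"
proof -
  have "inj_on conjugate {0..<n}"
  proof (rule inj_onI)
    fix i j assume ij: "i \<in> {0..<n}" "j \<in> {0..<n}" "conjugate i = conjugate j"
    then have "n dvd i - j" "n dvd j - i" by (auto simp: conjugate_eq_iff)
    moreover have "i - j < n" "j - i < n" using ij by auto
    ultimately have "i - j = 0" "j - i = 0" by (auto dest: dvd_imp_le)
    then show "i = j" by simp
  qed
  then show ?thesis by (simp add: distinct_map)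
qed

lemma pull_fps_of_poly: "subst_curve (fps_of_poly p) (fps_X ^ N) b = poly (ramify_poly N p) b"
  if "fps_X dvd b" "N > 0" for b
  unfolding ramify_poly_def using that by (intro subst_fps_of_poly) (simp_all add: dvd_power)

lemma ramify_F: "ramify_poly n F = (\<Prod>z\<leftarrow>map conjugate [0..<n]. [:- z, 1:])"
proof (rule prod_roots_eq[OF distinct_conjugates])
  show "\<forall>z\<in>set (map conjugate [0..<n]). poly (ramify_poly n F) z = 0"
  proof clarsimp
    fix i
    have "rotate_fps n i (pull FF) = 0" by (simp add: F_pull)
    then show "poly (ramify_poly n F) (conjugate i) = 0"
      using subst_conjugate[of FF i] pull_fps_of_poly[OF X_conjugate n, of F i] by simp
  qed
  show "lead_coeff (ramify_poly n F) = 1" "degree (ramify_poly n F) = length (map conjugate [0..<n])"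
    using degree_ramify_poly[OF leadF, of n] leadF by (simp_all add: coeff_ramify_poly degF)
qed

text \<open>The conjugates of \<open>pull G\<close> all have the same order, so the sum over the
  roots is \<open>n\<close> times this order and the ramification factor \<open>n\<close>
  cancels.\<close>

lemma has_codim_branch:
  assumes G: "pull G \<noteq> 0"
  shows "has_codim scl UNIV (ideal2 FF G) (subdegree (pull G))"
proof -
  have "\<exists>d. has_codim scl UNIV (ideal2 FF G) d \<and>
    (\<Sum>z\<leftarrow>map conjugate [0..<n]. subdegree (subst_curve G (fps_X ^ n) z)) = n * d"
  proof (rule has_codim_puiseux[OF n])
    show "ramify n FF = (\<Prod>z\<leftarrow>map conjugate [0..<n]. var_y - fps_const z)"
      by (simp only: ramify_fps_of_poly ramify_F fps_of_poly_prod_roots)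
  qed (use G in \<open>auto simp: X_conjugate subst_conjugate\<close>)
  then obtain d where d: "has_codim scl UNIV (ideal2 FF G) d" and
    s: "(\<Sum>z\<leftarrow>map conjugate [0..<n]. subdegree (subst_curve G (fps_X ^ n) z)) = n * d" by blast
  have "n * d = n * subdegree (pull G)"
    unfolding s[symmetric] by (simp add: o_def subst_conjugate sum_list_triv)
  then show ?thesis using d n by simp
qed

theorem intersection_mult_eq:
  assumes "G \<in> conv_series"
  shows "intersection_mult FF G = fps_ord (pull G)"
proof (cases "pull G = 0")
  case True
  then show ?thesis using quotient_dim_infinite[OF n Xy] F_pull
    by (simp add: intersection_mult_def fps_ord_def pull_def)
next
  case False
  then show ?thesis using quotient_dim_formal[OF convF assms has_codim_branch]
    by (simp add: intersection_mult_def fps_ord_def)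
qed

text \<open>The ramified \<open>F\<close> without its root \<open>y\<close>. Its value at
  \<open>y\<close> is the \<open>y\<close>-derivative of \<open>F\<close> on the curve.\<close>

definition cofactor :: "complex fps poly" where
  "cofactor = (\<Prod>z\<leftarrow>map conjugate [1..<n]. [:- z, 1:])"

lemma ramify_F_cofactor: "ramify_poly n F = [:- y, 1:] * cofactor"
proof -
  have "[0..<n] = 0 # [1..<n]" using n by (simp add: upt_conv_Cons)
  then show ?thesis by (simp add: ramify_F cofactor_def del: mult_pCons_left)
qed

lemma poly_cofactor_nonzero: "poly cofactor y \<noteq> 0"
proof -
  have "poly cofactor y = (\<Prod>z\<leftarrow>map conjugate [1..<n]. y - z)"
    unfolding cofactor_def by (rule poly_prod_roots)
  moreover have "y \<noteq> conjugate i" if "i \<in> {1..<n}" for i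
    using that distinct_conjugates n conjugate_eq_iff[of 0 i] by (auto dest: dvd_imp_le)
  ultimately show ?thesis by (auto simp: prod_list_zero_iff)
qed

lemma partial_y_F: "partial_y FF = fps_of_poly (pderiv F)"
  by (simp add: partial_y_def fps_of_poly_pderiv)

lemma ramify_poly_pderiv: "ramify_poly N (pderiv p) = pderiv (ramify_poly N p)"
proof (rule poly_eqI)
  fix i
  have "(of_nat (Suc i) * coeff p (Suc i)) oo fps_X ^ N = of_nat (Suc i) * (coeff p (Suc i) oo fps_X ^ N)"
    by (simp only: fps_of_nat[symmetric] fps_const_mult_apply_left fps_compose_mult_distrib fps_const_compose)
  then show "coeff (ramify_poly N (pderiv p)) i = coeff (pderiv (ramify_poly N p)) i"
    by (simp only: coeff_ramify_poly coeff_pderiv)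
qed

lemma pull_partial_y_F: "pull (partial_y FF) = poly cofactor y"
  using pull_fps_of_poly[OF Xy n, of "pderiv F"]
  by (simp add: pull_def partial_y_F ramify_poly_pderiv ramify_F_cofactor pderiv_mult pderiv_pCons del: mult_pCons_left)

text \<open>The lengths of \<open>(F_y, F)\<close> and \<open>(F_y, F_x)\<close> are evaluated along
  the same list of Puiseux roots of \<open>F_y\<close>. Along each root the orders differ by
  \<open>N\<close>, and there are \<open>n - 1\<close> roots; the first length is also known from
  the curve.\<close>

theorem milnor_number_eq:
  "\<exists>\<mu>. milnor_number FF = enat \<mu> \<and> subdegree (pull (partial_y FF)) = \<mu> + (n - 1)"
proof -
  let ?Fx = "partial_x FF" and ?Fy = "partial_y FF"
  \<comment> \<open>The derivative scaled to be monic, as \<open>puiseux\<close> requires.\<close>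
  define p where "p = smult (fps_const (inverse (of_nat n))) (pderiv F)"
  have n0: "inverse (of_nat n) \<noteq> (0 :: complex)" using n by simp
  have Fyp: "fps_of_poly p = cst (inverse (of_nat n)) * ?Fy"
    by (simp add: p_def partial_y_F fps_of_poly_smult)
  have cp: "coeff p j = fps_const (inverse (of_nat n) * of_nat (Suc j)) * coeff F (Suc j)" for j
    by (simp add: p_def coeff_pderiv fps_of_nat[symmetric] mult.assoc[symmetric] del: of_nat_Suc fps_of_nat)
  have lp: "coeff p (n - 1) = 1" using n leadF by (simp add: cp degF del: of_nat_Suc)
  have degp: "degree p = n - 1"
    using lp by (intro antisym degree_le le_degree) (auto simp: cp degF coeff_eq_0)
  obtain N zs where N: "N > 0" and zs: "ramify_poly N p = (\<Prod>z\<leftarrow>zs. [:- z, 1:])"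
    using puiseux[of p] lp degp unfolding splits_ramified_def by auto
  have len: "length zs = n - 1"
    using degree_prod_roots[of zs] degree_ramify_poly[of p N] lp degp zs by simp
  have root: "poly (ramify_poly N p) z = 0" if "z \<in> set zs" for z
    unfolding zs using that by (induction zs) (auto simp del: mult_pCons_left)
  \<comment> \<open>\<open>F\<close> is a Weierstrass polynomial, so at \<open>x = 0\<close> the
    polynomial \<open>p\<close> is a power of \<open>Y\<close> and its roots have no constant
    term.\<close>
  have z0: "fps_X dvd z" if z: "z \<in> set zs" for z
  proof -
    have "n - 1 > 0" using z len by (cases zs) auto
    have "0 = poly (ramify_poly N p) z $ 0" using root[OF z] by simp
    also have "\<dots> = (\<Sum>i\<le>n - 1. (coeff p i oo fps_X ^ N) $ 0 * (z $ 0) ^ i)"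
      using degree_ramify_poly[of p N] lp degp
      by (simp add: poly_altdef fps_sum_nth coeff_ramify_poly fps_power_zeroth)
    also have "\<dots> = (\<Sum>i\<in>{n - 1}. (z $ 0) ^ i)"
    proof (rule sum.mono_neutral_cong_right)
      show "\<forall>i\<in>{..n - 1} - {n - 1}. (coeff p i oo fps_X ^ N) $ 0 * (z $ 0) ^ i = 0"
      proof
        fix i assume "i \<in> {..n - 1} - {n - 1}"
        then have "coeff F (Suc i) $ 0 = 0" using weier degF by (auto simp: weierstrass_poly_def)
        then show "(coeff p i oo fps_X ^ N) $ 0 * (z $ 0) ^ i = 0" by (simp add: cp del: of_nat_Suc)
      qed
    qed (use lp in auto)
    finally have "z $ 0 = 0" using \<open>n - 1 > 0\<close> by simp
    then show ?thesis by (simp add: fps_X_dvd_iff)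
  qed
  have XN: "fps_X dvd (fps_X ^ N :: complex fps)" using N by (simp add: dvd_power)
  have Fyz: "subst_curve ?Fy (fps_X ^ N) z = 0" if z: "z \<in> set zs" for z
  proof -
    have "subst_curve (fps_of_poly p) (fps_X ^ N) z = 0"
      using root[OF z] pull_fps_of_poly[OF z0[OF z] N, of p] by simp
    then show ?thesis using n0 by (simp add: Fyp subst_cst_mult)
  qed
  have convFy: "?Fy \<in> conv_series" and convFx: "?Fx \<in> conv_series" using convF by auto
  have pFy: "pull ?Fy \<noteq> 0" using pull_partial_y_F poly_cofactor_nonzero by simp
  note D = has_codim_branch[OF pFy]
  \<comment> \<open>A common root would make the length of \<open>(F, F_y)\<close> infinite, against
    the finite length obtained from the curve in \<open>D\<close>.\<close>
  have Fz: "subst_curve FF (fps_X ^ N) z \<noteq> 0" if z: "z \<in> set zs" for z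
  proof
    assume "subst_curve FF (fps_X ^ N) z = 0"
    from quotient_dim_infinite[OF N z0[OF z] this Fyz[OF z]] quotient_dim_formal[OF convF convFy D]
    show False by simp
  qed
  have rp: "ramify N (fps_of_poly p) = (\<Prod>z\<leftarrow>zs. var_y - fps_const z)"
    by (simp only: ramify_fps_of_poly zs fps_of_poly_prod_roots)
  have FFx: "subst_curve ?Fx (fps_X ^ N) z \<noteq> 0 \<and>
    subdegree (subst_curve FF (fps_X ^ N) z) = subdegree (subst_curve ?Fx (fps_X ^ N) z) + N" if z: "z \<in> set zs" for z
  proof -
    let ?f = "subst_curve FF (fps_X ^ N) z" and ?g = "subst_curve ?Fx (fps_X ^ N) z"
    have d: "fps_deriv ?f = ?g * (of_nat N * fps_X ^ (N - 1))"
      using subst_chain_rule[OF XN z0[OF z], of FF] Fyz[OF z] by (simp add: fps_deriv_power fps_of_nat)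
    have "FF $ 0 $ 0 = 0" using weier degF n by (auto simp: weierstrass_poly_def)
    then have "?f $ 0 = 0" by (simp add: subst_curve_def)
    note sd = subdegree_fps_deriv'[OF Fz[OF z] this]
    have "?g \<noteq> 0" using sd(1) d by auto
    moreover have "(of_nat N :: complex fps) = fps_const (of_nat N)" by (simp add: fps_of_nat)
    ultimately have "subdegree (fps_deriv ?f) = subdegree ?g + (N - 1)"
      unfolding d using N by (simp add: subdegree_mult' subdegree_mult)
    then show ?thesis using sd(2) N \<open>?g \<noteq> 0\<close> by simp
  qed
  obtain D' where D': "has_codim scl UNIV (ideal2 (fps_of_poly p) FF) D'"
    and sD: "(\<Sum>z\<leftarrow>zs. subdegree (subst_curve FF (fps_X ^ N) z)) = N * D'"
    using has_codim_puiseux[OF N rp, of FF] z0 Fz by auto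
  have "ideal2 (fps_of_poly p) FF = ideal2 FF ?Fy"
    unfolding Fyp ideal2_cst_mult[OF n0] by (rule ideal2_commute)
  then have DD: "D' = subdegree (pull ?Fy)"
    using E.has_codim_unique[OF subspace_ideal2 D] D' by metis
  obtain \<mu> where mu: "has_codim scl UNIV (ideal2 (fps_of_poly p) ?Fx) \<mu>"
    and smu: "(\<Sum>z\<leftarrow>zs. subdegree (subst_curve ?Fx (fps_X ^ N) z)) = N * \<mu>"
    using has_codim_puiseux[OF N rp, of ?Fx] z0 FFx by auto
  have "ideal2 (fps_of_poly p) ?Fx = ideal2 ?Fx ?Fy"
    unfolding Fyp ideal2_cst_mult[OF n0] by (rule ideal2_commute)
  then have "milnor_number FF = enat \<mu>"
    using quotient_dim_formal[OF convFx convFy, of \<mu>] mu by (simp add: milnor_number_def)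
  moreover have "N * D' = N * \<mu> + N * (n - 1)"
  proof -
    have "N * D' = (\<Sum>z\<leftarrow>zs. subdegree (subst_curve ?Fx (fps_X ^ N) z) + N)"
      unfolding sD[symmetric] using FFx by (intro arg_cong[of _ _ sum_list] map_cong) auto
    also have "\<dots> = N * \<mu> + N * (n - 1)"
      by (simp add: sum_list_addf smu sum_list_triv len)
    finally show ?thesis .
  qed
  then have "N * D' = N * (\<mu> + (n - 1))" by (simp add: distrib_left)
  ultimately show ?thesis using N DD by auto
qed

end

section \<open>Values of differential forms\<close>

lemma subdegree_congruent:
  fixes f g :: "'a::comm_ring_1 fps"
  assumes "fps_X ^ Suc (subdegree f) dvd f - g" "f \<noteq> 0"
  shows "g \<noteq> 0" "subdegree g = subdegree f"
proof -
  have eq: "g $ i = f $ i" if "i \<le> subdegree f" for i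
    using assms(1) that unfolding fps_X_power_dvd_iff by (simp add: less_Suc_eq_le)
  then have "g $ subdegree f \<noteq> 0" using assms(2) by simp
  then show "g \<noteq> 0" by (metis fps_zero_nth)
  show "subdegree g = subdegree f"
    using \<open>g $ subdegree f \<noteq> 0\<close> by (intro subdegreeI) (simp_all add: eq nth_less_subdegree_zero)
qed

context branch begin

lemma pull_add: "pull (G + H) = pull G + pull H" by (simp add: pull_def subst_add)
lemma pull_diff: "pull (G - H) = pull G - pull H" by (simp add: pull_def subst_diff)
lemma pull_mult: "pull (G * H) = pull G * pull H" by (simp add: pull_def subst_mult[OF Xn Xy])
lemma pull_cst: "pull (cst c) = fps_const c" by (simp add: pull_def)

lemma pull_deriv:
  "fps_deriv (pull h) = pull (partial_x h) * fps_deriv (fps_X ^ n) + pull (partial_y h) * fps_deriv y"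
  by (simp add: pull_def subst_chain_rule[OF Xn Xy])

lemma X_power_m_dvd: "fps_X ^ m dvd y" using y_nth by (simp add: fps_X_power_dvd_iff)

lemma pull_weight:
  assumes "\<And>i j. G $ j $ i \<noteq> 0 \<Longrightarrow> k \<le> n * i + m * j"
  shows "fps_X ^ k dvd pull G"
  unfolding fps_X_power_dvd_iff
proof (intro allI impI)
  fix N assume "N < k"
  then have "G $ j $ i * ((fps_X ^ n) ^ i * y ^ j) $ N = 0" for i j
    using assms[where i = i and j = j] monomial_nth_eq_0[OF dvd_refl X_power_m_dvd, of N n i j] by (cases "G $ j $ i = 0") auto
  then show "pull G $ N = 0" unfolding pull_def subst_curve_def by (simp add: sum.neutral)
qed

lemma pull_ord_ge: "G \<in> ord_ge k \<Longrightarrow> fps_X ^ k dvd pull G"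
proof (rule pull_weight)
  fix i j assume "G \<in> ord_ge k" "G $ j $ i \<noteq> 0"
  then have "k \<le> i + j" by (auto simp: ord_ge_def not_less[symmetric])
  also have "\<dots> \<le> n * i + m * j" using n m by (intro add_mono) auto
  finally show "k \<le> n * i + m * j" .
qed

section \<open>Pullbacks of forms and weights\<close>

abbreviation pb :: "form \<Rightarrow> complex fps" where "pb \<equiv> form_pullback (fps_X ^ n) y"

lemma pb_pair: "pb (A, B) = pull A * fps_deriv (fps_X ^ n) + pull B * fps_deriv y"
  by (simp add: form_pullback_def pull_def)

text \<open>\<open>dx\<close> counts with weight \<open>n\<close> and \<open>dy\<close> with weight
  \<open>m\<close>, hence the two successors.\<close>

definition weight_ge :: "nat \<Rightarrow> form \<Rightarrow> bool" where
  "weight_ge k \<omega> \<longleftrightarrow> (\<forall>i j. (fst \<omega> $ j $ i \<noteq> 0 \<longrightarrow> k \<le> n * Suc i + m * j) \<and>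
     (snd \<omega> $ j $ i \<noteq> 0 \<longrightarrow> k \<le> n * i + m * Suc j))"

text \<open>The Euler operator \<open>t d/dt\<close> is diagonal on powers of \<open>t\<close>.
  Multiplying pullbacks by \<open>t\<close> also removes the shift between the order of a pullback
  and the value of the form.\<close>

lemma X_mult_deriv: "fps_X * fps_deriv f = Abs_fps (\<lambda>k. of_nat k * f $ k)" for f :: "complex fps"
  by (rule fps_ext) (auto simp: fps_X_mult_nth)

lemma X_deriv_Xn: "fps_X * fps_deriv (fps_X ^ n) = fps_const (of_nat n) * (fps_X ^ n :: complex fps)"
  by (rule fps_ext) (simp add: X_mult_deriv fps_X_power_iff)

lemma X_deriv_y: "fps_X ^ m dvd fps_X * fps_deriv y"
  using y_nth by (simp add: X_mult_deriv fps_X_power_dvd_iff)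

lemma X_pb: "fps_X * pb (A, B) =
    pull A * (fps_const (of_nat n) * fps_X ^ n) + pull B * (fps_X * fps_deriv y)"
  unfolding pb_pair X_deriv_Xn[symmetric] by (simp add: algebra_simps)

text \<open>The truncated subtraction is intended: for \<open>k < p\<close> the hypothesis is empty
  and \<open>fps_X ^ p\<close> alone suffices.\<close>

lemma fps_X_power_dvd_cancel: "fps_X ^ k dvd f * fps_X ^ p" if "fps_X ^ (k - p) dvd (f :: complex fps)"
proof -
  have "fps_X ^ (k - p + p) dvd f * fps_X ^ p" unfolding power_add using that by (intro mult_dvd_mono) auto
  moreover have "fps_X ^ k dvd (fps_X ^ (k - p + p) :: complex fps)" by (intro le_imp_power_dvd) auto
  ultimately show ?thesis by (rule dvd_trans[rotated])
qed

lemma weight_ge_pb: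
  assumes "weight_ge k \<omega>" shows "fps_X ^ k dvd fps_X * pb \<omega>"
proof -
  obtain A B where w: "\<omega> = (A, B)" by (cases \<omega>)
  have A: "fps_X ^ (k - n) dvd pull A"
  proof (rule pull_weight)
    fix i j assume "A $ j $ i \<noteq> 0"
    then have "k \<le> n * Suc i + m * j" using assms by (auto simp: weight_ge_def w)
    then show "k - n \<le> n * i + m * j" by simp
  qed
  have B: "fps_X ^ (k - m) dvd pull B"
  proof (rule pull_weight)
    fix i j assume "B $ j $ i \<noteq> 0"
    then have "k \<le> n * i + m * Suc j" using assms by (auto simp: weight_ge_def w)
    then show "k - m \<le> n * i + m * j" by simp
  qed
  obtain d where d: "fps_X * fps_deriv y = fps_X ^ m * d" using X_deriv_y ..
  have "fps_X * pb \<omega> = fps_const (of_nat n) * (pull A * fps_X ^ n) + d * (pull B * fps_X ^ m)"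
    by (simp add: w X_pb d mult_ac)
  then show ?thesis using fps_X_power_dvd_cancel[OF A] fps_X_power_dvd_cancel[OF B] by simp
qed

text \<open>Cartan's formula for the weighted Euler field \<open>E = n x d/dx + m y d/dy\<close>:
  the Lie derivative multiplies a monomial form by its weight and equals
  \<open>d (i_E \<omega>) + i_E d\<omega>\<close>. So \<open>h\<close> is the contraction with
  \<open>E\<close> and \<open>g\<close> the coefficient of the differential, both divided by the
  weight; contracting \<open>g dx dy\<close> with \<open>E\<close> gives
  \<open>g (n x dy - m y dx)\<close>.\<close>

lemma weighted_decomposition:
  assumes k: "weight_ge k (A, B)"
  shows "\<exists>h g. A = partial_x h - of_nat m * var_y * g \<and> B = partial_y h + of_nat n * var_x * g \<and>
    (\<forall>i j. g $ j $ i \<noteq> 0 \<longrightarrow> k \<le> n * Suc i + m * Suc j)"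
proof -
  define D :: "nat \<Rightarrow> nat \<Rightarrow> complex" where "D = (\<lambda>a b. of_nat n * of_nat a + of_nat m * of_nat b)"
  have D: "D a b \<noteq> 0" if "a > 0 \<or> b > 0" for a b
  proof -
    have "D a b = of_nat (n * a + m * b)" by (simp add: D_def)
    moreover have "n * a + m * b \<noteq> 0" using that n m by auto
    ultimately show ?thesis by (metis of_nat_eq_0_iff)
  qed
  define h where "h = Abs_fps (\<lambda>b. Abs_fps (\<lambda>a. (of_nat n * (if a = 0 then 0 else A $ b $ (a - 1))
      + of_nat m * (if b = 0 then 0 else B $ (b - 1) $ a)) / D a b))"
  define g where "g = Abs_fps (\<lambda>b. Abs_fps (\<lambda>a. (of_nat (Suc a) * B $ b $ Suc a
      - of_nat (Suc b) * A $ Suc b $ a) / D (Suc a) (Suc b)))"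
  have my: "(of_nat m * var_y * G) $ b $ a = (if b = 0 then 0 else of_nat m * G $ (b - 1) $ a)" for G b a
    by (simp add: mult.assoc fps_X_mult_nth fps_of_nat_mult_nth)
  have nx: "(of_nat n * var_x * G) $ b $ a = (if a = 0 then 0 else of_nat n * G $ b $ (a - 1))" for G b a
    by (simp add: mult.assoc fps_X_mult_nth fps_of_nat_mult_nth)
  have hn: "h $ b $ a = (of_nat n * (if a = 0 then 0 else A $ b $ (a - 1))
      + of_nat m * (if b = 0 then 0 else B $ (b - 1) $ a)) / D a b"
    and gn: "g $ b $ a = (of_nat (Suc a) * B $ b $ Suc a - of_nat (Suc b) * A $ Suc b $ a) / D (Suc a) (Suc b)"
    for a b by (simp_all add: h_def g_def)
  have "A = partial_x h - of_nat m * var_y * g"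
  proof (rule fps_ext, rule fps_ext)
    fix b a
    have px: "partial_x h $ b $ a = of_nat (Suc a) * h $ b $ Suc a" for a b
      by (simp add: partial_x_def del: of_nat_Suc)
    show "A $ b $ a = (partial_x h - of_nat m * var_y * g) $ b $ a"
    proof (cases b)
      case 0
      then show ?thesis using D[of "Suc a" 0] n
        by (simp add: px my hn del: of_nat_Suc) (simp add: D_def del: of_nat_Suc)
    next
      case (Suc b')
      have "(partial_x h - of_nat m * var_y * g) $ b $ a =
          (of_nat (Suc a) * (of_nat n * A $ b $ a + of_nat m * B $ b' $ Suc a)
          - of_nat m * (of_nat (Suc a) * B $ b' $ Suc a - of_nat b * A $ b $ a)) / D (Suc a) b"
        by (simp add: px my hn gn Suc diff_divide_distrib[symmetric] times_divide_eq_right del: of_nat_Suc)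
      also have "\<dots> = (D (Suc a) b * A $ b $ a) / D (Suc a) b" by (simp add: D_def algebra_simps del: of_nat_Suc)
      finally show ?thesis using D[of "Suc a" b] by simp
    qed
  qed
  moreover have "B = partial_y h + of_nat n * var_x * g"
  proof (rule fps_ext, rule fps_ext)
    fix b a
    have py: "partial_y h $ b $ a = of_nat (Suc b) * h $ Suc b $ a" for a b
      by (simp add: partial_y_def fps_of_nat_mult_nth del: of_nat_Suc)
    show "B $ b $ a = (partial_y h + of_nat n * var_x * g) $ b $ a"
    proof (cases a)
      case 0
      then show ?thesis using D[of 0 "Suc b"] m
        by (simp add: py nx hn del: of_nat_Suc) (simp add: D_def del: of_nat_Suc)
    next
      case (Suc a')
      have "(partial_y h + of_nat n * var_x * g) $ b $ a =
          (of_nat (Suc b) * (of_nat n * A $ Suc b $ a' + of_nat m * B $ b $ a)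
          + of_nat n * (of_nat a * B $ b $ a - of_nat (Suc b) * A $ Suc b $ a')) / D a (Suc b)"
        by (simp add: py nx hn gn Suc add_divide_distrib[symmetric] times_divide_eq_right del: of_nat_Suc)
      also have "\<dots> = (D a (Suc b) * B $ b $ a) / D a (Suc b)" by (simp add: D_def algebra_simps del: of_nat_Suc)
      finally show ?thesis using D[of a "Suc b"] by simp
    qed
  qed
  moreover have "k \<le> n * Suc i + m * Suc j" if "g $ j $ i \<noteq> 0" for i j
  proof -
    have "B $ j $ Suc i \<noteq> 0 \<or> A $ Suc j $ i \<noteq> 0" using that by (auto simp: g_def)
    then show ?thesis using k unfolding weight_ge_def fst_conv snd_conv by blast
  qed
  ultimately show ?thesis by blast
qed

lemma mult_nth2_nonzero:
  assumes "(g * q) $ j $ i \<noteq> (0 :: complex)"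
  obtains l k where "l \<le> j" "k \<le> i" "g $ l $ k \<noteq> 0" "q $ (j - l) $ (i - k) \<noteq> 0"
proof -
  have "\<exists>l\<le>j. \<exists>k\<le>i. g $ l $ k * q $ (j - l) $ (i - k) \<noteq> 0"
  proof (rule ccontr)
    assume "\<not> ?thesis"
    then have "(g * q) $ j $ i = 0" unfolding mult_nth2 by (intro sum.neutral ballI) auto
    with assms show False by simp
  qed
  then show ?thesis using that by auto
qed

text \<open>Weight by weight, the full form takes the place of its initial part. The error is the
  product of \<open>g'\<close> with \<open>q1\<close> and \<open>q2\<close> up to sign, and it has
  gained weight: \<open>g'\<close> falls short of \<open>k\<close> by at most \<open>n + m\<close>,
  while \<open>(q1, q2)\<close> has weight above \<open>n + m\<close>.\<close>

lemma form_reduction: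
  assumes q: "weight_ge (n + m + 1) (q1, q2)"
  shows "\<exists>h g C D. A = partial_x h + g * (- (of_nat m * var_y) + q1) + C \<and>
    B = partial_y h + g * (of_nat n * var_x + q2) + D \<and> weight_ge k (C, D)"
proof (induction k)
  case 0
  show ?case by (intro exI[of _ 0] exI[of _ A] exI[of _ B]) (simp add: weight_ge_def partial_x_def partial_y_def fps_eq_iff)
next
  case (Suc k)
  then obtain h g C D where 1: "A = partial_x h + g * (- (of_nat m * var_y) + q1) + C"
    "B = partial_y h + g * (of_nat n * var_x + q2) + D" "weight_ge k (C, D)" by blast
  obtain h' g' where 2: "C = partial_x h' - of_nat m * var_y * g'" "D = partial_y h' + of_nat n * var_x * g'"
    and g': "\<And>i j. g' $ j $ i \<noteq> 0 \<Longrightarrow> k \<le> n * Suc i + m * Suc j"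
    using weighted_decomposition[OF 1(3)] by blast
  have "weight_ge (Suc k) (- g' * q1, - g' * q2)"
    unfolding weight_ge_def fst_conv snd_conv
  proof (intro allI conjI impI)
    fix i j assume "(- g' * q1) $ j $ i \<noteq> 0"
    then have "(g' * q1) $ j $ i \<noteq> 0" by simp
    then obtain l a where la: "l \<le> j" "a \<le> i" "g' $ l $ a \<noteq> 0" "q1 $ (j - l) $ (i - a) \<noteq> 0"
      by (rule mult_nth2_nonzero)
    have "n + m + 1 \<le> n * Suc (i - a) + m * (j - l)" using q la by (auto simp: weight_ge_def)
    moreover have "n * i = n * (i - a) + n * a" "m * j = m * (j - l) + m * l"
      using la by (simp_all add: distrib_left[symmetric])
    ultimately show "Suc k \<le> n * Suc i + m * j" using g'[OF la(3)] by simp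
  next
    fix i j assume "(- g' * q2) $ j $ i \<noteq> 0"
    then have "(g' * q2) $ j $ i \<noteq> 0" by simp
    then obtain l a where la: "l \<le> j" "a \<le> i" "g' $ l $ a \<noteq> 0" "q2 $ (j - l) $ (i - a) \<noteq> 0"
      by (rule mult_nth2_nonzero)
    have "n + m + 1 \<le> n * (i - a) + m * Suc (j - l)" using q la by (auto simp: weight_ge_def)
    moreover have "n * i = n * (i - a) + n * a" "m * j = m * (j - l) + m * l"
      using la by (simp_all add: distrib_left[symmetric])
    ultimately show "Suc k \<le> n * i + m * Suc j" using g'[OF la(3)] by simp
  qed
  moreover have "A = partial_x (h + h') + (g + g') * (- (of_nat m * var_y) + q1) + (- g' * q1)"
    "B = partial_y (h + h') + (g + g') * (of_nat n * var_x + q2) + (- g' * q2)"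
    by (simp_all add: 1 2 partial_x_add partial_y_add algebra_simps)
  ultimately show ?case by blast
qed

text \<open>\<open>form_reduction\<close> supplies only formal series. Cutting \<open>h\<close> off
  beyond the order of its pullback keeps that order, so formal and convergent series have the same
  finite values.\<close>

lemma value_semigroup_iff: "enat s \<in> value_semigroup FF \<longleftrightarrow> (\<exists>h. pull h \<noteq> 0 \<and> subdegree (pull h) = s)"
proof
  assume "enat s \<in> value_semigroup FF"
  then obtain G where "G \<in> conv_series" "intersection_mult FF G = enat s" by (auto simp: value_semigroup_def)
  then have "fps_ord (pull G) = enat s" by (simp add: intersection_mult_eq)
  then show "\<exists>h. pull h \<noteq> 0 \<and> subdegree (pull h) = s" by (intro exI[of _ G]) (simp add: fps_ord_def split: if_splits)
next
  assume "\<exists>h. pull h \<noteq> 0 \<and> subdegree (pull h) = s"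
  then obtain h where h: "pull h \<noteq> 0" "subdegree (pull h) = s" by blast
  let ?G = "truncate2 (Suc s) h"
  have "fps_X ^ Suc (subdegree (pull h)) dvd pull h - pull ?G"
    using pull_ord_ge[OF truncate2_ord_ge[of h "Suc s"]] h(2) by (simp add: pull_diff)
  from subdegree_congruent[OF this h(1)] have "fps_ord (pull ?G) = enat s"
    by (simp add: fps_ord_def h(2))
  then have "intersection_mult FF ?G = enat s" by (simp add: intersection_mult_eq)
  then show "enat s \<in> value_semigroup FF" unfolding value_semigroup_def by (intro CollectI exI[of _ ?G]) simp
qed

lemma infinity_in_value_semigroup: "\<infinity> \<in> value_semigroup FF"
proof -
  have "intersection_mult FF 0 = \<infinity>" by (simp add: intersection_mult_eq fps_ord_def pull_def)
  then show ?thesis unfolding value_semigroup_def using conv_0 by (metis (mono_tags, lifting) mem_Collect_eq)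
qed

lemma form_value_eq: "pb \<omega> \<noteq> 0 \<Longrightarrow> form_value (fps_X ^ n) y \<omega> = enat (Suc (subdegree (pb \<omega>)))"
  by (simp add: form_value_def fps_ord_def one_enat_def)

lemma form_value_zero: "pb \<omega> = 0 \<Longrightarrow> form_value (fps_X ^ n) y \<omega> = \<infinity>"
  by (simp add: form_value_def fps_ord_def)

lemma form_value_less_iff: "enat s < form_value (fps_X ^ n) y \<omega> \<longleftrightarrow> fps_X ^ s dvd pb \<omega>"
proof (cases "pb \<omega> = 0")
  case False
  then show ?thesis
    using fps_dvd_iff[of "fps_X ^ s" "pb \<omega>"] by (simp add: form_value_eq fps_X_power_subdegree less_Suc_eq_le)
qed (simp add: form_value_zero)

text \<open>If the value of \<open>\<eta>\<close> were smaller than that of \<open>\<omega>\<close>, then modulo terms of high order \<open>\<eta>\<close> would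
  have the same pullback as an exact form, and its value would lie in the semigroup.\<close>

lemma form_value_le:
  assumes q: "weight_ge (n + m + 1) (q1, q2)"
    and \<eta>: "form_value (fps_X ^ n) y \<eta> \<notin> value_semigroup FF"
  shows "form_value (fps_X ^ n) y (- (of_nat m * var_y) + q1, of_nat n * var_x + q2)
    \<le> form_value (fps_X ^ n) y \<eta>"
proof (rule ccontr)
  let ?\<omega> = "(- (of_nat m * var_y) + q1, of_nat n * var_x + q2)"
  assume less: "\<not> form_value (fps_X ^ n) y ?\<omega> \<le> form_value (fps_X ^ n) y \<eta>"
  obtain A B where AB: "\<eta> = (A, B)" by (cases \<eta>)
  have pb0: "pb \<eta> \<noteq> 0" using less by (auto simp: form_value_zero)
  define s where "s = Suc (subdegree (pb \<eta>))"
  have s: "form_value (fps_X ^ n) y \<eta> = enat s" using pb0 by (simp add: s_def form_value_eq)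
  have w: "fps_X ^ s dvd pb ?\<omega>" using less unfolding form_value_less_iff[symmetric] s by simp
  obtain h g C D where hg: "A = partial_x h + g * (- (of_nat m * var_y) + q1) + C"
    "B = partial_y h + g * (of_nat n * var_x + q2) + D" "weight_ge (Suc s) (C, D)"
    using form_reduction[OF q] by blast
  have "fps_X * fps_X ^ s dvd fps_X * pb (C, D)" using weight_ge_pb[OF hg(3)] by simp
  then have CD: "fps_X ^ s dvd pb (C, D)" by simp
  have "pb \<eta> = fps_deriv (pull h) + pull g * pb ?\<omega> + pb (C, D)"
    unfolding AB pb_pair pull_deriv hg(1,2) pull_add pull_mult by (simp add: algebra_simps)
  then have "pb \<eta> - fps_deriv (pull h) = pull g * pb ?\<omega> + pb (C, D)" by simp
  then have "fps_X ^ Suc (subdegree (pb \<eta>)) dvd pb \<eta> - fps_deriv (pull h)"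
    using w CD by (simp add: s_def[symmetric])
  note dh = subdegree_congruent[OF this pb0]
  \<comment> \<open>Without constant term, the order of the pullback is exactly one more than that
    of its derivative, which matches the successor in the value of a form.\<close>
  define h0 where "h0 = h - cst (pull h $ 0)"
  have p0: "pull h0 = pull h - fps_const (pull h $ 0)" by (simp add: h0_def pull_diff pull_cst)
  then have "fps_deriv (pull h0) = fps_deriv (pull h)" by simp
  then have nz: "pull h0 \<noteq> 0" using dh(1) by auto
  have "pull h0 $ 0 = 0" by (simp add: p0)
  from subdegree_fps_deriv'(2)[OF nz this] have "subdegree (pull h0) = s"
    using dh(2) \<open>fps_deriv (pull h0) = _\<close> by (simp add: s_def)
  then have "enat s \<in> value_semigroup FF" using nz value_semigroup_iff by blast
  then show False using \<eta> s by simp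
qed

end

section \<open>The forms in the family \<open>D1\<close>\<close>

lemma degree_less_iff_coeff: "K > 0 \<Longrightarrow> degree p < K \<longleftrightarrow> (\<forall>j\<ge>K. coeff p j = 0)"
proof
  assume K: "K > 0" and z: "\<forall>j\<ge>K. coeff p j = 0"
  show "degree p < K"
  proof (rule ccontr)
    assume "\<not> degree p < K"
    then have "lead_coeff p = 0" using z by simp
    then have "p = 0" by simp
    then show False using K \<open>\<not> degree p < K\<close> by simp
  qed
qed (auto intro: coeff_eq_0)

lemma ord_ge_sum: "(\<And>i. i \<in> A \<Longrightarrow> f i \<in> ord_ge N) \<Longrightarrow> sum f A \<in> ord_ge N"
  by (induction A rule: infinite_finite_induct) (auto intro: ord_ge_add simp: ord_ge_def)

text \<open>Membership with convergent coefficients becomes the vanishing of finitely many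
  coefficients, which is easy to check for a corrected form.\<close>

lemma in_ideal_squares_iff:
  assumes "G \<in> conv_series"
  shows "G \<in> ideal_gen {var_x ^ 2, var_x * var_y, var_y ^ 2} \<longleftrightarrow> G \<in> ord_ge 2"
proof
  let ?S = "{var_x ^ 2, var_x * var_y, var_y ^ 2}"
  have S: "s \<in> ord_ge 2" if "s \<in> ?S" for s
    using that monomial_mult_nth[of 1 2 0] monomial_mult_nth[of 1 1 1] monomial_mult_nth[of 1 0 2]
    by (auto simp: ord_ge_def fps_one_nth split: if_splits)
  assume "G \<in> ideal_gen ?S"
  then obtain a where "G = (\<Sum>s\<in>?S. a s * s)" unfolding ideal_gen_def by blast
  moreover have "(\<Sum>s\<in>?S. a s * s) \<in> ord_ge 2" by (intro ord_ge_sum ord_ge_mult S)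
  ultimately show "G \<in> ord_ge 2" by simp
next
  let ?S = "{var_x ^ 2, var_x * var_y, var_y ^ 2}"
  assume "G \<in> ord_ge 2"
  from ord_ge_expansion[OF assms this] obtain a where
    a: "\<forall>i\<le>2. a i \<in> conv_series" "G = (\<Sum>i\<le>2. a i * (var_x ^ i * var_y ^ (2 - i)))" by blast
  have "G = a 0 * var_y ^ 2 + (a 1 * (var_x * var_y) + a 2 * var_x ^ 2)"
    by (simp add: a(2) numeral_2_eq_2 add.assoc)
  also have "\<dots> \<in> ideal_gen ?S" using a(1) by (intro ideal_gen_add ideal_gen_mult_gen) auto
  finally show "G \<in> ideal_gen ?S" .
qed

lemma in_ideal_x2_y_iff:
  assumes G: "G \<in> conv_series"
  shows "G \<in> ideal_gen {var_x ^ 2, var_y} \<longleftrightarrow> G $ 0 $ 0 = 0 \<and> G $ 0 $ 1 = 0"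
proof
  assume "G \<in> ideal_gen {var_x ^ 2, var_y}"
  then obtain a b where "G = a * var_x ^ 2 + b * var_y" by (auto simp: ideal_gen_pair)
  then show "G $ 0 $ 0 = 0 \<and> G $ 0 $ 1 = 0"
    by (simp add: fps_const_power fps_X_power_mult_right_nth)
next
  assume z: "G $ 0 $ 0 = 0 \<and> G $ 0 $ 1 = 0"
  define A where "A = fps_const (fps_shift 2 (G $ 0))"
  define B where "B = fps_shift 1 G"
  have "A \<in> conv_series"
    by (rule conv_series_compare[OF G, of _ 1 0 2]) (auto simp: A_def mult_le_cancel_right1)
  moreover have "B \<in> conv_series"
    by (rule conv_series_compare[OF G, of _ 1 1 0]) (auto simp: B_def mult_le_cancel_right1)
  moreover have "G = A * var_x ^ 2 + B * var_y"
  proof (rule fps_ext, rule fps_ext)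
    fix j i :: nat
    have "i < 2 \<Longrightarrow> i = 0 \<or> i = 1" "\<not> i < 2 \<Longrightarrow> Suc (Suc (i - 2)) = i" by auto
    then show "G $ j $ i = (A * var_x ^ 2 + B * var_y) $ j $ i" using z
      by (cases j) (auto simp: A_def B_def fps_const_power fps_X_power_mult_right_nth)
  qed
  ultimately show "G \<in> ideal_gen {var_x ^ 2, var_y}" unfolding ideal_gen_pair by blast
qed

lemma conv_radius_add_pos: "fps_conv_radius f > 0 \<Longrightarrow> fps_conv_radius g > 0 \<Longrightarrow> fps_conv_radius (f + g) > 0"
  for f g :: "complex fps"
  using fps_conv_radius_add[of f g] by (auto simp: min_def split: if_splits)

lemma conv_radius_diff_pos: "fps_conv_radius f > 0 \<Longrightarrow> fps_conv_radius g > 0 \<Longrightarrow> fps_conv_radius (f - g) > 0"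
  for f g :: "complex fps"
  using fps_conv_radius_diff[of f g] by (auto simp: min_def split: if_splits)

lemma conv_radius_mult_pos: "fps_conv_radius f > 0 \<Longrightarrow> fps_conv_radius g > 0 \<Longrightarrow> fps_conv_radius (f * g) > 0"
  for f g :: "complex fps"
  using fps_conv_radius_mult[of f g] by (auto simp: min_def split: if_splits)

lemma conv_polys_diff: "p \<in> conv_polys \<Longrightarrow> q \<in> conv_polys \<Longrightarrow> p - q \<in> conv_polys"
  by (simp add: conv_polys_def conv_radius_diff_pos)

context branch begin

definition admissible :: "complex fps poly \<Rightarrow> complex fps poly \<Rightarrow> bool" where
  "admissible Q1 Q2 \<longleftrightarrow> Q1 \<in> conv_polys \<and> Q2 \<in> conv_polys \<and>
     (\<forall>i j. i + j < 2 \<longrightarrow> coeff Q1 j $ i = 0) \<and> coeff Q2 0 $ 0 = 0 \<and> coeff Q2 0 $ 1 = 0 \<and>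
     (\<forall>j\<ge>n div gcd n m. coeff Q1 j = 0) \<and> (\<forall>j\<ge>n div gcd n m - 1. coeff Q2 j = 0) \<and>
     (\<forall>i. coeff Q1 0 $ i \<noteq> 0 \<longrightarrow> m < n * i)"

definition D1_form :: "complex fps poly \<Rightarrow> complex fps poly \<Rightarrow> form" where
  "D1_form Q1 Q2 = (- (of_nat m * var_y) + fps_of_poly Q1, of_nat n * var_x + fps_of_poly Q2)"

lemma admissible_order_iff:
  "ereal_of_enat (fps_ord f) > ereal (real m / real n) \<longleftrightarrow> (\<forall>i. f $ i \<noteq> 0 \<longrightarrow> m < n * i)"
proof (cases "f = 0")
  case False
  have r: "real m / real n < real i \<longleftrightarrow> m < n * i" for i
  proof -
    have "real m / real n < real i \<longleftrightarrow> real m < real (n * i)" using n by (simp add: field_simps)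
    then show ?thesis by (simp only: of_nat_less_iff)
  qed
  have "(\<forall>i. f $ i \<noteq> 0 \<longrightarrow> m < n * i) \<longleftrightarrow> m < n * subdegree f"
  proof (intro iffI allI impI)
    show "m < n * subdegree f" if "\<forall>i. f $ i \<noteq> 0 \<longrightarrow> m < n * i" using that False by simp
    show "m < n * i" if "m < n * subdegree f" "f $ i \<noteq> 0" for i
      using that subdegree_leI[of f i] by (meson less_le_trans mult_le_mono2)
  qed
  then show ?thesis using False by (simp add: fps_ord_def r)
qed (simp add: fps_ord_def)

lemma fps_of_poly_ord_ge_2: "fps_of_poly Q \<in> ord_ge 2 \<longleftrightarrow> (\<forall>i j. i + j < 2 \<longrightarrow> coeff Q j $ i = 0)"
  by (simp add: ord_ge_def)

text \<open>If \<open>n div gcd n m = 1\<close>, no polynomial has degree below \<open>0\<close>,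
  whereas \<open>admissible\<close> would still allow \<open>Q2 = 0\<close>; hence the
  assumption.\<close>

lemma forms_D1_eq:
  assumes "n div gcd n m > 1"
  shows "forms_D1 n m = {D1_form Q1 Q2 | Q1 Q2. admissible Q1 Q2}"
proof -
  have "Q1 \<in> conv_polys \<and> Q2 \<in> conv_polys \<and>
        fps_of_poly Q1 \<in> ideal_gen {var_x ^ 2, var_x * var_y, var_y ^ 2} \<and>
        fps_of_poly Q2 \<in> ideal_gen {var_x ^ 2, var_y} \<and>
        degree Q1 < n div gcd n m \<and> degree Q2 < n div gcd n m - 1 \<and>
        ereal_of_enat (fps_ord (poly Q1 0)) > ereal (real m / real n) \<longleftrightarrow> admissible Q1 Q2" for Q1 Q2
  proof (cases "Q1 \<in> conv_polys \<and> Q2 \<in> conv_polys")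
    case True
    then have c: "fps_of_poly Q1 \<in> conv_series" "fps_of_poly Q2 \<in> conv_series" by (simp_all add: conv_fps_of_poly)
    show ?thesis
      unfolding in_ideal_squares_iff[OF c(1)] in_ideal_x2_y_iff[OF c(2)] fps_of_poly_ord_ge_2
        admissible_order_iff poly_0_coeff_0 admissible_def
      using assms True by (simp add: degree_less_iff_coeff)
  qed (auto simp: admissible_def)
  then show ?thesis unfolding forms_D1_def D1_form_def by simp
qed

lemma pull_poly: "pull (fps_of_poly p) = (\<Sum>j\<le>degree p. (coeff p j oo fps_X ^ n) * y ^ j)"
proof -
  have "pull (fps_of_poly p) = poly (ramify_poly n p) y"
    unfolding pull_def by (rule pull_fps_of_poly[OF Xy n])
  also have "\<dots> = (\<Sum>j\<le>degree (ramify_poly n p). coeff (ramify_poly n p) j * y ^ j)" by (rule poly_altdef)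
  also have "\<dots> = (\<Sum>j\<le>degree p. coeff (ramify_poly n p) j * y ^ j)"
  proof (rule sum.mono_neutral_left)
    have "degree (ramify_poly n p) \<le> degree p"
      by (rule degree_le) (simp add: coeff_ramify_poly coeff_eq_0)
    then show "{..degree (ramify_poly n p)} \<subseteq> {..degree p}" by simp
  qed (auto simp: coeff_eq_0)
  finally show ?thesis by (simp add: coeff_ramify_poly)
qed

lemma subdegree_y: "y \<noteq> 0" "subdegree y = m"
  using y_nth by (auto intro!: subdegreeI)

lemma subdegree_ramify: "(f :: complex fps) \<noteq> 0 \<Longrightarrow> (f oo fps_X ^ n) \<noteq> 0 \<and> subdegree (f oo fps_X ^ n) = n * subdegree f"
proof -
  assume f: "f \<noteq> 0"
  have "(f oo fps_X ^ n) $ (n * subdegree f) \<noteq> 0" using f n by (simp add: compose_X_power_nth)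
  moreover have "(f oo fps_X ^ n) $ i = 0" if "i < n * subdegree f" for i
    using n that by (auto simp: compose_X_power_nth elim!: dvdE)
  ultimately show ?thesis by (metis fps_zero_nth subdegreeI)
qed

text \<open>Terms with different \<open>j\<close> have different orders, because the products
  \<open>j * (m div gcd n m)\<close> are distinct modulo \<open>n div gcd n m\<close>. Hence nothing
  cancels, and the order of the sum is the smallest weight.\<close>

lemma low_degree_value:
  assumes r: "\<forall>j\<ge>n div gcd n m. coeff r j = 0" and nz: "pull (fps_of_poly r) \<noteq> 0"
  shows "\<exists>a b. b < n div gcd n m \<and> subdegree (pull (fps_of_poly r)) = n * a + m * b"
proof -
  define t where "t = (\<lambda>j. (coeff r j oo fps_X ^ n) * y ^ j)"
  define J where "J = {j. j \<le> degree r \<and> coeff r j \<noteq> 0}"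
  define w where "w = (\<lambda>j. n * subdegree (coeff r j) + m * j)"
  have t: "t j \<noteq> 0" "subdegree (t j) = w j" if "j \<in> J" for j
    using that subdegree_ramify[of "coeff r j"] subdegree_y
    by (auto simp: t_def J_def w_def subdegree_power)
  have sum: "pull (fps_of_poly r) = (\<Sum>j\<in>J. t j)"
    unfolding pull_poly t_def by (rule sum.mono_neutral_cong_right) (auto simp: J_def)
  have fin: "finite J" by (simp add: J_def)
  have ne: "J \<noteq> {}" using nz sum by auto
  have Jn: "j < n div gcd n m" if "j \<in> J" for j using r that by (auto simp: J_def not_less[symmetric])
  have inj: "j = k" if jk: "j \<in> J" "k \<in> J" "w j = w k" for j k
  proof -
    define e where "e = gcd n m"
    define n1 m1 where "n1 = n div e" and "m1 = m div e"
    have e0: "e > 0" using n by (simp add: e_def)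
    have nm: "n = e * n1" "m = e * m1" by (simp_all add: n1_def m1_def e_def)
    have cop: "coprime n1 m1" unfolding n1_def m1_def e_def using n by (intro div_gcd_coprime) auto
    have key: "j = k" if "j \<le> k" "w j = w k" "k < n1" for j k
    proof -
      have "e * (n1 * subdegree (coeff r j) + m1 * j) = e * (n1 * subdegree (coeff r k) + m1 * k)"
        using that(2) unfolding w_def by (simp only: nm[symmetric] distrib_left mult.assoc[symmetric])
      then have "n1 * subdegree (coeff r j) + m1 * j = n1 * subdegree (coeff r k) + m1 * k" using e0 by simp
      moreover have "m1 * k = m1 * j + m1 * (k - j)" using that(1) by (simp add: distrib_left[symmetric])
      ultimately have "n1 * subdegree (coeff r j) = n1 * subdegree (coeff r k) + m1 * (k - j)" by simp
      then have "n1 dvd n1 * subdegree (coeff r k) + m1 * (k - j)" by (metis dvd_triv_left)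
      then have "n1 dvd m1 * (k - j)" by (simp add: dvd_add_right_iff)
      then have "n1 dvd k - j" using cop by (simp add: coprime_dvd_mult_right_iff)
      then have "k - j = 0" using that(3) by (auto dest: dvd_imp_le)
      then show ?thesis using that(1) by simp
    qed
    have "j < n1" "k < n1" using jk Jn by (auto simp: n1_def e_def)
    then show ?thesis using key[of j k] key[of k j] jk(3) by (metis nle_le)
  qed
  define s where "s = Min (w ` J)"
  have "s \<in> w ` J" unfolding s_def using fin ne by (intro Min_in) auto
  then obtain j0 where j0: "j0 \<in> J" "s = w j0" by blast
  have s_le: "s \<le> w j" if "j \<in> J" for j unfolding s_def using fin that by (intro Min_le) auto
  have "(\<Sum>j\<in>J. t j) $ s = (\<Sum>j\<in>{j0}. t j $ s)" unfolding fps_sum_nth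
  proof (rule sum.mono_neutral_right)
    show "\<forall>j\<in>J - {j0}. t j $ s = 0"
    proof
      fix j assume j: "j \<in> J - {j0}"
      then have jJ: "j \<in> J" and "w j \<noteq> w j0" using inj[of j j0] j0(1) by blast+
      then have "s < subdegree (t j)" using s_le[of j] j0(2) t(2)[of j] by linarith
      then show "t j $ s = 0" by (rule nth_less_subdegree_zero)
    qed
  qed (simp_all add: fin j0(1))
  moreover have "t j0 $ s \<noteq> 0"
    using t[OF j0(1)] unfolding j0(2) by (metis nth_subdegree_nonzero)
  ultimately have "pull (fps_of_poly r) $ s \<noteq> 0" by (simp add: sum)
  moreover have "pull (fps_of_poly r) $ i = 0" if "i < s" for i
  proof -
    have "t j $ i = 0" if "j \<in> J" for j
      using \<open>i < s\<close> s_le[OF that] t(2)[OF that] by (intro nth_less_subdegree_zero) simp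
    then show ?thesis unfolding sum fps_sum_nth by simp
  qed
  ultimately have "subdegree (pull (fps_of_poly r)) = s" by (intro subdegreeI) auto
  then show ?thesis using j0 Jn
    by (intro exI[of _ "subdegree (coeff r j0)"] exI[of _ j0]) (simp add: w_def)
qed

text \<open>Only a part of \<open>h\<close> that is polynomial in \<open>y\<close> affects its
  value. Division by the monic \<open>f\<close>, whose pullback is divisible by
  \<open>fps_X ^ B\<close>, leaves a remainder of low degree with the same value.\<close>

lemma small_value:
  assumes f: "lead_coeff f = 1" "degree f = n div gcd n m" "fps_X ^ B dvd pull (fps_of_poly f)"
    and h: "pull h \<noteq> 0" "subdegree (pull h) < B"
  shows "\<exists>a b. b < n div gcd n m \<and> subdegree (pull h) = n * a + m * b"
proof -
  define s where "s = subdegree (pull h)"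
  define p where "p = (\<Sum>j\<le>s. monom (h $ j) j)"
  have f0: "f \<noteq> 0" using f by auto
  have n1: "n div gcd n m > 0" using n by (simp add: div_greater_zero_iff gcd_le1_nat)
  have "h - fps_of_poly p \<in> ord_ge (Suc s)"
    by (auto simp: ord_ge_def p_def coeff_sum_monom_fps)
  then have hp: "fps_X ^ Suc s dvd pull h - pull (fps_of_poly p)"
    using pull_ord_ge by (metis pull_diff)
  \<comment> \<open>Pseudo-division is genuine division here, as \<open>f\<close> has leading
    coefficient \<open>1\<close>.\<close>
  obtain q r where qr: "pseudo_divmod p f = (q, r)" by (cases "pseudo_divmod p f")
  have p: "p = f * q + r" and r: "r = 0 \<or> degree r < degree f"
    using pseudo_divmod[OF f0 qr] f(1) by auto
  have "fps_X ^ B dvd pull (fps_of_poly p) - pull (fps_of_poly r)"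
    unfolding p using f(3) by (simp add: fps_of_poly_add fps_of_poly_mult pull_add pull_mult)
  then have "fps_X ^ Suc s dvd pull (fps_of_poly p) - pull (fps_of_poly r)"
    using h(2) by (rule_tac dvd_trans[OF le_imp_power_dvd]) (auto simp: s_def)
  from dvd_add[OF hp this] have "fps_X ^ Suc s dvd pull h - pull (fps_of_poly r)" by simp
  note sr = subdegree_congruent[OF this[unfolded s_def] h(1)]
  have "\<forall>j\<ge>n div gcd n m. coeff r j = 0" using r f(2) by (auto intro: coeff_eq_0)
  from low_degree_value[OF this sr(1)] show ?thesis by (simp add: sr(2))
qed

section \<open>Exponents outside the multiples of the gcd, and corrections inside the family\<close>

definition no_other_up_to :: "nat \<Rightarrow> complex fps \<Rightarrow> bool" where
  "no_other_up_to k f \<longleftrightarrow> (\<forall>N<k. \<not> gcd n m dvd N \<longrightarrow> f $ N = 0)"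

text \<open>An exponent of the product outside the multiples of the gcd needs such an exponent in
  one factor, and the other factor contributes at least its order.\<close>

lemma no_other_up_to_mult:
  assumes "no_other_up_to k f" "no_other_up_to l g" "fps_X ^ p dvd f" "fps_X ^ q dvd g"
  shows "no_other_up_to (min (k + q) (l + p)) (f * g)"
  unfolding no_other_up_to_def mult_sum_nth
proof (intro allI impI sum.neutral ballI)
  fix N i assume N: "N < min (k + q) (l + p)" "\<not> gcd n m dvd N" and i: "i \<in> {..N}"
  show "f $ i * g $ (N - i) = 0"
  proof (rule ccontr)
    assume "f $ i * g $ (N - i) \<noteq> 0"
    then have nz: "f $ i \<noteq> 0" "g $ (N - i) \<noteq> 0" by auto
    have "p \<le> i" "q \<le> N - i"
      using nz assms(3,4) by (auto simp: fps_X_power_dvd_iff not_less[symmetric])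
    then have "i < k" "N - i < l" using N i by auto
    then have "gcd n m dvd i" "gcd n m dvd N - i" using nz assms(1,2) by (auto simp: no_other_up_to_def)
    then have "gcd n m dvd i + (N - i)" by (rule dvd_add)
    then show False using N i by simp
  qed
qed

end

lemma dvd_diff_iff: "(d::nat) dvd k \<Longrightarrow> k \<le> N \<Longrightarrow> d dvd N - k \<longleftrightarrow> d dvd N"
  by (metis dvd_diffD dvd_diff_nat)

context branch begin

lemma pull_D1:
  "pull (- (of_nat m * var_y) + q1) = pull q1 - fps_const (of_nat m) * y"
  "pull (of_nat n * var_x + q2) = fps_const (of_nat n) * fps_X ^ n + pull q2"
proof -
  have "pull (of_nat k * G) = fps_const (of_nat k) * pull G" for k G
    unfolding pull_mult by (simp add: pull_def subst_of_nat fps_of_nat)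
  then have "pull (of_nat m * var_y) = fps_const (of_nat m) * y" "pull (of_nat n * var_x) = fps_const (of_nat n) * fps_X ^ n"
    by (simp_all add: pull_def subst_var_x[OF Xn Xy] subst_var_y[OF Xn Xy])
  then show "pull (- (of_nat m * var_y) + q1) = pull q1 - fps_const (of_nat m) * y"
    "pull (of_nat n * var_x + q2) = fps_const (of_nat n) * fps_X ^ n + pull q2"
    unfolding pull_add by (simp_all add: pull_def subst_uminus)
qed

lemma no_other_up_to_y_power:
  assumes "no_other_up_to \<beta> y"
  shows "no_other_up_to (m * j + \<beta>) (y ^ Suc j)"
proof (induction j)
  case (Suc j)
  have "fps_X ^ (m * Suc j) dvd y ^ Suc j"
    unfolding power_mult by (rule dvd_power_same[OF X_power_m_dvd])
  from no_other_up_to_mult[OF assms Suc X_power_m_dvd this]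
  show ?case by (simp add: algebra_simps no_other_up_to_def)
qed (use assms in simp)

lemma no_other_up_to_dy:
  assumes "no_other_up_to \<beta> y"
  shows "no_other_up_to (m * j + \<beta>) (fps_X * fps_deriv y * y ^ j)"
proof -
  have d: "no_other_up_to \<beta> (fps_X * fps_deriv y)"
    using assms by (simp add: no_other_up_to_def X_mult_deriv)
  show ?thesis
  proof (cases j)
    case (Suc i)
    have "fps_X ^ (m * Suc i) dvd y ^ Suc i"
      unfolding power_mult by (rule dvd_power_same[OF X_power_m_dvd])
    from no_other_up_to_mult[OF d no_other_up_to_y_power[OF assms, of i] X_deriv_y this]
    show ?thesis by (simp add: algebra_simps no_other_up_to_def Suc)
  qed (use d in simp)
qed

text \<open>The coefficient is \<open>n * (\<beta> - m) * y $ \<beta>\<close> and comes from the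
  initial part alone; \<open>\<beta>\<close> differs from \<open>m\<close> because
  \<open>gcd n m\<close> does not divide it. This caps the values of the family at
  \<open>n + \<beta>\<close>.\<close>

lemma D1_pb_nth:
  assumes q: "weight_ge (n + m + 1) (q1, q2)"
    and b: "y $ \<beta> \<noteq> 0" "\<not> gcd n m dvd \<beta>" "no_other_up_to \<beta> y"
  shows "(fps_X * pb (- (of_nat m * var_y) + q1, of_nat n * var_x + q2)) $ (n + \<beta>) \<noteq> 0"
proof -
  let ?dy = "fps_X * fps_deriv y"
  have gn: "gcd n m dvd n * i" for i by simp
  have q1: "pull q1 $ \<beta> = 0"
    unfolding pull_def subst_curve_def fps_nth_Abs_fps
  proof (intro sum.neutral ballI)
    fix i j
    show "q1 $ j $ i * ((fps_X ^ n) ^ i * y ^ j) $ \<beta> = 0"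
    proof (cases "q1 $ j $ i = 0 \<or> \<beta> < n * i")
      case True
      then show ?thesis by (auto simp: power_mult[symmetric] fps_X_power_mult_nth)
    next
      case False
      then have "n + m + 1 \<le> n * Suc i + m * j" using q by (auto simp: weight_ge_def)
      then have w: "m < n * i + m * j" by simp
      \<comment> \<open>The weight bound puts the remaining exponent \<open>\<beta> - n * i\<close>
        below the first exponent of \<open>y ^ j\<close> outside the multiples of the gcd.\<close>
      have nd: "\<not> gcd n m dvd \<beta> - n * i" using b(2) False dvd_diff_iff[OF gn] by simp
      have "y ^ j $ (\<beta> - n * i) = 0"
      proof (cases j)
        case 0
        then show ?thesis using nd by (auto simp: fps_one_nth)
      next
        case (Suc k)
        have "n * i \<le> \<beta>" using False by simp
        then have "\<beta> - n * i < m * k + \<beta>" using w unfolding Suc mult_Suc_right by linarith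
        then show ?thesis using no_other_up_to_y_power[OF b(3), of k] nd
          by (simp add: no_other_up_to_def Suc)
      qed
      then show ?thesis by (simp add: power_mult[symmetric] fps_X_power_mult_nth)
    qed
  qed
  have "(?dy * pull q2) $ (n + \<beta>) = (\<Sum>i\<le>n + \<beta>. \<Sum>j\<le>n + \<beta>. q2 $ j $ i * (?dy * ((fps_X ^ n) ^ i * y ^ j)) $ (n + \<beta>))"
    unfolding pull_def by (rule subst_var_mult_aux[OF Xn Xy, symmetric])
  also have "\<dots> = 0"
  proof (intro sum.neutral ballI)
    fix i j
    have e: "?dy * ((fps_X ^ n) ^ i * y ^ j) = fps_X ^ (n * i) * (?dy * y ^ j)"
      unfolding power_mult by (simp only: mult_ac)
    show "q2 $ j $ i * (?dy * ((fps_X ^ n) ^ i * y ^ j)) $ (n + \<beta>) = 0"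
    proof (cases "q2 $ j $ i = 0 \<or> n + \<beta> < n * i")
      case True
      then show ?thesis unfolding e by (auto simp: fps_X_power_mult_nth)
    next
      case False
      then have "n + m + 1 \<le> n * i + m * Suc j" using q by (auto simp: weight_ge_def)
      then have w: "n < n * i + m * j" by simp
      have "\<not> gcd n m dvd n + \<beta>" using b(2) by (simp add: dvd_add_right_iff)
      then have nd: "\<not> gcd n m dvd n + \<beta> - n * i" using False dvd_diff_iff[OF gn] by simp
      have "n * i \<le> n + \<beta>" using False by simp
      then have "n + \<beta> - n * i < m * j + \<beta>" using w by linarith
      then have "(?dy * y ^ j) $ (n + \<beta> - n * i) = 0"
        using no_other_up_to_dy[OF b(3), of j] nd by (simp add: no_other_up_to_def)
      then show ?thesis unfolding e by (simp only: fps_X_power_mult_nth) simp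
    qed
  qed
  finally have q2: "(?dy * pull q2) $ (n + \<beta>) = 0" .
  have "fps_X * pb (- (of_nat m * var_y) + q1, of_nat n * var_x + q2) =
      fps_X ^ n * (fps_const (of_nat n) * (?dy - fps_const (of_nat m) * y + pull q1)) + ?dy * pull q2"
    unfolding X_pb pull_D1 by (simp add: algebra_simps)
  then have "(fps_X * pb (- (of_nat m * var_y) + q1, of_nat n * var_x + q2)) $ (n + \<beta>) =
      of_nat n * (?dy $ \<beta> - of_nat m * y $ \<beta>)"
    using q1 q2 by (simp add: fps_X_power_mult_nth del: fps_mult_fps_X_commute)
  also have "\<dots> = of_nat n * ((of_nat \<beta> - of_nat m) * y $ \<beta>)" by (simp add: X_mult_deriv algebra_simps)
  also have "\<dots> \<noteq> 0"
  proof -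
    have "\<beta> \<noteq> m" using b(2) by auto
    then show ?thesis using b(1) n by simp
  qed
  finally show ?thesis .
qed

text \<open>The purpose of the conditions on the family: \<open>x ^ i dx\<close> has weight
  \<open>n * (i + 1)\<close>, above \<open>n + m\<close> exactly if \<open>i > m / n\<close>. The
  ideal conditions exclude \<open>y dx\<close>, \<open>dy\<close> and \<open>x dy\<close>.\<close>

lemma admissible_weight:
  assumes "n < m" "admissible Q1 Q2"
  shows "weight_ge (n + m + 1) (fps_of_poly Q1, fps_of_poly Q2)"
  unfolding weight_ge_def fst_conv snd_conv fps_of_poly_nth
proof (intro allI conjI impI)
  fix i j
  {
    assume nz: "coeff Q1 j $ i \<noteq> 0"
    then have ij: "\<not> i + j < 2" using assms(2) by (auto simp: admissible_def)
    consider "j = 0" | "j = 1" "i \<ge> 1" | "j \<ge> 2" using ij by linarith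
    then show "n + m + 1 \<le> n * Suc i + m * j"
    proof cases
      case 1
      then have "m < n * i" using nz assms(2) by (auto simp: admissible_def)
      then show ?thesis by simp
    next
      case 2
      then have "n * 1 \<le> n * i" by (intro mult_le_mono2)
      then show ?thesis using n unfolding 2(1) mult_Suc_right by linarith
    next
      case 3
      then have "m * 2 \<le> m * j" by (intro mult_le_mono2)
      then show ?thesis using m unfolding mult_Suc_right by linarith
    qed
  }
  assume nz: "coeff Q2 j $ i \<noteq> 0"
  have "\<not> (j = 0 \<and> (i = 0 \<or> i = 1))" using nz assms(2) by (auto simp: admissible_def)
  then consider "j = 0" "i \<ge> 2" | "j \<ge> 1" by linarith
  then show "n + m + 1 \<le> n * i + m * Suc j"
  proof cases
    case 1
    then have "n * 2 \<le> n * i" by (intro mult_le_mono2)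
    then show ?thesis using n unfolding mult_Suc_right by linarith
  next
    case 2
    then have "m * 1 \<le> m * j" by (intro mult_le_mono2)
    then show ?thesis using assms(1) unfolding mult_Suc_right by linarith
  qed
qed

text \<open>The terms of order \<open>n + m\<close> in \<open>n x dy - m y dx\<close> cancel,
  because \<open>t y' - m y\<close> has order above \<open>m\<close>.\<close>

lemma D1_value_gt:
  assumes "weight_ge (n + m + 1) (q1, q2)"
  shows "fps_X ^ (n + m) dvd pb (- (of_nat m * var_y) + q1, of_nat n * var_x + q2)"
proof -
  let ?u = "fps_X * fps_deriv y - fps_const (of_nat m) * y"
  have "fps_X * pb (- (of_nat m * var_y) + q1, of_nat n * var_x + q2) =
      fps_const (of_nat n) * (fps_X ^ n * ?u) + fps_X * pb (q1, q2)"
    unfolding X_pb pull_D1 by (simp add: algebra_simps)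
  moreover have "?u $ i = 0" if "i < m + 1" for i
    using y_nth(1)[of i] that by (cases "i = m") (simp_all add: X_mult_deriv)
  then have "fps_X ^ (m + 1) dvd ?u" unfolding fps_X_power_dvd_iff by blast
  then have "fps_X ^ n * fps_X ^ (m + 1) dvd fps_X ^ n * ?u"
    by (rule mult_dvd_mono[OF dvd_refl])
  then have "fps_X ^ (n + m + 1) dvd fps_const (of_nat n) * (fps_X ^ n * ?u)"
    unfolding power_add[symmetric] add.assoc by (rule dvd_mult)
  ultimately have "fps_X ^ (n + m + 1) dvd fps_X * pb (- (of_nat m * var_y) + q1, of_nat n * var_x + q2)"
    using weight_ge_pb[OF assms] by (metis dvd_add)
  then have "fps_X * fps_X ^ (n + m) dvd fps_X * pb (- (of_nat m * var_y) + q1, of_nat n * var_x + q2)"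
    by simp
  then show ?thesis by simp
qed

lemma pull_monom: "pull (fps_of_poly (monom f j)) = (f oo fps_X ^ n) * y ^ j"
  unfolding fps_of_poly_monom pull_mult
  by (simp add: pull_def subst_fps_const[OF Xn Xy] subst_power[OF Xn Xy] subst_var_y[OF Xn Xy])

lemma cancel_leading_term:
  fixes f g :: "complex fps"
  assumes "fps_X ^ s dvd f" "g \<noteq> 0" "subdegree g = s"
  shows "\<exists>c. fps_X ^ Suc s dvd f - fps_const c * g"
proof (intro exI)
  have g: "g $ s \<noteq> 0" using nth_subdegree_nonzero[OF assms(2)] unfolding assms(3) .
  have z: "f $ i = 0" "g $ i = 0" if "i < s" for i
    using assms(1) that unfolding fps_X_power_dvd_iff assms(3)[symmetric]
    by (blast, intro nth_less_subdegree_zero)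
  show "fps_X ^ Suc s dvd f - fps_const (f $ s / g $ s) * g"
    unfolding fps_X_power_dvd_iff
  proof (intro allI impI)
    fix i assume "i < Suc s"
    then consider "i < s" | "i = s" by linarith
    then show "(f - fps_const (f $ s / g $ s) * g) $ i = 0" by cases (use g z in simp_all)
  qed
qed

lemma pb_D1_form_diff:
  "pb (D1_form (Q1 - smult (fps_const c) P1) (Q2 - smult (fps_const c) P2)) =
    pb (D1_form Q1 Q2) - fps_const c * pb (fps_of_poly P1, fps_of_poly P2)"
  by (simp add: D1_form_def pb_pair fps_of_poly_diff fps_of_poly_smult pull_add pull_diff pull_mult pull_cst
      algebra_simps)

text \<open>A monomial form of weight above \<open>n + m\<close> is none of \<open>dx\<close>,
  \<open>x dx\<close>, \<open>y dx\<close>, as \<open>n < m\<close>; for \<open>b = 0\<close> the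
  weight condition gives the required order in \<open>x\<close>.\<close>

lemma admissible_diff_dx:
  assumes adm: "admissible Q1 Q2" and ab: "a > 0" "b < n div gcd n m" "n + m < n * a + m * b" and nm: "n < m"
  shows "admissible (Q1 - smult (fps_const c) (monom (fps_X ^ (a - 1)) b)) Q2" (is "admissible (_ - ?P) _")
  unfolding admissible_def
proof (intro conjI allI impI)
  have P: "coeff ?P j = (if j = b then fps_const c * fps_X ^ (a - 1) else 0)" for j by (simp add: coeff_monom)
  have "?P \<in> conv_polys" unfolding conv_polys_def P by (auto intro!: conv_radius_mult_pos)
  then show "Q1 - ?P \<in> conv_polys" using adm by (auto simp: admissible_def intro: conv_polys_diff)
  show "coeff (Q1 - ?P) j $ i = 0" if "i + j < 2" for i j
  proof -
    have "\<not> (j = b \<and> i = a - 1)"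
    proof
      assume "j = b \<and> i = a - 1"
      then have "(a = 1 \<and> b = 0) \<or> (a = 2 \<and> b = 0) \<or> (a = 1 \<and> b = 1)" using that ab(1) by auto
      then show False using ab(3) nm by auto
    qed
    then show ?thesis using adm that by (auto simp: coeff_monom admissible_def fps_X_power_iff)
  qed
  show "coeff (Q1 - ?P) j = 0" if "n div gcd n m \<le> j" for j
    using adm that ab(2) by (simp add: coeff_monom admissible_def)
  show "m < n * i" if "coeff (Q1 - ?P) 0 $ i \<noteq> 0" for i
  proof (cases "coeff Q1 0 $ i = 0")
    case True
    then have "b = 0" "i = a - 1" using that by (auto simp: coeff_monom fps_X_power_iff split: if_splits)
    then have "n * Suc i = n * a + m * b" using ab(1) by simp
    then show ?thesis using ab(3) by simp
  qed (use adm in \<open>simp add: admissible_def\<close>)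
qed (use adm in \<open>auto simp: admissible_def\<close>)

lemma admissible_diff_dy:
  assumes adm: "admissible Q1 Q2" and b: "b \<ge> 2" "b < n div gcd n m"
  shows "admissible Q1 (Q2 - smult (fps_const c) (monom 1 (b - 1)))" (is "admissible _ (_ - ?P)")
  unfolding admissible_def
proof (intro conjI allI impI)
  have P: "coeff ?P j = (if j = b - 1 then fps_const c else 0)" for j by (simp add: coeff_monom)
  have "?P \<in> conv_polys" unfolding conv_polys_def P by auto
  then show "Q2 - ?P \<in> conv_polys" using adm by (auto simp: admissible_def intro: conv_polys_diff)
  show "coeff (Q2 - ?P) 0 $ 0 = 0" "coeff (Q2 - ?P) 0 $ 1 = 0"
    using adm b by (auto simp: coeff_monom admissible_def)
  show "coeff (Q2 - ?P) j = 0" if "n div gcd n m - 1 \<le> j" for j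
    using adm that b by (simp add: coeff_monom admissible_def)
qed (use adm in \<open>auto simp: admissible_def\<close>)

text \<open>The correction is a multiple of \<open>x ^ (a - 1) * y ^ b dx\<close>, or of \<open>y ^ (b - 1) dy\<close> if \<open>a = 0\<close>.\<close>

lemma improve_form:
  assumes nm: "n < m" and adm: "admissible Q1 Q2" and s: "form_value (fps_X ^ n) y (D1_form Q1 Q2) = enat s"
    and ab: "s = n * a + m * b" "b < n div gcd n m"
  shows "\<exists>Q1 Q2. admissible Q1 Q2 \<and> enat s < form_value (fps_X ^ n) y (D1_form Q1 Q2)"
proof -
  let ?w = "D1_form Q1 Q2"
  have wt: "weight_ge (n + m + 1) (fps_of_poly Q1, fps_of_poly Q2)" by (rule admissible_weight[OF nm adm])
  have "enat (n + m) < enat s" using D1_value_gt[OF wt] unfolding s[symmetric] form_value_less_iff D1_form_def .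
  then have snm: "n + m < s" by simp
  have "enat (s - 1) < form_value (fps_X ^ n) y ?w" unfolding s using snm by simp
  then have ds: "fps_X ^ s dvd fps_X * pb ?w"
    using snm unfolding form_value_less_iff by (metis Suc_pred' less_nat_zero_code mult_dvd_mono dvd_refl not_gr_zero power_Suc)
  have "\<exists>P1 P2. fps_X * pb (fps_of_poly P1, fps_of_poly P2) \<noteq> 0 \<and>
    subdegree (fps_X * pb (fps_of_poly P1, fps_of_poly P2)) = s \<and>
    (\<forall>c. admissible (Q1 - smult (fps_const c) P1) (Q2 - smult (fps_const c) P2))"
  proof (cases "a = 0")
    case False
    define P where "P = monom (fps_X ^ (a - 1) :: complex fps) b"
    have pP: "pull (fps_of_poly P) = fps_X ^ (n * (a - 1)) * y ^ b"
      using n by (simp add: P_def pull_monom power_mult fps_compose_power[symmetric])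
    have "fps_X * pb (fps_of_poly P, 0) = fps_const (of_nat n) * (fps_X ^ (n * (a - 1) + n) * y ^ b)"
      unfolding X_pb pP by (simp add: pull_def power_add mult_ac)
    also have "n * (a - 1) + n = n * a" using False by (cases a) simp_all
    finally have e: "fps_X * pb (fps_of_poly P, 0) = fps_const (of_nat n) * (fps_X ^ (n * a) * y ^ b)" .
    have "fps_X * pb (fps_of_poly P, 0) \<noteq> 0" "subdegree (fps_X * pb (fps_of_poly P, 0)) = s"
      unfolding e using n subdegree_y by (simp_all add: ab subdegree_mult subdegree_power)
    moreover have "admissible (Q1 - smult (fps_const c) P) Q2" for c
      unfolding P_def using admissible_diff_dx[OF adm _ ab(2) _ nm, of a c] False snm ab(1) by simp
    ultimately show ?thesis by (intro exI[of _ P] exI[of _ 0]) simp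
  next
    case True
    \<comment> \<open>Values of the family exceed \<open>n + m\<close>, so \<open>m * b\<close> with
      \<open>b < 2\<close> cannot occur.\<close>
    have b: "b \<ge> 2"
    proof (rule ccontr)
      assume "\<not> b \<ge> 2"
      then have "m * b \<le> m * 1" by (intro mult_le_mono2) simp
      moreover have "s = m * b" using ab(1) True by simp
      ultimately show False using snm by linarith
    qed
    define P where "P = monom (1 :: complex fps) (b - 1)"
    have pP: "pull (fps_of_poly P) = y ^ (b - 1)" by (simp add: P_def pull_monom)
    have e: "fps_X * pb (0, fps_of_poly P) = y ^ (b - 1) * (fps_X * fps_deriv y)"
      unfolding X_pb pP by (simp add: pull_def)
    have dy0: "(fps_X * fps_deriv y) $ m \<noteq> 0" using y_nth m by (simp add: X_mult_deriv)
    then have dy1: "fps_X * fps_deriv y \<noteq> 0" by (metis fps_zero_nth)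
    have dy: "subdegree (fps_X * fps_deriv y) = m"
      using dy0 y_nth by (intro subdegreeI) (simp_all add: X_mult_deriv)
    have mb: "m * (b - 1) + m = m * b" using b by (cases b) simp_all
    have "fps_X * pb (0, fps_of_poly P) \<noteq> 0" unfolding e using dy1 subdegree_y by simp
    moreover have "subdegree (fps_X * pb (0, fps_of_poly P)) = s"
      unfolding e using dy1 subdegree_y b True
      by (subst subdegree_mult) (simp_all add: dy ab subdegree_power mult.commute[of "b - Suc 0"] mb[simplified])
    moreover have "admissible Q1 (Q2 - smult (fps_const c) P)" for c
      unfolding P_def by (rule admissible_diff_dy[OF adm b ab(2)])
    ultimately show ?thesis by (intro exI[of _ 0] exI[of _ P]) simp
  qed
  then obtain P1 P2 where P: "fps_X * pb (fps_of_poly P1, fps_of_poly P2) \<noteq> 0"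
    "subdegree (fps_X * pb (fps_of_poly P1, fps_of_poly P2)) = s"
    "\<And>c. admissible (Q1 - smult (fps_const c) P1) (Q2 - smult (fps_const c) P2)" by blast
  obtain c where "fps_X ^ Suc s dvd fps_X * pb ?w - fps_const c * (fps_X * pb (fps_of_poly P1, fps_of_poly P2))"
    using cancel_leading_term[OF ds P(1,2)] by blast
  then have "fps_X * fps_X ^ s dvd fps_X * pb (D1_form (Q1 - smult (fps_const c) P1) (Q2 - smult (fps_const c) P2))"
    unfolding pb_D1_form_diff by (simp only: right_diff_distrib mult_ac power_Suc)
  then have "enat s < form_value (fps_X ^ n) y (D1_form (Q1 - smult (fps_const c) P1) (Q2 - smult (fps_const c) P2))"
    unfolding form_value_less_iff by simp
  with P(3) show ?thesis by blast
qed

end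

section \<open>Convergence under rotation, and traces\<close>

lemma conv_radius_sum_pos: "(\<And>i. i \<in> A \<Longrightarrow> fps_conv_radius (f i :: complex fps) > 0) \<Longrightarrow> fps_conv_radius (sum f A) > 0"
  by (induction A rule: infinite_finite_induct) (auto intro: conv_radius_add_pos)

lemma conv_radius_power_pos: "fps_conv_radius f > 0 \<Longrightarrow> fps_conv_radius ((f :: complex fps) ^ k) > 0"
  using fps_conv_radius_power[of f k] by (rule less_le_trans[rotated])

lemma conv_radius_bound:
  assumes "fps_conv_radius (f :: complex fps) > 0"
  obtains C K where "C \<ge> 0" "K \<ge> 1" "\<And>i. norm (f $ i) \<le> C * K ^ i"
proof -
  obtain C K where CK: "\<And>i. norm (f $ i) \<le> C * K ^ i" using assms by (auto simp: fps_conv_radius_pos_iff)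
  show ?thesis
  proof (rule that[of "\<bar>C\<bar>" "max 1 \<bar>K\<bar>"])
    fix i
    have "norm (f $ i) \<le> \<bar>C\<bar> * \<bar>K\<bar> ^ i"
      using CK[of i] by (simp add: abs_mult[symmetric] power_abs[symmetric])
    also have "\<dots> \<le> \<bar>C\<bar> * max 1 \<bar>K\<bar> ^ i" by (intro mult_left_mono power_mono) auto
    finally show "norm (f $ i) \<le> \<bar>C\<bar> * max 1 \<bar>K\<bar> ^ i" .
  qed auto
qed

lemma conv_radius_ramify_pos:
  assumes "N > 0" "fps_conv_radius f > 0"
  shows "fps_conv_radius (f oo fps_X ^ N :: complex fps) > 0"
proof -
  obtain C K where CK: "C \<ge> 0" "K \<ge> 1" "\<And>i. norm (f $ i) \<le> C * K ^ i"
    using conv_radius_bound[OF assms(2)] by blast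
  have "norm ((f oo fps_X ^ N) $ i) \<le> C * K ^ i" for i
  proof (cases "N dvd i")
    case True
    have "norm (f $ (i div N)) \<le> C * K ^ (i div N)" by (rule CK)
    also have "\<dots> \<le> C * K ^ i" using CK by (intro mult_left_mono power_increasing) auto
    finally show ?thesis using True assms(1) by (simp add: compose_X_power_nth)
  qed (use CK assms(1) in \<open>simp add: compose_X_power_nth\<close>)
  then show ?thesis unfolding fps_conv_radius_pos_iff by blast
qed

lemma conv_radius_section1_pos:
  assumes "fps_conv_radius f > 0"
  shows "fps_conv_radius (section1 N k f) > 0"
proof -
  obtain C K where CK: "C \<ge> 0" "K \<ge> 1" "\<And>i. norm (f $ i) \<le> C * K ^ i"
    using conv_radius_bound[OF assms] by blast
  have "norm (section1 N k f $ i) \<le> (C * K ^ k) * (K ^ N) ^ i" for i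
    using CK(3)[of "N * i + k"] by (simp add: section1_def power_add power_mult mult_ac)
  then show ?thesis unfolding fps_conv_radius_pos_iff by blast
qed

lemma conv_radius_rotate_pos:
  assumes "fps_conv_radius f > 0" shows "fps_conv_radius (rotate_fps n i f) > 0"
proof -
  have "norm (root_of_unity n) = 1" by (simp add: root_of_unity_def)
  then have "norm (rotate_fps n i f $ k) = norm (f $ k)" for k
    by (simp add: rotate_fps_nth norm_mult norm_power)
  then show ?thesis using assms by (simp add: fps_conv_radius_pos_iff)
qed

lemma conv_radius_deriv_pos: "fps_conv_radius f > 0 \<Longrightarrow> fps_conv_radius (fps_deriv f :: complex fps) > 0"
  using fps_conv_radius_deriv[of f] by auto

lemma conv_polys_mult: "p \<in> conv_polys \<Longrightarrow> q \<in> conv_polys \<Longrightarrow> p * q \<in> conv_polys"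
  by (simp add: conv_polys_def coeff_mult conv_radius_sum_pos conv_radius_mult_pos)

lemma conv_polys_prod_roots:
  "\<forall>z\<in>set zs. fps_conv_radius z > 0 \<Longrightarrow> (\<Prod>z\<leftarrow>zs. [:- z, 1:]) \<in> conv_polys"
proof (induction zs)
  case Nil
  have "coeff (1 :: complex fps poly) j = (if j = 0 then 1 else 0)" for j by (simp add: coeff_1)
  then show ?case by (simp add: conv_polys_def)
next
  case (Cons z zs)
  have "[:- z, 1:] \<in> conv_polys" using Cons.prems by (simp add: conv_polys_def coeff_pCons split: nat.splits)
  then show ?case using Cons by (simp add: conv_polys_mult del: mult_pCons_left)
qed

definition rotate_poly :: "nat \<Rightarrow> nat \<Rightarrow> complex fps poly \<Rightarrow> complex fps poly" where
  "rotate_poly n i p = map_poly (rotate_fps n i) p"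

lemma coeff_rotate_poly: "coeff (rotate_poly n i p) j = rotate_fps n i (coeff p j)"
  by (simp add: rotate_poly_def coeff_map_poly)

lemma rotate_fps_sum: "rotate_fps n i (\<Sum>k\<in>A. f k) = (\<Sum>k\<in>A. rotate_fps n i (f k))"
  by (simp add: rotate_fps_def fps_compose_sum_distrib)

lemma rotate_poly_mult: "rotate_poly n i (p * q) = rotate_poly n i p * rotate_poly n i q"
  by (rule poly_eqI) (simp add: coeff_rotate_poly coeff_mult rotate_fps_sum rotate_fps_mult)

lemma rotate_fps_const [simp]: "rotate_fps n i (fps_const c) = fps_const c"
  by (simp add: rotate_fps_def)

lemma rotate_fps_1 [simp]: "rotate_fps n i 1 = 1"
  using rotate_fps_const[of n i 1] by simp

lemma rotate_poly_linear: "rotate_poly n i [:- z, 1:] = [:- rotate_fps n i z, 1:]"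
proof (rule poly_eqI)
  have "rotate_fps n i (- z) = - rotate_fps n i z" by (simp add: rotate_fps_def fps_compose_uminus)
  then show "coeff (rotate_poly n i [:- z, 1:]) j = coeff [:- rotate_fps n i z, 1:] j" for j
    by (auto simp: coeff_rotate_poly coeff_pCons split: nat.splits)
qed

lemma rotate_poly_prod:
  "rotate_poly n i (\<Prod>k\<in>A. [:- f k, 1:]) = (\<Prod>k\<in>A. [:- rotate_fps n i (f k), 1:])"
proof (induction A rule: infinite_finite_induct)
  case empty
  show ?case by (rule poly_eqI) (simp add: coeff_rotate_poly coeff_1)
next
  case (infinite A)
  then show ?case by (simp, intro poly_eqI) (simp add: coeff_rotate_poly coeff_1)
next
  case (insert x A)
  then show ?case by (simp add: rotate_poly_mult rotate_poly_linear del: mult_pCons_left)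
qed

lemma rotate_fps_rotate_fps: "rotate_fps n i (rotate_fps n j f) = rotate_fps n (i + j) f"
  by (rule fps_ext) (simp add: rotate_fps_nth power_add distrib_right mult.assoc)

lemma rotate_invariant_descends:
  assumes n: "n > 0" and "rotate_fps n 1 f = f"
  shows "section1 n 0 f oo fps_X ^ n = f"
proof (rule fps_ext)
  fix k
  have "root_of_unity n ^ k * f $ k = f $ k"
    using arg_cong[OF assms(2), of "\<lambda>f. f $ k"] by (simp add: rotate_fps_nth)
  then have "n dvd k \<or> f $ k = 0" using root_of_unity_power_eq_1_iff[OF n, of k] by auto
  then show "(section1 n 0 f oo fps_X ^ n) $ k = f $ k"
    using n by (auto simp: compose_X_power_nth section1_def)
qed

lemma sum_roots_of_unity:
  assumes n: "n > 0" shows "(\<Sum>i<n. root_of_unity n ^ (i * k)) = (if n dvd k then of_nat n else 0)"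
proof -
  let ?w = "root_of_unity n ^ k"
  have s: "(\<Sum>i<n. root_of_unity n ^ (i * k)) = (\<Sum>i<n. ?w ^ i)"
    by (simp add: power_mult[symmetric] mult.commute)
  show ?thesis
  proof (cases "n dvd k")
    case True
    then have "?w = 1" using root_of_unity_power_eq_1_iff[OF n] by simp
    then show ?thesis using True unfolding s by simp
  next
    case False
    then have w: "?w \<noteq> 1" using root_of_unity_power_eq_1_iff[OF n] by simp
    have "?w ^ n = 1"
      using root_of_unity_power_eq_1_iff[OF n, of "k * n"] by (simp add: power_mult)
    then show ?thesis using False w unfolding s by (simp add: geometric_sum)
  qed
qed

text \<open>The trace to the series in \<open>t ^ n\<close>, evaluated by orthogonality of the
  characters of the cyclic group.\<close>

lemma trace_eq:
  assumes n: "n > 0"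
  shows "(\<Sum>i<n. rotate_fps n i f) = fps_const (of_nat n) * (section1 n 0 f oo fps_X ^ n)"
proof (rule fps_ext)
  fix k
  have "(\<Sum>i<n. rotate_fps n i f) $ k = (\<Sum>i<n. root_of_unity n ^ (i * k)) * f $ k"
    by (simp add: fps_sum_nth rotate_fps_nth sum_distrib_right)
  also have "\<dots> = (fps_const (of_nat n) * (section1 n 0 f oo fps_X ^ n)) $ k"
    unfolding sum_roots_of_unity[OF n] using n by (auto simp: compose_X_power_nth section1_def)
  finally show "(\<Sum>i<n. rotate_fps n i f) $ k = (fps_const (of_nat n) * (section1 n 0 f oo fps_X ^ n)) $ k" .
qed

context branch begin

text \<open>The truncation of \<open>y\<close> below \<open>\<beta>\<close> involves only powers of
  \<open>t ^ gcd n m\<close>, so its rotations repeat with period \<open>n1\<close> and the product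
  over one period descends to series in \<open>x\<close>. On the curve the factor of the truncation
  itself has order at least \<open>\<beta>\<close>, the others at least \<open>m\<close>.\<close>

lemma approximate_root:
  assumes b: "no_other_up_to \<beta> y"
  shows "\<exists>f. lead_coeff f = 1 \<and> degree f = n div gcd n m \<and>
    fps_X ^ (\<beta> + (n div gcd n m - 1) * m) dvd pull (fps_of_poly f)"
proof -
  define n1 where "n1 = n div gcd n m"
  have nn: "n = gcd n m * n1" by (simp add: n1_def)
  have n1: "n1 > 0" using n nn by (metis gr0I mult_0_right)
  define y1 where "y1 = Abs_fps (\<lambda>k. if k < \<beta> then y $ k else 0)"
  define r where "r = (\<lambda>i. rotate_fps n i y1)"
  have r1: "rotate_fps n 1 (r i) = r (Suc i)" for i by (simp add: r_def rotate_fps_rotate_fps)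
  \<comment> \<open>For \<open>gcd n m dvd k\<close>, rotation by \<open>n1\<close> steps multiplies
    \<open>t ^ k\<close> by \<open>\<zeta> ^ (n1 * k) = 1\<close>.\<close>
  have rn: "r n1 = r 0"
  proof (rule fps_ext)
    fix k
    show "r n1 $ k = r 0 $ k"
    proof (cases "y1 $ k = 0")
      case False
      then have "k < \<beta>" "y $ k \<noteq> 0" by (auto simp: y1_def split: if_splits)
      then have "gcd n m dvd k" using b by (auto simp: no_other_up_to_def)
      then have "gcd n m * n1 dvd k * n1" by (rule mult_dvd_mono) simp
      then have "n dvd n1 * k" unfolding nn[symmetric] by (simp only: mult.commute)
      then have "root_of_unity n ^ (n1 * k) = 1"
        using root_of_unity_power_eq_1_iff[OF n] by blast
      then show ?thesis by (simp add: r_def rotate_fps_nth)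
    qed (simp add: r_def rotate_fps_nth)
  qed
  define q where "q = (\<Prod>i<n1. [:- r i, 1:])"
  obtain k where k: "n1 = Suc k" using n1 by (cases n1) auto
  have "rotate_poly n 1 q = (\<Prod>i<n1. [:- r (Suc i), 1:])"
    unfolding q_def rotate_poly_prod r1 ..
  also have "\<dots> = (\<Prod>i<k. [:- r (Suc i), 1:]) * [:- r n1, 1:]" by (simp add: k)
  also have "\<dots> = [:- r 0, 1:] * (\<Prod>i<k. [:- r (Suc i), 1:])" unfolding rn by (rule mult.commute)
  also have "\<dots> = q" unfolding q_def k by (rule prod.lessThan_Suc_shift[symmetric])
  finally have inv: "rotate_poly n 1 q = q" .
  have ql: "q = (\<Prod>z\<leftarrow>map r [0..<n1]. [:- z, 1:])"
    using prod.distinct_set_conv_list[of "[0..<n1]" "\<lambda>i. [:- r i, 1:]"]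
    by (simp add: q_def o_def atLeast0LessThan)
  have dq: "degree q = n1" unfolding ql degree_prod_roots by simp
  have "lead_coeff q = 1" unfolding ql by (rule lead_coeff_prod_roots)
  note q = this dq
  define f where "f = map_poly (section1 n 0) q"
  have cf: "coeff f j = section1 n 0 (coeff q j)" for j by (simp add: f_def coeff_map_poly)
  have rf: "ramify_poly n f = q"
  proof (rule poly_eqI)
    fix j
    have "rotate_fps n 1 (coeff q j) = coeff q j"
      using arg_cong[OF inv, of "\<lambda>p. coeff p j"] by (simp add: coeff_rotate_poly)
    then show "coeff (ramify_poly n f) j = coeff q j"
      using rotate_invariant_descends[OF n] by (simp add: coeff_ramify_poly cf)
  qed
  have "coeff q n1 = 1" using q by simp
  then have f1: "coeff f n1 = 1" using n by (intro fps_ext) (simp add: cf section1_def)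
  have df: "degree f = n1"
  proof (rule antisym)
    show "degree f \<le> n1" by (rule degree_le) (simp add: cf coeff_eq_0 q)
    show "n1 \<le> degree f" by (rule le_degree) (simp add: f1)
  qed
  have "pull (fps_of_poly f) = poly q y"
    unfolding pull_def rf[symmetric] by (rule pull_fps_of_poly[OF Xy n])
  also have "\<dots> = (\<Prod>i<n1. y - r i)" by (simp add: q_def poly_prod)
  also have "\<dots> = (y - r 0) * (\<Prod>i<k. y - r (Suc i))" unfolding k by (rule prod.lessThan_Suc_shift)
  finally have pf: "pull (fps_of_poly f) = (y - r 0) * (\<Prod>i<k. y - r (Suc i))" .
  have d0: "fps_X ^ \<beta> dvd y - r 0"
    unfolding fps_X_power_dvd_iff by (simp add: r_def y1_def)
  have di: "fps_X ^ m dvd y - r i" for i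
    using y_nth unfolding fps_X_power_dvd_iff by (simp add: r_def y1_def rotate_fps_nth)
  have "(\<Prod>i<k. fps_X ^ m) dvd (\<Prod>i<k. y - r (Suc i))" by (rule prod_dvd_prod) (rule di)
  then have "fps_X ^ \<beta> * fps_X ^ (m * k) dvd pull (fps_of_poly f)"
    unfolding pf by (intro mult_dvd_mono d0) (simp add: power_mult)
  then have "fps_X ^ (\<beta> + (n1 - 1) * m) dvd pull (fps_of_poly f)"
    by (simp add: power_add k mult.commute)
  then show ?thesis using f1 df unfolding n1_def[symmetric] by blast
qed

lemma conv_y: "fps_conv_radius y > 0"
  using puis by (simp add: primitive_puiseux_def)

lemma conv_pull: "p \<in> conv_polys \<Longrightarrow> fps_conv_radius (pull (fps_of_poly p)) > 0"
  unfolding pull_poly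
  by (intro conv_radius_sum_pos conv_radius_mult_pos conv_radius_ramify_pos conv_radius_power_pos conv_y n)
     (simp add: conv_polys_def)

lemma cofactor_props: "cofactor \<in> conv_polys" "j \<ge> n \<Longrightarrow> coeff cofactor j = 0"
proof -
  show "cofactor \<in> conv_polys" unfolding cofactor_def
    by (rule conv_polys_prod_roots) (auto simp: conjugate_def intro: conv_radius_rotate_pos conv_y)
  show "coeff cofactor j = 0" if "j \<ge> n"
    using that n degree_prod_roots[of "map conjugate [1..<n]"] by (intro coeff_eq_0) (simp add: cofactor_def)
qed

text \<open>Lagrange interpolation at the conjugates of \<open>y\<close>, written as a trace.\<close>

lemma conductor:
  assumes o: "fps_conv_radius h > 0" "fps_X ^ (n * K) dvd h"
  shows "\<exists>P\<in>conv_polys. pull (fps_of_poly P) = h * poly cofactor y \<and> (\<forall>j\<ge>n. coeff P j = 0) \<and>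
    (\<forall>i<K. \<forall>j. coeff P j $ i = 0)"
proof -
  \<comment> \<open>\<open>L\<close> is \<open>h\<close> times the quotient of the ramified
    \<open>F\<close> by \<open>Y - y\<close>, hence zero at every other conjugate of
    \<open>y\<close>; the sum of its rotations is \<open>P\<close> after ramification.\<close>
  define L where "L = smult h cofactor"
  define P where "P = (\<Sum>j\<le>degree L. monom (fps_const (of_nat n) * section1 n 0 (coeff L j)) j)"
  have cP: "coeff P j = fps_const (of_nat n) * section1 n 0 (coeff L j)" for j
    by (simp add: P_def coeff_sum_monom_fps coeff_eq_0)
  have cL: "fps_conv_radius (coeff L j) > 0" for j
    using cofactor_props(1) o(1) by (auto simp: L_def conv_polys_def intro: conv_radius_mult_pos)
  have "P \<in> conv_polys"
    unfolding conv_polys_def by (auto simp: cP intro!: conv_radius_mult_pos conv_radius_section1_pos cL)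
  moreover have "pull (fps_of_poly P) = h * poly cofactor y"
  proof -
    have "ramify_poly n P = (\<Sum>i<n. rotate_poly n i L)"
      by (rule poly_eqI) (simp add: coeff_ramify_poly cP coeff_sum coeff_rotate_poly trace_eq[OF n]
          fps_compose_mult_distrib n)
    then have "pull (fps_of_poly P) = (\<Sum>i<n. poly (rotate_poly n i L) y)"
      unfolding pull_def by (simp add: pull_fps_of_poly[OF Xy n] poly_sum)
    also have "\<dots> = (\<Sum>i\<in>{0}. poly (rotate_poly n i L) y)"
    proof (rule sum.mono_neutral_right)
      show "\<forall>i\<in>{..<n} - {0}. poly (rotate_poly n i L) y = 0"
      proof
        fix i assume i: "i \<in> {..<n} - {0}"
        \<comment> \<open>Rotation moves the linear factor to the conjugate \<open>i\<close>, while
          the ramified \<open>F\<close> is invariant and vanishes at \<open>y\<close>.\<close>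
        have "smult h (ramify_poly n F) = [:- y, 1:] * L"
          unfolding ramify_F_cofactor L_def by (rule mult_smult_right[symmetric])
        then have "rotate_poly n i (smult h (ramify_poly n F)) = [:- conjugate i, 1:] * rotate_poly n i L"
          by (simp only: rotate_poly_mult rotate_poly_linear conjugate_def)
        moreover have "poly (rotate_poly n i (smult h (ramify_poly n F))) y = 0"
        proof -
          have "rotate_poly n i (ramify_poly n F) = ramify_poly n F"
          proof (rule poly_eqI, rule fps_ext)
            fix j k
            show "coeff (rotate_poly n i (ramify_poly n F)) j $ k = coeff (ramify_poly n F) j $ k"
              using root_of_unity_power_eq_1_iff[OF n, of "i * k"] n
              by (auto simp: coeff_rotate_poly coeff_ramify_poly rotate_fps_nth compose_X_power_nth)
          qed
          then have "rotate_poly n i ([:h:] * ramify_poly n F) = rotate_poly n i [:h:] * ramify_poly n F"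
            by (simp only: rotate_poly_mult)
          then have "poly (rotate_poly n i (smult h (ramify_poly n F))) y = poly (rotate_poly n i [:h:]) y * poly (ramify_poly n F) y"
            by (simp add: poly_mult)
          also have "poly (ramify_poly n F) y = 0" unfolding ramify_F_cofactor by (simp del: mult_pCons_left)
          finally show ?thesis by simp
        qed
        ultimately have "poly ([:- conjugate i, 1:] * rotate_poly n i L) y = 0" by simp
        then have "(y - conjugate i) * poly (rotate_poly n i L) y = 0"
          unfolding poly_mult by simp
        moreover have "y \<noteq> conjugate i"
          using i conjugate_eq_iff[of 0 i] by (auto dest: dvd_imp_le)
        ultimately show "poly (rotate_poly n i L) y = 0" by simp
      qed
    qed (use n in auto)
    also have "\<dots> = poly L y"
    proof -
      have "rotate_poly n 0 L = L" by (rule poly_eqI) (simp add: coeff_rotate_poly)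
      then show ?thesis by simp
    qed
    finally show ?thesis by (simp add: L_def)
  qed
  moreover have "\<forall>j\<ge>n. coeff P j = 0" using cofactor_props(2) by (simp add: cP L_def)
  moreover have "coeff P j $ i = 0" if "i < K" for i j
  proof -
    have "fps_X ^ (n * K) dvd coeff L j" using o(2) by (simp add: L_def)
    then show ?thesis using that n by (simp add: fps_X_power_dvd_iff cP section1_def)
  qed
  ultimately show ?thesis by blast
qed

text \<open>A form \<open>P dx\<close> with the same pullback is subtracted: the pullback is divided
  by \<open>x' * F_y\<close> on the curve, and \<open>conductor\<close> interpolates. As
  \<open>gcd n m = 1\<close>, its degree bound \<open>n\<close> is the one for
  \<open>Q1\<close>.\<close>

lemma annihilating_form:
  assumes g: "gcd n m = 1"
  shows "\<exists>K. \<forall>Q1 Q2. admissible Q1 Q2 \<and> fps_X ^ K dvd pb (D1_form Q1 Q2) \<longrightarrow>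
    (\<exists>Q1. admissible Q1 Q2 \<and> pb (D1_form Q1 Q2) = 0)"
proof -
  define c where "c = fps_deriv (fps_X ^ n) * poly cofactor y"
  define \<delta> where "\<delta> = subdegree c"
  have dX: "fps_deriv (fps_X ^ n) = fps_const (of_nat n) * (fps_X ^ (n - 1) :: complex fps)"
    by (simp add: fps_deriv_power fps_of_nat)
  have c0: "c \<noteq> 0" using poly_cofactor_nonzero n by (simp add: c_def dX)
  define u where "u = fps_shift \<delta> c"
  have cu: "c = fps_X ^ \<delta> * u"
    unfolding u_def \<delta>_def by (subst subdegree_decompose[of c]) (rule mult.commute)
  have u0: "u $ 0 \<noteq> 0" using c0 by (simp add: u_def \<delta>_def)
  have cof: "fps_conv_radius (poly cofactor y) > 0"
    unfolding poly_altdef using cofactor_props(1)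
    by (intro conv_radius_sum_pos conv_radius_mult_pos conv_radius_power_pos conv_y) (simp add: conv_polys_def)
  have conv_c: "fps_conv_radius c > 0" unfolding c_def dX
    by (intro conv_radius_mult_pos cof) simp_all
  have conv_u: "fps_conv_radius u > 0" using conv_c by (simp add: u_def)
  show ?thesis
  \<comment> \<open>\<open>\<delta>\<close> pays for the division by \<open>c\<close>. The surplus
    \<open>n * (m + 2)\<close> gives \<open>P\<close> order at least \<open>m + 2\<close> in
    \<open>x\<close>, enough for all order conditions on \<open>Q1\<close>.\<close>
  proof (intro exI[of _ "\<delta> + n * (m + 2)"] allI impI)
    fix Q1 Q2 assume "admissible Q1 Q2 \<and> fps_X ^ (\<delta> + n * (m + 2)) dvd pb (D1_form Q1 Q2)"
    then have adm: "admissible Q1 Q2" and dv: "fps_X ^ (\<delta> + n * (m + 2)) dvd pb (D1_form Q1 Q2)" by auto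
    obtain w where w: "pb (D1_form Q1 Q2) = fps_X ^ (\<delta> + n * (m + 2)) * w" using dv ..
    have conv_pb: "fps_conv_radius (pb (D1_form Q1 Q2)) > 0"
    proof -
      have "Q1 \<in> conv_polys" "Q2 \<in> conv_polys" using adm by (auto simp: admissible_def)
      then show ?thesis unfolding D1_form_def pb_pair pull_D1 dX
        by (intro conv_radius_add_pos conv_radius_diff_pos conv_radius_mult_pos conv_pull conv_radius_deriv_pos conv_y) simp_all
    qed
    have "w = fps_shift (\<delta> + n * (m + 2)) (pb (D1_form Q1 Q2))"
      by (rule fps_ext) (simp add: w fps_X_power_mult_nth)
    then have conv_w: "fps_conv_radius w > 0" using conv_pb by simp
    define h where "h = fps_X ^ (n * (m + 2)) * (w * inverse u)"
    have "fps_conv_radius (fps_X ^ (n * (m + 2)) :: complex fps) > 0" by simp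
    then have hc: "fps_conv_radius h > 0" unfolding h_def
      by (rule conv_radius_mult_pos[OF _ conv_radius_mult_pos[OF conv_w fps_conv_radius_inverse_pos[OF u0 conv_u]]])
    have hd: "fps_X ^ (n * (m + 2)) dvd h" unfolding h_def by (rule dvd_triv_left)
    obtain P where P: "P \<in> conv_polys" "pull (fps_of_poly P) = h * poly cofactor y"
      and P34: "\<forall>j\<ge>n. coeff P j = 0" "\<forall>i<m + 2. \<forall>j. coeff P j $ i = 0"
      using conductor[OF hc hd] by blast
    have P: "P \<in> conv_polys" "pull (fps_of_poly P) = h * poly cofactor y"
      "\<And>j. j \<ge> n \<Longrightarrow> coeff P j = 0" "\<And>i j. i < m + 2 \<Longrightarrow> coeff P j $ i = 0"
      using P P34 by simp_all
    have "pull (fps_of_poly P) * fps_deriv (fps_X ^ n) = h * c" by (simp add: P(2) c_def)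
    also have "\<dots> = fps_X ^ (\<delta> + n * (m + 2)) * w * (u * inverse u)"
      by (simp only: h_def cu power_add mult_ac)
    also have "u * inverse u = 1" using u0 by (simp add: inverse_mult_eq_1')
    finally have eq: "pull (fps_of_poly P) * fps_deriv (fps_X ^ n) = pb (D1_form Q1 Q2)" by (simp add: w)
    have "pb (D1_form (Q1 - P) Q2) = pb (D1_form Q1 Q2) - pull (fps_of_poly P) * fps_deriv (fps_X ^ n)"
      unfolding D1_form_def pb_pair fps_of_poly_diff pull_D1 pull_diff by (simp add: algebra_simps)
    then have "pb (D1_form (Q1 - P) Q2) = 0" by (simp add: eq)
    moreover have "admissible (Q1 - P) Q2"
      unfolding admissible_def
    proof (intro conjI allI impI)
      show "m < n * i" if "coeff (Q1 - P) 0 $ i \<noteq> 0" for i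
      proof (cases "i < m + 2")
        case True
        then show ?thesis using that P(4) adm by (auto simp: admissible_def)
      next
        case False
        then have "1 * (m + 2) \<le> n * i" using n by (intro mult_le_mono) auto
        then show ?thesis by simp
      qed
    qed (use adm P g in \<open>auto simp: admissible_def intro: conv_polys_diff\<close>)
    ultimately show "\<exists>Q1. admissible Q1 Q2 \<and> pb (D1_form Q1 Q2) = 0" by blast
  qed
qed

section \<open>Existence of a maximal form and the two maxima\<close>

lemma D1_form_in_forms: "admissible Q1 Q2 \<Longrightarrow> D1_form Q1 Q2 \<in> forms"
  unfolding D1_form_def forms_def
  by (auto simp: admissible_def intro!: conv_add conv_uminus conv_mult conv_fps_of_poly)

lemma admissible_0: "admissible 0 0"
  by (simp add: admissible_def conv_polys_def)

lemma one_less_div_gcd: "gcd n m < n \<Longrightarrow> 1 < n div gcd n m"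
proof (rule ccontr)
  assume g: "gcd n m < n" and "\<not> 1 < n div gcd n m"
  then have "gcd n m * (n div gcd n m) \<le> gcd n m * 1" by (intro mult_le_mono2) simp
  then show False using g by simp
qed

text \<open>Otherwise \<open>improve_form\<close> raises every value that is small for a suitable
  monic \<open>f\<close>. Either the values are bounded and the largest one is raised, or they are
  unbounded and a form vanishing on the curve appears.\<close>

lemma exists_maximal_form:
  assumes nm: "n < m" and g: "gcd n m < n"
  shows "\<exists>Q1 Q2. admissible Q1 Q2 \<and> (form_value (fps_X ^ n) y (D1_form Q1 Q2) = \<infinity> \<or>
    form_value (fps_X ^ n) y (D1_form Q1 Q2) \<notin> value_semigroup FF)"
proof (rule ccontr)
  let ?v = "\<lambda>Q1 Q2. form_value (fps_X ^ n) y (D1_form Q1 Q2)"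
  assume no: "\<not> ?thesis"
  have fin: "\<exists>s. ?v Q1 Q2 = enat s \<and> (\<exists>h. pull h \<noteq> 0 \<and> subdegree (pull h) = s)" if "admissible Q1 Q2" for Q1 Q2
    using no that value_semigroup_iff by (metis enat.exhaust)
  have imp: "\<exists>Q1 Q2. admissible Q1 Q2 \<and> enat s < ?v Q1 Q2"
    if adm: "admissible Q1 Q2" and s: "?v Q1 Q2 = enat s" and f: "lead_coeff f = 1" "degree f = n div gcd n m"
      "fps_X ^ B dvd pull (fps_of_poly f)" and B: "s < B" for Q1 Q2 s f B
  proof -
    obtain h where h: "pull h \<noteq> 0" "subdegree (pull h) = s" using fin[OF adm] s by auto
    then obtain a b where "b < n div gcd n m" "s = n * a + m * b" using small_value[OF f h(1)] B by auto
    then show ?thesis using improve_form[OF nm adm s] by blast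
  qed
  show False
  proof (cases "gcd n m = 1")
    case True
    have large: "\<exists>Q1 Q2. admissible Q1 Q2 \<and> enat k < ?v Q1 Q2" for k
    proof (induction k)
      case 0
      obtain s where s: "?v 0 0 = enat s" using fin[OF admissible_0] by blast
      have "pb (D1_form 0 0) \<noteq> 0" using s by (auto simp: form_value_zero)
      then have "enat 0 < ?v 0 0" by (simp add: form_value_eq)
      then show ?case using admissible_0 by blast
    next
      case (Suc k)
      then obtain Q1 Q2 where Q: "admissible Q1 Q2" "enat k < ?v Q1 Q2" by blast
      obtain s where s: "?v Q1 Q2 = enat s" using fin[OF Q(1)] by blast
      \<comment> \<open>\<open>F\<close> itself serves as \<open>f\<close>: its degree is
        \<open>n div gcd n m = n\<close> and its pullback is zero, so every \<open>s\<close> counts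
        as small.\<close>
      have "fps_X ^ Suc s dvd pull FF" by (simp add: F_pull)
      from imp[OF Q(1) s leadF _ this] obtain R1 R2 where R: "admissible R1 R2" "enat s < ?v R1 R2"
        using True degF by auto
      have "enat (Suc k) \<le> enat s" using Q(2) s by simp
      then show ?case using R by (meson le_less_trans)
    qed
    obtain K where K: "\<And>Q1 Q2. admissible Q1 Q2 \<Longrightarrow> fps_X ^ K dvd pb (D1_form Q1 Q2) \<Longrightarrow>
      \<exists>Q1. admissible Q1 Q2 \<and> pb (D1_form Q1 Q2) = 0" using annihilating_form[OF True] by blast
    obtain Q1 Q2 where "admissible Q1 Q2" "enat K < ?v Q1 Q2" using large by blast
    then obtain R where "admissible R Q2" "pb (D1_form R Q2) = 0"
      using K form_value_less_iff by blast
    then show False using no form_value_zero by blast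
  next
    case False
    have "\<exists>k. y $ k \<noteq> 0 \<and> \<not> gcd n m dvd k"
    proof (rule ccontr)
      assume "\<nexists>k. y $ k \<noteq> 0 \<and> \<not> gcd n m dvd k"
      then have "gcd n m dvd Gcd (insert n {k. y $ k \<noteq> 0})" by (intro Gcd_greatest) auto
      also have "Gcd (insert n {k. y $ k \<noteq> 0}) = 1" using puis by (simp only: primitive_puiseux_def)
      finally have "gcd n m dvd 1" .
      then show False using False by simp
    qed
    then obtain \<beta> where \<beta>: "y $ \<beta> \<noteq> 0" "\<not> gcd n m dvd \<beta>" and min: "\<And>k. k < \<beta> \<Longrightarrow> \<not> (y $ k \<noteq> 0 \<and> \<not> gcd n m dvd k)"
      using exists_least_iff[of "\<lambda>k. y $ k \<noteq> 0 \<and> \<not> gcd n m dvd k"] by blast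
    have nb: "no_other_up_to \<beta> y" using min by (auto simp: no_other_up_to_def)
    have le: "s \<le> n + \<beta>" if adm: "admissible Q1 Q2" and s: "?v Q1 Q2 = enat s" for Q1 Q2 s
    proof -
      have "(fps_X * pb (D1_form Q1 Q2)) $ (n + \<beta>) \<noteq> 0"
        unfolding D1_form_def by (rule D1_pb_nth[OF admissible_weight[OF nm adm] \<beta> nb])
      moreover have pz: "pb (D1_form Q1 Q2) \<noteq> 0" using s by (auto simp: form_value_zero)
      ultimately have "subdegree (fps_X * pb (D1_form Q1 Q2)) \<le> n + \<beta>" by (intro subdegree_leI)
      then show ?thesis using s pz by (simp add: form_value_eq)
    qed
    define S where "S = {s. \<exists>Q1 Q2. admissible Q1 Q2 \<and> ?v Q1 Q2 = enat s}"
    have S: "finite S" "S \<noteq> {}"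
    proof -
      have "S \<subseteq> {..n + \<beta>}" using le by (auto simp: S_def)
      then show "finite S" by (rule finite_subset) simp
      show "S \<noteq> {}" using fin[OF admissible_0] admissible_0 unfolding S_def by blast
    qed
    obtain Q1 Q2 where Q: "admissible Q1 Q2" "?v Q1 Q2 = enat (Max S)"
      using Max_in[OF S] unfolding S_def by blast
    obtain f where f: "lead_coeff f = 1" "degree f = n div gcd n m"
      "fps_X ^ (\<beta> + (n div gcd n m - 1) * m) dvd pull (fps_of_poly f)" using approximate_root[OF nb] by blast
    \<comment> \<open>The order of \<open>f\<close> on the curve exceeds every value of the family,
      since \<open>n + \<beta> < m + \<beta>\<close> and \<open>n div gcd n m - 1\<close> is at
      least \<open>1\<close>.\<close>
    have "n div gcd n m > 1" by (rule one_less_div_gcd[OF g])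
    then have "1 * m \<le> (n div gcd n m - 1) * m" by (intro mult_le_mono1) simp
    then have "Max S < \<beta> + (n div gcd n m - 1) * m" using le[OF Q] nm by linarith
    from imp[OF Q f this] obtain R1 R2 where R: "admissible R1 R2" "enat (Max S) < ?v R1 R2" by blast
    obtain s where s: "?v R1 R2 = enat s" using fin[OF R(1)] by blast
    then have "s \<in> S" using R(1) unfolding S_def by blast
    then have "s \<le> Max S" using S(1) by (intro Max_ge)
    then show False using R(2) s by simp
  qed
qed

lemma D1_value_le:
  assumes nm: "n < m" and adm: "admissible Q1 Q2" and \<eta>: "s \<in> form_values (fps_X ^ n) y - value_semigroup FF"
  shows "form_value (fps_X ^ n) y (D1_form Q1 Q2) \<le> s"
proof -
  obtain \<eta> where "s = form_value (fps_X ^ n) y \<eta>" using \<eta> by (auto simp: form_values_def)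
  then show ?thesis using \<eta> form_value_le[OF admissible_weight[OF nm adm], of \<eta>] by (simp add: D1_form_def)
qed

text \<open>The form from \<open>exists_maximal_form\<close> either has a value outside the
  semigroup, by \<open>D1_value_le\<close> the least such value, or has infinite value, and then no
  value lies outside.\<close>

theorem zariski_invariant_maximum:
  assumes nm: "n < m" and g: "gcd n m < n"
  shows "is_maximum {ereal_of_enat (form_value (fps_X ^ n) y \<omega>) - ereal (real n) | \<omega>. \<omega> \<in> forms_D1 n m}
    (zariski_invariant FF n y)"
proof -
  let ?v = "\<lambda>Q1 Q2. form_value (fps_X ^ n) y (D1_form Q1 Q2)"
  let ?D = "form_values (fps_X ^ n) y - value_semigroup FF"
  have S: "{ereal_of_enat (form_value (fps_X ^ n) y \<omega>) - ereal (real n) | \<omega>. \<omega> \<in> forms_D1 n m} =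
    {ereal_of_enat (?v Q1 Q2) - ereal (real n) | Q1 Q2. admissible Q1 Q2}"
    unfolding forms_D1_eq[OF one_less_div_gcd[OF g]] by blast
  obtain Q1 Q2 where Q: "admissible Q1 Q2" "?v Q1 Q2 = \<infinity> \<or> ?v Q1 Q2 \<notin> value_semigroup FF"
    using exists_maximal_form[OF nm g] by blast
  have mem: "?v Q1 Q2 \<in> form_values (fps_X ^ n) y"
    using D1_form_in_forms[OF Q(1)] by (simp add: form_values_def)
  have "zariski_invariant FF n y = ereal_of_enat (?v Q1 Q2) - ereal (real n) \<and>
    (\<forall>R1 R2. admissible R1 R2 \<longrightarrow> ?v R1 R2 \<le> ?v Q1 Q2)"
  proof (cases "?D = {}")
    case True
    then have "?v Q1 Q2 = \<infinity>" using Q(2) mem by blast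
    then show ?thesis using True by (simp add: zariski_invariant_def)
  next
    case False
    \<comment> \<open>An infinite value would bound every element of \<open>?D\<close> from below,
      but infinity belongs to the semigroup.\<close>
    have notinf: "?v Q1 Q2 \<noteq> \<infinity>"
    proof
      assume "?v Q1 Q2 = \<infinity>"
      then have "s = \<infinity>" if "s \<in> ?D" for s using D1_value_le[OF nm Q(1) that] by simp
      then show False using False infinity_in_value_semigroup by blast
    qed
    then have "?v Q1 Q2 \<notin> value_semigroup FF" using Q(2) by metis
    then have inD: "?v Q1 Q2 \<in> ?D" using mem by simp
    have "Inf ?D = ?v Q1 Q2"
      using inD D1_value_le[OF nm Q(1)] by (intro antisym Inf_lower Inf_greatest)
    moreover have "zariski_invariant FF n y = ereal_of_enat (Inf ?D) - ereal (real n)"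
      using False by (simp add: zariski_invariant_def Let_def)
    ultimately show ?thesis using D1_value_le[OF nm _ inD] by simp
  qed
  then show ?thesis unfolding S is_maximum_def using Q(1)
    by (auto intro!: ereal_minus_mono)
qed

text \<open>The order of the wedge coefficient is
  \<open>(\<mu> + n - 1) + ord (pb \<omega>) - (n - 1)\<close>, and the value of the form is
  \<open>ord (pb \<omega>) + 1\<close>. If the pullback vanishes, both sides are infinite.\<close>

lemma wedge_value:
  assumes w: "\<omega> \<in> forms"
  shows "ereal_of_enat (intersection_mult FF (wedge_coeff \<omega> (differential FF)))
              - (ereal_of_enat (milnor_number FF) + ereal (real n) - 1) =
    ereal_of_enat (form_value (fps_X ^ n) y \<omega>) - ereal (real n)"
proof -
  obtain A B where AB: "\<omega> = (A, B)" by (cases \<omega>)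
  let ?W = "wedge_coeff \<omega> (differential FF)"
  have W: "?W = A * partial_y FF - B * partial_x FF" by (simp add: wedge_coeff_def differential_def AB)
  have convW: "?W \<in> conv_series" using w convF unfolding W by (auto simp: forms_def AB)
  obtain \<mu> where mu: "milnor_number FF = enat \<mu>" "subdegree (pull (partial_y FF)) = \<mu> + (n - 1)"
    using milnor_number_eq by blast
  have Fy0: "pull (partial_y FF) \<noteq> 0" using pull_partial_y_F poly_cofactor_nonzero by simp
  have "pull (partial_x FF) * fps_deriv (fps_X ^ n) = - (pull (partial_y FF) * fps_deriv y)"
    using pull_deriv[of FF] by (simp add: F_pull eq_neg_iff_add_eq_0)
  then have "pull B * (pull (partial_x FF) * fps_deriv (fps_X ^ n)) = - (pull B * (pull (partial_y FF) * fps_deriv y))"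
    by simp
  then have e: "pull ?W * fps_deriv (fps_X ^ n) = pull (partial_y FF) * pb \<omega>"
    unfolding W pull_diff pull_mult unfolding AB pb_pair by (simp add: algebra_simps)
  have dX: "fps_deriv (fps_X ^ n) = fps_const (of_nat n) * (fps_X ^ (n - 1) :: complex fps)"
    by (simp add: fps_deriv_power fps_of_nat)
  have dX0: "fps_deriv (fps_X ^ n) \<noteq> (0 :: complex fps)" "subdegree (fps_deriv (fps_X ^ n) :: complex fps) = n - 1"
    using n by (simp_all add: dX subdegree_mult)
  show ?thesis
  proof (cases "pb \<omega> = 0")
    case True
    then have "pull ?W = 0" using e dX0 by simp
    then show ?thesis using True convW by (simp add: intersection_mult_eq fps_ord_def form_value_zero mu)
  next
    case False
    then have W0: "pull ?W \<noteq> 0" using e Fy0 by auto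
    have "subdegree (pull ?W * fps_deriv (fps_X ^ n)) = subdegree (pull (partial_y FF) * pb \<omega>)" by (simp only: e)
    then have "subdegree (pull ?W) = \<mu> + subdegree (pb \<omega>)"
      using W0 dX0 Fy0 False mu(2) by (simp add: subdegree_mult)
    then show ?thesis using W0 False convW mu(1) n
      by (simp add: intersection_mult_eq fps_ord_def form_value_eq one_ereal_def)
  qed
qed

end

theorem proposition4p9:
  fixes F :: "complex fps poly" and g :: nat and v :: "nat \<Rightarrow> nat" and y :: "complex fps"
  assumes "weierstrass_poly F"
    and "irreducible_in conv_polys F"
    and "degree F = v 0"
    and "series_mult (fps_of_poly F) = enat (v 0)"
    and "g \<ge> 1"
    and "minimal_generators (value_semigroup (fps_of_poly F)) g v"
    and "gcd (v 0) (v 1) < v 0"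
    and "intersection_mult (fps_of_poly F) var_x = enat (v 0)"
    and "v 0 < v 1"
    and "intersection_mult (fps_of_poly F) var_y = enat (v 1)"
    and "primitive_puiseux (fps_of_poly F) (v 0) (v 1) y"
  shows "is_maximum
           {ereal_of_enat (form_value (fps_X ^ v 0) y \<omega>) - ereal (real (v 0)) | \<omega>.
              \<omega> \<in> forms_D1 (v 0) (v 1)}
           (zariski_invariant (fps_of_poly F) (v 0) y) \<and>
         is_maximum
           {ereal_of_enat (intersection_mult (fps_of_poly F)
                (wedge_coeff \<omega> (differential (fps_of_poly F))))
              - (ereal_of_enat (milnor_number (fps_of_poly F)) + ereal (real (v 0)) - 1) | \<omega>.
              \<omega> \<in> forms_D1 (v 0) (v 1)}
           (zariski_invariant (fps_of_poly F) (v 0) y)"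
proof -
  interpret branch F "v 0" "v 1" y
    by unfold_locales (use assms in auto)
  note max = zariski_invariant_maximum[OF assms(9,7)]
  have "\<omega> \<in> forms" if "\<omega> \<in> forms_D1 (v 0) (v 1)" for \<omega>
    using that D1_form_in_forms unfolding forms_D1_eq[OF one_less_div_gcd[OF assms(7)]] by blast
  then have "{ereal_of_enat (intersection_mult FF (wedge_coeff \<omega> (differential FF)))
        - (ereal_of_enat (milnor_number FF) + ereal (real (v 0)) - 1) | \<omega>. \<omega> \<in> forms_D1 (v 0) (v 1)} =
      {ereal_of_enat (form_value (fps_X ^ v 0) y \<omega>) - ereal (real (v 0)) | \<omega>. \<omega> \<in> forms_D1 (v 0) (v 1)}"
    using wedge_value by (metis (no_types, lifting))
  with max show ?thesis by simp
qed

end
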